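(* Let $E$ be a countably generated Hilbert $C^*$-module over a $\sigma$-unital $C^*$-algebra $B$, let $D : \operatorname{Dom}(D) \to E$ be a closed, symmetric and regular unbounded operator, and let $x : E \to E$ be a bounded adjointable operator such that (1) $x(\operatorname{Dom}(D^* )) \subseteq \operatorname{Dom}(D)$ and $x^*(\operatorname{Dom}(D^* )) \subseteq \operatorname{Dom}(D)$; (2) $Dx - xD$ and $Dx^* - x^*D : \operatorname{Dom}(D) \to E$ extend to bounded operators $d(x)$ and $d(x^* ) : E \to E$, respectively. Put $\Delta := xx^*$. Then the localization $D_x : \operatorname{Dom}(D_x) \to E_x$ of $D$ with respect to $x$ is a selfadjoint and regular unbounded operator with core $x(\operatorname{Dom}(D)) \subseteq \operatorname{Dom}(D_x)$. Moreover, \[ (i\mu + D_x)^{-1}(\xi) = (i\mu + D\Delta - d(x)x^* )^{-1}(\xi) \] for all $\xi \in E_x$ and all $\mu \in \mathbb{R}\setminus\{0\}$. In particular, $E_x \subseteq E$ is an invariant submodule for $(i\mu + D\Delta - d(x)x^* )^{-1} : E \to E$ for all $\mu \in \mathbb{R}\setminus\{0\}$.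
   Context: A closed, densely defined unbounded operator $D : \operatorname{Dom}(D) \to E$ is regular when $D^*$ is densely defined and $1 + D^*D : \operatorname{Dom}(D^*D) \to E$ has dense range. $E_x := \operatorname{cl}(\operatorname{Im}(x)) \subseteq E$ is the norm closure of the image of $x$, a Hilbert $C^*$-submodule. The localization $D_x : \operatorname{Dom}(D_x) \to E_x$ of $D$ with respect to $x$ is the closure of the (densely defined) symmetric unbounded operator $xDx^* : \operatorname{Dom}(D) \cap E_x \to E_x$. The operator $D\Delta$ has domain $\operatorname{Dom}(D\Delta) = \{\xi \in E \mid \Delta(\xi) \in \operatorname{Dom}(D)\}$, and $D\Delta - d(x)x^* : \operatorname{Dom}(D\Delta) \to E$ is a selfadjoint and regular unbounded operator on $E$. *)

theory Defs
  imports "HOL-Analysis.Analysis"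
begin

section \<open>Complex Banach spaces and C*-algebras\<close>

class complex_normed_vector = real_normed_vector +
  fixes scaleC :: "complex \<Rightarrow> 'a \<Rightarrow> 'a"  (infixr "*\<^sub>C" 75)
  assumes scaleC_add_right: "z *\<^sub>C (a + b) = z *\<^sub>C a + z *\<^sub>C b"
    and scaleC_add_left: "(z + w) *\<^sub>C a = z *\<^sub>C a + w *\<^sub>C a"
    and scaleC_scaleC: "z *\<^sub>C (w *\<^sub>C a) = (z * w) *\<^sub>C a"
    and scaleR_scaleC: "r *\<^sub>R a = complex_of_real r *\<^sub>C a"
    and norm_scaleC: "norm (z *\<^sub>C a) = cmod z * norm a"

class complex_banach = complex_normed_vector + banach

text \<open>C*-algebras are not assumed to be unital.\<close>

class cstar_algebra = complex_banach + real_normed_algebra +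
  fixes star :: "'a \<Rightarrow> 'a"
  assumes scaleC_mult_left: "(z *\<^sub>C a) * b = z *\<^sub>C (a * b)"
    and scaleC_mult_right: "a * (z *\<^sub>C b) = z *\<^sub>C (a * b)"
    and star_add: "star (a + b) = star a + star b"
    and star_scaleC: "star (z *\<^sub>C a) = cnj z *\<^sub>C star a"
    and star_mult: "star (a * b) = star b * star a"
    and star_star: "star (star a) = a"
    and cstar_identity: "norm (star a * a) = (norm a)\<^sup>2"

definition positive :: "'b::cstar_algebra \<Rightarrow> bool" where
  "positive a \<longleftrightarrow> (\<exists>b. a = star b * b)"

text \<open>A C*-algebra is sigma-unital if it has a countable approximate unit.\<close>

definition sigma_unital :: "'b::cstar_algebra itself \<Rightarrow> bool" where
  "sigma_unital _ \<longleftrightarrow> (\<exists>u :: nat \<Rightarrow> 'b.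
     (\<forall>n. positive (u n) \<and> norm (u n) \<le> 1) \<and>
     (\<forall>b. (\<lambda>n. u n * b) \<longlonglongrightarrow> b) \<and> (\<forall>b. (\<lambda>n. b * u n) \<longlonglongrightarrow> b))"

section \<open>Hilbert C*-modules\<close>

text \<open>
  A right Hilbert module over the C*-algebra \<open>'b\<close>, carried by the whole type \<open>'e\<close>. The
  inner product is linear in its second argument. Completeness is part of the sort of \<open>'e\<close>,
  whose norm is required to be the one induced by the inner product.
\<close>

locale hilbert_module =
  fixes act :: "'e::complex_banach \<Rightarrow> 'b::cstar_algebra \<Rightarrow> 'e"
    and ip :: "'e \<Rightarrow> 'e \<Rightarrow> 'b"
  assumes act_add_left: "act (\<xi> + \<eta>) b = act \<xi> b + act \<eta> b"
    and act_add_right: "act \<xi> (b + c) = act \<xi> b + act \<xi> c"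
    and act_mult: "act \<xi> (b * c) = act (act \<xi> b) c"
    and act_scaleC_left: "act (z *\<^sub>C \<xi>) b = z *\<^sub>C act \<xi> b"
    and act_scaleC_right: "act \<xi> (z *\<^sub>C b) = z *\<^sub>C act \<xi> b"
    and ip_add_right: "ip \<xi> (\<eta> + \<zeta>) = ip \<xi> \<eta> + ip \<xi> \<zeta>"
    and ip_scaleC_right: "ip \<xi> (z *\<^sub>C \<eta>) = z *\<^sub>C ip \<xi> \<eta>"
    and ip_act_right: "ip \<xi> (act \<eta> b) = ip \<xi> \<eta> * b"
    and star_ip: "star (ip \<xi> \<eta>) = ip \<eta> \<xi>"
    and ip_positive: "positive (ip \<xi> \<xi>)"
    and ip_definite: "ip \<xi> \<xi> = 0 \<Longrightarrow> \<xi> = 0"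
    and norm_ip: "norm \<xi> = sqrt (norm (ip \<xi> \<xi>))"

definition submodule :: "('e::complex_banach \<Rightarrow> 'b::cstar_algebra \<Rightarrow> 'e) \<Rightarrow> 'e set \<Rightarrow> bool" where
  "submodule act M \<longleftrightarrow> 0 \<in> M \<and> (\<forall>\<xi>\<in>M. \<forall>\<eta>\<in>M. \<xi> + \<eta> \<in> M) \<and>
     (\<forall>\<xi>\<in>M. \<forall>z. z *\<^sub>C \<xi> \<in> M) \<and> (\<forall>\<xi>\<in>M. \<forall>b. act \<xi> b \<in> M)"

definition countably_generated :: "('e::complex_banach \<Rightarrow> 'b::cstar_algebra \<Rightarrow> 'e) \<Rightarrow> bool" where
  "countably_generated act \<longleftrightarrow>
     (\<exists>S. countable S \<and> (\<lambda>M. submodule act M \<and> closed M) hull S = UNIV)"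

definition bounded_operator ::
  "('e::complex_banach \<Rightarrow> 'b::cstar_algebra \<Rightarrow> 'e) \<Rightarrow> ('e \<Rightarrow> 'e) \<Rightarrow> bool" where
  "bounded_operator act f \<longleftrightarrow> bounded_linear f \<and>
     (\<forall>z \<xi>. f (z *\<^sub>C \<xi>) = z *\<^sub>C f \<xi>) \<and> (\<forall>\<xi> b. f (act \<xi> b) = act (f \<xi>) b)"

definition adjointable :: "('e \<Rightarrow> 'e \<Rightarrow> 'b) \<Rightarrow> ('e \<Rightarrow> 'e) \<Rightarrow> bool" where
  "adjointable ip f \<longleftrightarrow> (\<exists>g. \<forall>\<xi> \<eta>. ip (f \<xi>) \<eta> = ip \<xi> (g \<eta>))"

definition adj :: "('e \<Rightarrow> 'e \<Rightarrow> 'b) \<Rightarrow> ('e \<Rightarrow> 'e) \<Rightarrow> 'e \<Rightarrow> 'e" where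
  "adj ip f = (THE g. \<forall>\<xi> \<eta>. ip (f \<xi>) \<eta> = ip \<xi> (g \<eta>))"

section \<open>Unbounded operators\<close>

text \<open>
  Unbounded operators are represented by their graphs: \<open>Domain T\<close> is the domain of \<open>T\<close>,
  \<open>closure T\<close> (in the product topology) is its closure, the converse relation is its
  inverse, and \<open>T O S\<close> is the composition that applies \<open>T\<close> first. The predicates are
  relative to a closed submodule \<open>F\<close>, so that they apply to the whole module (\<open>F = UNIV\<close>)
  as well as to operators on a Hilbert submodule, where adjoints are formed inside \<open>F\<close>.
\<close>

type_synonym 'e op_graph = "('e \<times> 'e) set"

definition app :: "'e op_graph \<Rightarrow> 'e \<Rightarrow> 'e" where
  "app T \<xi> = (THE \<eta>. (\<xi>, \<eta>) \<in> T)"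

definition unbounded_operator_on ::
  "('e::complex_banach \<Rightarrow> 'b::cstar_algebra \<Rightarrow> 'e) \<Rightarrow> 'e set \<Rightarrow> 'e op_graph \<Rightarrow> bool" where
  "unbounded_operator_on act F T \<longleftrightarrow> T \<subseteq> F \<times> F \<and> single_valued T \<and> (0, 0) \<in> T \<and>
     (\<forall>\<xi> \<xi>' \<eta> \<eta>'. (\<xi>, \<xi>') \<in> T \<longrightarrow> (\<eta>, \<eta>') \<in> T \<longrightarrow> (\<xi> + \<eta>, \<xi>' + \<eta>') \<in> T) \<and>
     (\<forall>z \<xi> \<xi>'. (\<xi>, \<xi>') \<in> T \<longrightarrow> (z *\<^sub>C \<xi>, z *\<^sub>C \<xi>') \<in> T) \<and>
     (\<forall>b \<xi> \<xi>'. (\<xi>, \<xi>') \<in> T \<longrightarrow> (act \<xi> b, act \<xi>' b) \<in> T)"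

definition densely_defined_on :: "'e::topological_space set \<Rightarrow> 'e op_graph \<Rightarrow> bool" where
  "densely_defined_on F T \<longleftrightarrow> closure (Domain T) = F"

definition adjoint_on :: "('e \<Rightarrow> 'e \<Rightarrow> 'b) \<Rightarrow> 'e set \<Rightarrow> 'e op_graph \<Rightarrow> 'e op_graph" where
  "adjoint_on ip F T = {(\<eta>, \<zeta>). \<eta> \<in> F \<and> \<zeta> \<in> F \<and> (\<forall>(\<xi>, \<xi>')\<in>T. ip \<xi>' \<eta> = ip \<xi> \<zeta>)}"

definition symmetric_on :: "('e \<Rightarrow> 'e \<Rightarrow> 'b) \<Rightarrow> 'e set \<Rightarrow> 'e op_graph \<Rightarrow> bool" where
  "symmetric_on ip F T \<longleftrightarrow> T \<subseteq> adjoint_on ip F T"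

definition selfadjoint_on :: "('e \<Rightarrow> 'e \<Rightarrow> 'b) \<Rightarrow> 'e set \<Rightarrow> 'e op_graph \<Rightarrow> bool" where
  "selfadjoint_on ip F T \<longleftrightarrow> adjoint_on ip F T = T"

text \<open>\<open>op_add f T\<close> is the operator \<open>f + T\<close> with the domain of \<open>T\<close>, and
  \<open>op_comp T f\<close> is the operator \<open>T f\<close> with domain \<open>f -` Domain T\<close>.\<close>

definition op_add :: "('e::plus \<Rightarrow> 'e) \<Rightarrow> 'e op_graph \<Rightarrow> 'e op_graph" where
  "op_add f T = {(\<xi>, f \<xi> + \<eta>) |\<xi> \<eta>. (\<xi>, \<eta>) \<in> T}"

definition op_comp :: "'e op_graph \<Rightarrow> ('e \<Rightarrow> 'e) \<Rightarrow> 'e op_graph" where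
  "op_comp T f = {(\<xi>, \<eta>). (f \<xi>, \<eta>) \<in> T}"

definition regular_on ::
  "('e::real_normed_vector \<Rightarrow> 'e \<Rightarrow> 'b) \<Rightarrow> 'e set \<Rightarrow> 'e op_graph \<Rightarrow> bool" where
  "regular_on ip F T \<longleftrightarrow> closed T \<and> densely_defined_on F T \<and>
     densely_defined_on F (adjoint_on ip F T) \<and>
     closure (Range (op_add id (T O adjoint_on ip F T))) = F"

definition core :: "'e::topological_space set \<Rightarrow> 'e op_graph \<Rightarrow> bool" where
  "core C T \<longleftrightarrow> C \<subseteq> Domain T \<and> closure (T \<inter> C \<times> UNIV) = T"

definition bijective_onto :: "'e set \<Rightarrow> 'e op_graph \<Rightarrow> bool" where
  "bijective_onto F T \<longleftrightarrow> single_valued T \<and> single_valued (T\<inverse>) \<and> Range T = F"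

definition invariant_submodule ::
  "('e::complex_banach \<Rightarrow> 'b::cstar_algebra \<Rightarrow> 'e) \<Rightarrow> 'e op_graph \<Rightarrow> 'e set \<Rightarrow> bool" where
  "invariant_submodule act T M \<longleftrightarrow> submodule act M \<and> closed M \<and> T `` M \<subseteq> M"

section \<open>Localization\<close>

definition loc_module :: "('e::topological_space \<Rightarrow> 'e) \<Rightarrow> 'e set" where
  "loc_module x = closure (range x)"

text \<open>The closure of \<open>x D x\<^sup>*\<close> with domain \<open>Dom D \<inter> E\<^sub>x\<close>, meaningful when
  the adjoint of \<open>x\<close> maps \<open>Dom D\<close> into itself.\<close>

definition localization ::
  "('e::topological_space \<Rightarrow> 'e \<Rightarrow> 'b) \<Rightarrow> ('e \<Rightarrow> 'e) \<Rightarrow> 'e op_graph \<Rightarrow> 'e op_graph" where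
  "localization ip x D =
     closure {(\<xi>, x (app D (adj ip x \<xi>))) |\<xi>. \<xi> \<in> Domain D \<inter> loc_module x}"

end

theory Submission
  imports Defs
begin

text \<open>
  The inclusions of \<open>x (Dom D\<^sup>*)\<close> and \<open>x\<^sup>* (Dom D\<^sup>*)\<close> in \<open>Dom D\<close> say that \<open>x\<close> removes the
  difference between \<open>D\<close> and \<open>D\<^sup>*\<close>. They are exploited by doubling: the operator
  \<open>(a, b) \<mapsto> (D b, D\<^sup>* a)\<close> on \<open>E \<oplus> E\<close> is symmetric, its sum with \<open>i\<mu>\<close> is onto because \<open>D\<close> is
  regular (\<open>regular_symmetric_hat\<close>), and it still has a bounded commutator with \<open>x\<^sup>* \<oplus> x\<^sup>*\<close>,
  because \<open>D x\<^sup>* - x\<^sup>* D\<^sup>*\<close> is given by \<open>d(x\<^sup>*)\<close> on all of \<open>Dom D\<^sup>*\<close> (\<open>y_comm_adjoint\<close>).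

  The core of the proof (\<open>compression_dense_range\<close>) is therefore a statement about an operator \<open>A\<close>
  that has resolvents: if \<open>Y = X\<^sup>*\<close> has a bounded commutator with \<open>A\<close>, then \<open>i\<mu> + X A Y\<close>
  has dense range on \<open>Dom A\<close>. In a Hilbert space one would mollify a vector that is orthogonal to
  the range. In a Hilbert module orthogonality does not detect density, so approximate solutions
  are mollified instead. Resolvents give mollifiers \<open>r\<^sub>n \<rightarrow> 1\<close> with values in \<open>Dom A\<close> such that
  \<open>B\<^sub>n = A r\<^sub>n\<close> is bounded and selfadjoint. Solve \<open>(i\<mu> + X B\<^sub>n Y) \<xi>\<^sub>n = \<eta>\<close>. Then \<open>r\<^sub>n \<xi>\<^sub>n\<close> solves
  \<open>(i\<mu> + X A Y) u = \<eta>\<close> up to an error \<open>e\<^sub>n \<xi>\<^sub>n\<close> that is bounded but need not tend to \<open>0\<close> in norm.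
  However, \<open>e\<^sub>n\<^sup>* \<rightarrow> 0\<close> strongly, so the errors are weakly null, and averages of sufficiently sparse
  subsequences of them do tend to \<open>0\<close> in norm (\<open>banach_saks\<close>).

  It follows that the closure of \<open>x D x\<^sup>*\<close> does not depend on whether one starts on \<open>Dom D\<close> or on
  \<open>Dom D\<^sup>*\<close>, that its sum with \<open>i\<mu>\<close> is bijective for \<open>\<mu> \<noteq> 0\<close>, and that it equals
  \<open>D \<Delta> - d(x) x\<^sup>*\<close> (\<open>compression_formula\<close>).

  To descend to \<open>E\<^sub>x\<close>, the same result is used with the roles of \<open>x\<close> and \<open>x\<^sup>*\<close> exchanged. For large
  \<open>\<mu>\<close> the bounded perturbation \<open>d(x\<^sup>*) x\<close> does not affect it, so that \<open>i\<mu> + D x\<^sup>* x\<close> has dense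
  range on \<open>Dom D\<close>. The identity \<open>x (i\<mu> + D x\<^sup>* x) = (i\<mu> + x D x\<^sup>*) x\<close> turns this into density in \<open>E\<^sub>x\<close>
  of the range of \<open>i\<mu> + x D x\<^sup>*\<close> on \<open>x (Dom D)\<close>, and a Neumann series argument reaches all \<open>\<mu> \<noteq> 0\<close>
  (\<open>loc_core_surj\<close>). Every operator on \<open>E\<^sub>x\<close> between the closure of \<open>x D x\<^sup>*\<close> on \<open>x (Dom D)\<close> and
  \<open>D \<Delta> - d(x) x\<^sup>*\<close> then coincides with the smaller one, since adding \<open>i\<mu>\<close> makes the smaller
  one onto and the larger one injective. This identifies \<open>D\<^sub>x\<close>, its core and its resolvent, and
  surjectivity of \<open>i\<mu> + D\<^sub>x\<close> gives selfadjointness and regularity.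

  The order structure of the C*-algebra enters only through the inequality
  \<open>\<parallel>a\<^sup>* a\<parallel> \<le> \<parallel>a\<^sup>* a + b\<^sup>* b\<parallel>\<close>, which makes the norm of \<open>E \<oplus> E\<close> equivalent to the one induced by the
  inner product. The Cauchy-Schwarz inequality is used with a constant, which polarization
  provides.
\<close>

section \<open>Complex scalars and the involution\<close>

lemma scaleC_minus_left: "(- z) *\<^sub>C a = - (z *\<^sub>C (a::'a::complex_normed_vector))"
  using scaleC_add_left[of z "-z" a] scaleC_add_left[of 0 0 a]
  by (simp add: eq_neg_iff_add_eq_0 add.commute)

lemma scaleC_minus_right: "z *\<^sub>C (- a) = - (z *\<^sub>C (a::'a::complex_normed_vector))"
  using scaleC_add_right[of z a "-a"] scaleC_add_right[of z 0 "0::'a"]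
  by (simp add: eq_neg_iff_add_eq_0 add.commute)

lemma scaleC_one [simp]: "1 *\<^sub>C a = (a::'a::complex_normed_vector)"
  using scaleR_scaleC[of 1 a] by simp

lemma scaleC_zero_right [simp]: "z *\<^sub>C 0 = (0::'a::complex_normed_vector)"
  by (metis mult_zero_right norm_eq_zero norm_scaleC norm_zero)

lemma scaleC_zero_left [simp]: "0 *\<^sub>C a = (0::'a::complex_normed_vector)"
  by (metis mult_zero_left norm_eq_zero norm_scaleC norm_zero)

lemma scaleC_diff_right: "z *\<^sub>C (a - b) = z *\<^sub>C a - z *\<^sub>C (b::'a::complex_normed_vector)"
  using scaleC_add_right[of z a "-b"] by (simp add: scaleC_minus_right)

lemma scaleC_diff_left: "(z - w) *\<^sub>C a = z *\<^sub>C a - w *\<^sub>C (a::'a::complex_normed_vector)"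
  using scaleC_add_left[of z "-w" a] by (simp add: scaleC_minus_left)

lemma scaleC_scaleR: "z *\<^sub>C (r *\<^sub>R a) = r *\<^sub>R (z *\<^sub>C (a::'a::complex_normed_vector))"
  by (simp add: scaleR_scaleC scaleC_scaleC mult.commute)

lemma bounded_linear_scaleC: "bounded_linear (\<lambda>a::'a::complex_normed_vector. z *\<^sub>C a)"
  by (rule bounded_linear_intro[of _ "cmod z"])
    (simp_all add: scaleC_add_right scaleC_scaleR norm_scaleC mult.commute)

lemma star_zero [simp]: "star (0::'b::cstar_algebra) = 0"
  using star_add[of "0::'b" 0] by simp

lemma star_minus: "star (- a) = - star (a::'b::cstar_algebra)"
  using star_add[of a "- a"] by (simp add: eq_neg_iff_add_eq_0 add.commute)

lemma star_diff: "star (a - b) = star a - star (b::'b::cstar_algebra)"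
  using star_add[of a "- b"] by (simp add: star_minus)

lemma star_scaleR: "star (r *\<^sub>R a) = r *\<^sub>R star (a::'b::cstar_algebra)"
  by (simp add: scaleR_scaleC star_scaleC)

lemma norm_star: "norm (star a) = norm (a::'b::cstar_algebra)"
proof -
  have *: "norm a \<le> norm (star a)" for a :: 'b
  proof (cases "a = 0")
    case False
    have "(norm a)\<^sup>2 \<le> norm (star a) * norm a"
      using norm_mult_ineq[of "star a" a] by (simp add: cstar_identity)
    then show ?thesis using False by (simp add: power2_eq_square)
  qed simp
  show ?thesis using *[of a] *[of "star a"] by (simp add: star_star)
qed

lemma star_mult_self_eq_0: "star a * a = 0 \<longleftrightarrow> a = (0::'b::cstar_algebra)"
  using cstar_identity[of a] by auto

lemma eq_zero_if_annihilated:
  assumes "\<And>b. star b * d = (0::'b::cstar_algebra)"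
  shows "d = 0"
  using assms[of d] star_mult_self_eq_0 by blast

section \<open>Positive multipliers of a C*-algebra\<close>

text \<open>The algebra acts on itself by left multiplication, and \<open>star b * c\<close> is the inner product of this
  Hilbert module. Working with adjointable maps instead of elements supplies the unit that
  square roots of elements near the identity need.\<close>

definition adjoint_pair :: "('b::cstar_algebra \<Rightarrow> 'b) \<Rightarrow> ('b \<Rightarrow> 'b) \<Rightarrow> bool" where
  "adjoint_pair F G \<longleftrightarrow> (\<forall>b c. star (F b) * c = star b * G c)"

abbreviation selfadj :: "('b::cstar_algebra \<Rightarrow> 'b) \<Rightarrow> bool" where
  "selfadj S \<equiv> adjoint_pair S S"

lemma adjoint_pairD: "adjoint_pair F G \<Longrightarrow> star (F b) * c = star b * G c"
  by (simp add: adjoint_pair_def)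

lemma adjoint_pair_sym:
  assumes "adjoint_pair F G"
  shows "adjoint_pair G F"
  unfolding adjoint_pair_def
proof (intro allI)
  fix b c
  have "star (star (F c) * b) = star (star c * G b)"
    using assms by (simp add: adjoint_pair_def)
  then show "star (G b) * c = star b * F c"
    by (simp add: star_mult star_star)
qed

text \<open>Adjoints are linear because the inner product separates points; the same argument gives
  complex linearity below.\<close>

lemma adjoint_pair_linear:
  assumes "adjoint_pair F G"
  shows "linear G"
proof
  fix a b
  have "star c * (G (a + b) - G a - G b) = 0" for c
    by (simp add: right_diff_distrib adjoint_pairD[OF assms, symmetric] algebra_simps)
  then show "G (a + b) = G a + G b"
    using eq_zero_if_annihilated[of "G (a + b) - G a - G b"] by (simp add: algebra_simps)
next
  fix r b
  have "star c * (G (r *\<^sub>R b) - r *\<^sub>R G b) = 0" for c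
    by (simp add: right_diff_distrib adjoint_pairD[OF assms, symmetric])
  then show "G (r *\<^sub>R b) = r *\<^sub>R G b"
    using eq_zero_if_annihilated[of "G (r *\<^sub>R b) - r *\<^sub>R G b"] by simp
qed

lemma adjoint_pair_comp:
  "adjoint_pair F G \<Longrightarrow> adjoint_pair F' G' \<Longrightarrow> adjoint_pair (\<lambda>b. F (F' b)) (\<lambda>b. G' (G b))"
  by (simp add: adjoint_pair_def)

lemma adjoint_pair_add:
  "adjoint_pair F G \<Longrightarrow> adjoint_pair F' G' \<Longrightarrow> adjoint_pair (\<lambda>b. F b + F' b) (\<lambda>b. G b + G' b)"
  by (simp add: adjoint_pair_def star_add algebra_simps)

lemma adjoint_pair_diff:
  "adjoint_pair F G \<Longrightarrow> adjoint_pair F' G' \<Longrightarrow> adjoint_pair (\<lambda>b. F b - F' b) (\<lambda>b. G b - G' b)"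
  by (simp add: adjoint_pair_def star_diff algebra_simps)

lemma adjoint_pair_scaleR:
  "adjoint_pair F G \<Longrightarrow> adjoint_pair (\<lambda>b. r *\<^sub>R F b) (\<lambda>b. r *\<^sub>R G b)"
  by (simp add: adjoint_pair_def star_scaleR)

lemma selfadj_id: "selfadj (\<lambda>b. r *\<^sub>R b)"
  by (simp add: adjoint_pair_def star_scaleR)

lemma adjoint_pair_mult_left: "adjoint_pair (\<lambda>b. a * b) (\<lambda>b. star a * b)"
  by (simp add: adjoint_pair_def star_mult mult.assoc)

text \<open>The positive cone, in the form that makes it obviously closed under addition: for a
  selfadjoint element, positivity of the spectrum amounts to \<open>\<parallel>t - S\<parallel> \<le> t\<close> for some \<open>t\<close>.\<close>

definition pos :: "('b::cstar_algebra \<Rightarrow> 'b) \<Rightarrow> bool" where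
  "pos S \<longleftrightarrow> selfadj S \<and> (\<exists>t\<ge>0. \<forall>b. norm (t *\<^sub>R b - S b) \<le> t * norm b)"

lemma pos_selfadj: "pos S \<Longrightarrow> selfadj S"
  by (simp add: pos_def)

lemma pos_add:
  assumes "pos S" "pos S'"
  shows "pos (\<lambda>b. S b + S' b)"
proof -
  obtain t t' where t: "t \<ge> 0" "\<And>b. norm (t *\<^sub>R b - S b) \<le> t * norm b"
    and t': "t' \<ge> 0" "\<And>b. norm (t' *\<^sub>R b - S' b) \<le> t' * norm b"
    using assms unfolding pos_def by auto
  have "norm ((t + t') *\<^sub>R b - (S b + S' b)) \<le> (t + t') * norm b" for b
  proof -
    have "norm ((t + t') *\<^sub>R b - (S b + S' b)) = norm ((t *\<^sub>R b - S b) + (t' *\<^sub>R b - S' b))"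
      by (simp add: algebra_simps)
    also have "\<dots> \<le> t * norm b + t' * norm b"
      using t(2)[of b] t'(2)[of b] norm_triangle_mono by blast
    finally show ?thesis by (simp add: algebra_simps)
  qed
  then show ?thesis
    unfolding pos_def using t(1) t'(1) assms
    by (auto intro!: adjoint_pair_add exI[of _ "t + t'"] simp: pos_def)
qed

lemma pos_scaleR:
  assumes "pos S" "r \<ge> 0"
  shows "pos (\<lambda>b. r *\<^sub>R S b)"
proof -
  obtain t where t: "t \<ge> 0" "\<And>b. norm (t *\<^sub>R b - S b) \<le> t * norm b"
    using assms unfolding pos_def by auto
  have "norm ((r * t) *\<^sub>R b - r *\<^sub>R S b) \<le> (r * t) * norm b" for b
  proof -
    have "norm ((r * t) *\<^sub>R b - r *\<^sub>R S b) = r * norm (t *\<^sub>R b - S b)"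
      using assms(2) by (metis abs_of_nonneg norm_scaleR scaleR_right_diff_distrib scaleR_scaleR)
    then show ?thesis
      using mult_left_mono[OF t(2)[of b] assms(2)] by (simp add: mult.assoc)
  qed
  then show ?thesis
    unfolding pos_def using t(1) assms
    by (auto intro!: adjoint_pair_scaleR exI[of _ "r * t"] simp: pos_def)
qed

text \<open>The binomial series of \<open>1 - \<surd>(1 - K)\<close> is majorised by the scalar one. The recursion
  \<open>Y \<mapsto> (K + Y\<^sup>2) / 2\<close> for it makes the comparison immediate.\<close>

lemma sqrt_near_identity:
  fixes A :: "'b::cstar_algebra \<Rightarrow> 'b"
  assumes sa: "selfadj A" and bd: "\<And>b. norm (b - A b) \<le> norm b"
  obtains R where "selfadj R" "\<And>b. R (R b) = A b" "\<And>b. norm (b - R b) \<le> norm b"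
    "\<And>C b. bounded_linear C \<Longrightarrow> (\<And>b. C (A b) = A (C b)) \<Longrightarrow> C (R b) = R (C b)"
proof -
  define y :: "nat \<Rightarrow> real" where "y = rec_nat 0 (\<lambda>_ s. (1 + s\<^sup>2) / 2)"
  define Y :: "nat \<Rightarrow> 'b \<Rightarrow> 'b" where
    "Y = rec_nat (\<lambda>b. 0) (\<lambda>_ U b. (1/2) *\<^sub>R ((b - A b) + U (U b)))"
  have y0: "y 0 = 0" and yS: "y (Suc n) = (1 + (y n)\<^sup>2) / 2" for n
    by (simp_all add: y_def)
  have Y0: "Y 0 b = 0" and YS: "Y (Suc n) b = (1/2) *\<^sub>R ((b - A b) + Y n (Y n b))" for n b
    by (simp_all add: Y_def)
  have y01: "0 \<le> y n \<and> y n \<le> 1" for n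
  proof (induction n)
    case (Suc n)
    then have "(y n)\<^sup>2 \<le> 1" by (simp add: power_le_one)
    then show ?case by (simp add: yS)
  qed (simp add: y0)
  have Ysa: "selfadj (Y n)" for n
  proof (induction n)
    case 0
    show ?case by (simp add: Y_def adjoint_pair_def)
  next
    case (Suc n)
    have "selfadj (\<lambda>b. (1/2) *\<^sub>R ((1 *\<^sub>R b - A b) + Y n (Y n b)))"
      by (rule adjoint_pair_scaleR[OF adjoint_pair_add[OF adjoint_pair_diff[OF selfadj_id sa]
              adjoint_pair_comp[OF Suc Suc]]])
    moreover have "Y (Suc n) = (\<lambda>b. (1/2) *\<^sub>R ((1 *\<^sub>R b - A b) + Y n (Y n b)))"
      by (rule ext) (simp add: YS)
    ultimately show ?case by simp
  qed
  have Ylin: "linear (Y n)" for n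
    using adjoint_pair_linear[OF Ysa] .
  have Ybd: "norm (Y n b) \<le> y n * norm b" for n b
  proof (induction n arbitrary: b)
    case (Suc n)
    have "norm (Y n (Y n b)) \<le> y n * (y n * norm b)"
      using Suc[of "Y n b"] mult_left_mono[OF Suc[of b], of "y n"] y01[of n] by linarith
    then have "norm ((b - A b) + Y n (Y n b)) \<le> norm b + (y n)\<^sup>2 * norm b"
      using bd[of b] norm_triangle_mono by (metis mult.assoc power2_eq_square)
    then show ?case unfolding YS norm_scaleR by (simp add: yS field_simps)
  qed (simp add: Y0 y0)
  have step: "norm (Y (Suc n) b - Y n b) \<le> (y (Suc n) - y n) * norm b \<and> y n \<le> y (Suc n)" for n b
  proof (induction n arbitrary: b)
    case 0
    then show ?case using bd[of b] by (simp add: YS Y0 yS y0)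
  next
    case (Suc n)
    let ?E = "\<lambda>b. Y (Suc n) b - Y n b"
    have ge: "y n \<le> y (Suc n)" using Suc[of 0] by simp
    have "Y (Suc (Suc n)) b - Y (Suc n) b = (1/2) *\<^sub>R (Y (Suc n) (Y (Suc n) b) - Y n (Y n b))"
      unfolding YS[of "Suc n"] YS[of n b] by (simp add: algebra_simps)
    also have "Y (Suc n) (Y (Suc n) b) - Y n (Y n b) = Y (Suc n) (?E b) + ?E (Y n b)"
      by (simp add: linear_diff[OF Ylin])
    finally have eq: "norm (Y (Suc (Suc n)) b - Y (Suc n) b)
      = norm (Y (Suc n) (?E b) + ?E (Y n b)) / 2" by simp
    have 1: "norm (Y (Suc n) (?E b)) \<le> y (Suc n) * ((y (Suc n) - y n) * norm b)"
      using Ybd[of "Suc n" "?E b"] mult_left_mono[OF conjunct1[OF Suc[of b]], of "y (Suc n)"]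
        y01[of "Suc n"] by linarith
    have 2: "norm (?E (Y n b)) \<le> (y (Suc n) - y n) * (y n * norm b)"
      using conjunct1[OF Suc[of "Y n b"]] mult_left_mono[OF Ybd[of n b], of "y (Suc n) - y n"]
        ge by linarith
    have "norm (Y (Suc n) (?E b) + ?E (Y n b))
        \<le> y (Suc n) * ((y (Suc n) - y n) * norm b) + (y (Suc n) - y n) * (y n * norm b)"
      using 1 2 norm_triangle_mono by blast
    also have "\<dots> = 2 * ((y (Suc (Suc n)) - y (Suc n)) * norm b)"
      by (simp only: yS[of "Suc n"]) (simp add: yS[of n] field_simps power2_eq_square)
    finally have "norm (Y (Suc (Suc n)) b - Y (Suc n) b)
        \<le> (y (Suc (Suc n)) - y (Suc n)) * norm b" using eq by simp
    moreover have "y (Suc n) \<le> y (Suc (Suc n))"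
      using ge y01[of n] by (simp add: yS[of "Suc n"] yS[of n] power_mono)
    ultimately show ?case by blast
  qed
  have inc: "incseq y" using step by (auto intro: incseq_SucI)
  have tail: "norm (Y m b - Y n b) \<le> (y m - y n) * norm b" if "n \<le> m" for m n b
    using that
  proof (induction m rule: dec_induct)
    case (step m)
    have "norm (Y (Suc m) b - Y n b) \<le> norm (Y (Suc m) b - Y m b) + norm (Y m b - Y n b)"
      using norm_triangle_ineq[of "Y (Suc m) b - Y m b" "Y m b - Y n b"] by simp
    also have "\<dots> \<le> (y (Suc m) - y m) * norm b + (y m - y n) * norm b"
      using step \<open>\<And>n b. norm (Y (Suc n) b - Y n b) \<le> (y (Suc n) - y n) * norm b \<and> y n \<le> y (Suc n)\<close>
      by (intro add_mono) auto
    finally show ?case by (simp add: algebra_simps)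
  qed simp
  have "convergent y"
    using incseq_convergent[OF inc, of 1] y01 by (metis convergentI)
  then have Cy: "Cauchy y" using convergent_Cauchy by blast
  have "Cauchy (\<lambda>n. Y n b)" for b
  proof (rule CauchyI)
    fix e :: real assume "e > 0"
    then have "e / (norm b + 1) > 0" by (simp add: add_nonneg_pos)
    then obtain N where N: "\<And>m n. m \<ge> N \<Longrightarrow> n \<ge> N \<Longrightarrow> norm (y m - y n) < e / (norm b + 1)"
      using CauchyD[OF Cy] by metis
    have *: "norm (Y m b - Y n b) < e" if "m \<ge> N" "n \<ge> N" "n \<le> m" for m n
    proof -
      have "norm (Y m b - Y n b) \<le> \<bar>y m - y n\<bar> * norm b"
        using tail[OF that(3)] by (meson abs_ge_self mult_right_mono norm_ge_zero order_trans)
      also have "\<dots> \<le> (e / (norm b + 1)) * norm b"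
        using N[OF that(1,2)] by (intro mult_right_mono) auto
      also have "\<dots> < e"
        using \<open>e > 0\<close> add_nonneg_pos[OF norm_ge_zero[of b] zero_less_one]
        by (simp add: divide_less_eq add.commute)
      finally show ?thesis .
    qed
    show "\<exists>M. \<forall>m\<ge>M. \<forall>n\<ge>M. norm (Y m b - Y n b) < e"
      using * by (metis norm_minus_commute nle_le)
  qed
  then have "convergent (\<lambda>n. Y n b)" for b
    using Cauchy_convergent_iff by blast
  then obtain Z where Z: "\<And>b. (\<lambda>n. Y n b) \<longlonglongrightarrow> Z b"
    unfolding convergent_def by metis
  have YY: "(\<lambda>n. Y n (Y n b)) \<longlonglongrightarrow> Z (Z b)" for b
  proof -
    have "(\<lambda>n. Y n b - Z b) \<longlonglongrightarrow> 0" using Z[of b] by (simp add: LIM_zero)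
    then have n0: "(\<lambda>n. norm (Y n b - Z b)) \<longlonglongrightarrow> 0" by (simp add: tendsto_norm_zero)
    have "(\<lambda>n. Y n (Y n b - Z b)) \<longlonglongrightarrow> 0"
    proof (rule tendsto_norm_zero_cancel, rule tendsto_sandwich[OF _ _ tendsto_const n0])
      show "\<forall>\<^sub>F n in sequentially. norm (Y n (Y n b - Z b)) \<le> norm (Y n b - Z b)"
        using Ybd y01 by (intro always_eventually allI)
          (meson mult_left_le_one_le norm_ge_zero order_trans)
    qed simp
    from tendsto_add[OF this Z[of "Z b"]] show ?thesis
      by (simp add: linear_diff[OF Ylin])
  qed
  have Zeq: "Z b = (1/2) *\<^sub>R ((b - A b) + Z (Z b))" for b
  proof -
    have "(\<lambda>n. Y (Suc n) b) \<longlonglongrightarrow> (1/2) *\<^sub>R ((b - A b) + Z (Z b))"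
      unfolding YS by (intro tendsto_intros YY)
    then show ?thesis using LIMSEQ_unique LIMSEQ_Suc[OF Z] by blast
  qed
  have Zsa: "selfadj Z"
    unfolding adjoint_pair_def
  proof (intro allI)
    fix b c
    have 1: "(\<lambda>n. star c * Y n b) \<longlonglongrightarrow> star c * Z b" for b c by (intro tendsto_intros Z)
    have "(\<lambda>n. star b * Y n c - star (Z b) * c) \<longlonglongrightarrow> 0"
    proof (rule Lim_null_comparison)
      show "\<forall>\<^sub>F n in sequentially.
          norm (star b * Y n c - star (Z b) * c) \<le> norm (Y n b - Z b) * norm c"
      proof (intro always_eventually allI)
        fix n
        have "star b * Y n c - star (Z b) * c = star (Y n b - Z b) * c"
          by (simp add: star_diff left_diff_distrib adjoint_pairD[OF Ysa])
        then show "norm (star b * Y n c - star (Z b) * c) \<le> norm (Y n b - Z b) * norm c"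
          using norm_mult_ineq[of "star (Y n b - Z b)" c] by (simp add: norm_star)
      qed
      show "(\<lambda>n. norm (Y n b - Z b) * norm c) \<longlonglongrightarrow> 0"
        using Z[of b] by (intro tendsto_mult_left_zero tendsto_norm_zero LIM_zero)
    qed
    then have "(\<lambda>n. star b * Y n c) \<longlonglongrightarrow> star (Z b) * c" by (rule LIM_zero_cancel)
    then show "star (Z b) * c = star b * Z c" using 1 LIMSEQ_unique by blast
  qed
  have Zlin: "linear Z" using adjoint_pair_linear[OF Zsa] .
  show thesis
  proof (rule that[of "\<lambda>b. b - Z b"])
    show "selfadj (\<lambda>b. b - Z b)"
      using adjoint_pair_diff[OF selfadj_id[of 1] Zsa] by simp
    show "b - Z b - Z (b - Z b) = A b" for b
    proof -
      have "Z b + Z b = b - A b + Z (Z b)"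
        by (subst (1 2) Zeq) (simp flip: scaleR_left_distrib)
      then have *: "A b = b - Z b - (Z b - Z (Z b))" by (simp add: algebra_simps)
      show ?thesis unfolding linear_diff[OF Zlin] * ..
    qed
    have "norm (Z b) \<le> norm b" for b
    proof (rule LIMSEQ_le_const2[OF tendsto_norm[OF Z]])
      show "\<exists>N. \<forall>n\<ge>N. norm (Y n b) \<le> norm b"
        using Ybd y01 by (meson mult_left_le_one_le norm_ge_zero order_trans)
    qed
    then show "norm (b - (b - Z b)) \<le> norm b" for b by simp
    fix C b assume C: "bounded_linear C" and comm: "\<And>b. C (A b) = A (C b)"
    have lC: "linear C" using C bounded_linear.linear by blast
    have "C (Y n b) = Y n (C b)" for n b
    proof (induction n arbitrary: b)
      case (Suc n)
      then show ?case
        by (simp add: YS linear_add[OF lC] linear_diff[OF lC] linear_cmul[OF lC] comm)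
    qed (simp add: Y0 linear_0[OF lC])
    moreover have "(\<lambda>n. C (Y n b)) \<longlonglongrightarrow> C (Z b)"
      using bounded_linear.tendsto[OF C Z] .
    ultimately have "C (Z b) = Z (C b)" using Z[of "C b"] LIMSEQ_unique by simp
    then show "C (b - Z b) = C b - Z (C b)" by (simp add: linear_diff[OF lC])
  qed
qed

lemma adjoint_pair_bounded_linear:
  assumes "adjoint_pair F G" "\<And>b. norm (F b) \<le> K * norm b"
  shows "bounded_linear F"
  using assms adjoint_pair_linear[OF adjoint_pair_sym[OF assms(1)]]
  by (intro bounded_linear_intro[of F K])
    (auto simp: linear_add linear_cmul mult.commute)

lemma pos_bounded_linear:
  assumes "pos S"
  shows "bounded_linear S"
proof -
  obtain t where t: "t \<ge> 0" "\<And>b. norm (t *\<^sub>R b - S b) \<le> t * norm b"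
    using assms unfolding pos_def by auto
  have "norm (S b) \<le> (2 * t) * norm b" for b
    using t(2)[of b] t(1) norm_triangle_ineq2[of "S b" "t *\<^sub>R b"]
    by (simp add: norm_minus_commute)
  then show ?thesis
    using adjoint_pair_bounded_linear[OF pos_selfadj[OF assms]] by blast
qed

text \<open>The last property puts the root in the bicommutant of \<open>S\<close>; it stands in for a functional
  calculus.\<close>

lemma pos_sqrt:
  assumes "pos S"
  obtains R where "pos R" "\<And>b. R (R b) = S b"
    "\<And>C b. bounded_linear C \<Longrightarrow> (\<And>b. C (S b) = S (C b)) \<Longrightarrow> C (R b) = R (C b)"
proof -
  obtain t where t: "t \<ge> 0" "\<And>b. norm (t *\<^sub>R b - S b) \<le> t * norm b"
    using assms unfolding pos_def by auto
  show thesis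
  proof (cases "t = 0")
    case True
    then have "S b = 0" for b using t(2)[of b] by simp
    then show thesis
      using that[of "\<lambda>b. 0"] assms by (auto simp: pos_def adjoint_pair_def linear_0
          bounded_linear.linear intro!: exI[of _ 0])
  next
    case False
    then have "t > 0" using t by simp
    let ?A = "\<lambda>b. (1 / t) *\<^sub>R S b"
    have 1: "selfadj ?A" using assms by (simp add: pos_def adjoint_pair_scaleR)
    have 2: "norm (b - ?A b) \<le> norm b" for b
    proof -
      have "b - ?A b = (1 / t) *\<^sub>R (t *\<^sub>R b - S b)"
        using \<open>t > 0\<close> by (simp add: scaleR_right_diff_distrib)
      then have "norm (b - ?A b) = norm (t *\<^sub>R b - S b) / t" using \<open>t > 0\<close> by simp
      also have "\<dots> \<le> norm b" using t(2)[of b] \<open>t > 0\<close> by (simp add: field_simps)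
      finally show ?thesis .
    qed
    obtain R where R: "selfadj R" "\<And>b. R (R b) = ?A b" "\<And>b. norm (b - R b) \<le> norm b"
      "\<And>C b. bounded_linear C \<Longrightarrow> (\<And>b. C (?A b) = ?A (C b)) \<Longrightarrow> C (R b) = R (C b)"
      using sqrt_near_identity[of ?A] 1 2 by blast
    have lR: "linear R" using adjoint_pair_linear R(1) by blast
    have "pos R" unfolding pos_def using R by (auto intro!: exI[of _ 1])
    then have pos: "pos (\<lambda>b. sqrt t *\<^sub>R R b)" using t(1) by (intro pos_scaleR) auto
    have sq: "sqrt t *\<^sub>R R (sqrt t *\<^sub>R R b) = S b" for b
      using t(1) \<open>t > 0\<close> by (simp add: linear_cmul[OF lR] R(2))
    have comm: "C (sqrt t *\<^sub>R R b) = sqrt t *\<^sub>R R (C b)"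
      if C: "bounded_linear C" "\<And>b. C (S b) = S (C b)" for C b
    proof -
      have "C (?A b) = ?A (C b)" for b
        using C by (simp add: linear_cmul bounded_linear.linear)
      then have "C (R b) = R (C b)" using R(4)[OF C(1)] by blast
      then show ?thesis using C by (simp add: linear_cmul bounded_linear.linear)
    qed
    show thesis
      using that[of "\<lambda>b. sqrt t *\<^sub>R R b", OF pos sq] comm by blast
  qed
qed

text \<open>The C*-identity for operators: \<open>\<parallel>F b\<parallel>\<^sup>2\<close> is the norm of the inner product of \<open>b\<close> and \<open>F\<^sup>* F b\<close>.\<close>

lemma norm_le_norm_square:
  assumes "adjoint_pair F G"
  shows "(norm (F b))\<^sup>2 \<le> norm b * norm (G (F b))"
proof -
  have "star (F b) * F b = star b * G (F b)" using adjoint_pairD[OF assms] .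
  then show ?thesis
    using norm_mult_ineq[of "star b" "G (F b)"] by (simp add: norm_star flip: cstar_identity)
qed

text \<open>If \<open>R\<close> and \<open>S\<close> are commuting selfadjoint elements with \<open>R\<^sup>2 + S\<^sup>2 = t\<close>, then
  \<open>R \<plusminus> iS\<close> are \<open>\<surd>t\<close> times a unitary, and \<open>R\<close> is their mean.\<close>

lemma norm_le_of_squares:
  fixes R S :: "'b::cstar_algebra \<Rightarrow> 'b"
  assumes R: "selfadj R" and S: "selfadj S" and comm: "\<And>b. R (S b) = S (R b)"
    and t: "\<And>b. R (R b) + S (S b) = t *\<^sub>R b" "t \<ge> 0"
  shows "norm (R (R b)) \<le> t * norm b"
proof -
  have scaleC_star: "star (R b + z *\<^sub>C S b) * (R b + z *\<^sub>C S b) = t *\<^sub>R (star b * b)"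
    if z: "z = \<i> \<or> z = - \<i>" for z b
  proof -
    have zz: "cnj z * z = 1" "cnj z = - z" "z * z = -1" using z by auto
    have "star (R b + z *\<^sub>C S b) * (R b + z *\<^sub>C S b) =
      star b * R (R b) + z *\<^sub>C (star b * R (S b)) + (cnj z *\<^sub>C (star b * S (R b))
        + (cnj z * z) *\<^sub>C (star b * S (S b)))"
      by (simp add: star_add star_scaleC distrib_left distrib_right scaleC_mult_left
          scaleC_mult_right scaleC_scaleC adjoint_pairD[OF R] adjoint_pairD[OF S] scaleC_add_right
          mult.commute)
    also have "\<dots> = star b * R (R b) + star b * S (S b)"
      by (simp add: zz scaleC_minus_left comm)
    also have "\<dots> = t *\<^sub>R (star b * b)" by (simp flip: distrib_left add: t)
    finally show ?thesis .
  qed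
  have bd: "norm (R b + z *\<^sub>C S b) \<le> sqrt t * norm b" if z: "z = \<i> \<or> z = - \<i>" for z b
  proof -
    have "(norm (R b + z *\<^sub>C S b))\<^sup>2 = t * (norm b)\<^sup>2"
      using scaleC_star[OF z, of b] t(2) by (simp flip: cstar_identity)
    then have "(norm (R b + z *\<^sub>C S b))\<^sup>2 = (sqrt t * norm b)\<^sup>2"
      using t(2) by (simp add: power_mult_distrib)
    then show ?thesis using t(2) by (simp add: power2_eq_iff_nonneg)
  qed
  have Rbd: "norm (R b) \<le> sqrt t * norm b" for b
  proof -
    have "(2::real) *\<^sub>R R b = (R b + \<i> *\<^sub>C S b) + (R b + (- \<i>) *\<^sub>C S b)"
      using scaleC_add_left[of "\<i>" "-\<i>" "S b"] scaleC_add_left[of 0 0 "S b"]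
      by (simp add: scaleR_2 algebra_simps)
    then have "norm ((2::real) *\<^sub>R R b) \<le> sqrt t * norm b + sqrt t * norm b"
      using bd[of "\<i>" b] bd[of "-\<i>" b] norm_triangle_mono by metis
    then show ?thesis by simp
  qed
  have "norm (R (R b)) \<le> sqrt t * (sqrt t * norm b)"
    using Rbd[of "R b"] mult_left_mono[OF Rbd[of b], of "sqrt t"] t(2) by force
  then show ?thesis using t(2) by (simp flip: mult.assoc)
qed

text \<open>After scaling, \<open>\<parallel>T\<parallel> \<le> 1\<close> and \<open>1 - T\<^sup>2\<close> has a square root that commutes with \<open>T\<close>, hence norm at most
  \<open>1\<close>, which is the defining estimate for positivity of \<open>T\<^sup>2\<close>.\<close>

lemma pos_square:
  assumes "selfadj S" "bounded_linear S"
  shows "pos (\<lambda>b. S (S b))"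
proof -
  obtain k where k: "k > 0" "\<And>b. norm (S b) \<le> norm b * k"
    using bounded_linear.pos_bounded[OF assms(2)] by auto
  have lS: "linear S" using adjoint_pair_linear assms(1) by blast
  define T where "T = (\<lambda>b. (1/k) *\<^sub>R S b)"
  have T: "selfadj T" "norm (T b) \<le> norm b" "T (T b) = (1/k\<^sup>2) *\<^sub>R S (S b)" for b
    using assms(1) k(1) k(2)[of b]
    by (simp_all add: T_def adjoint_pair_scaleR field_simps linear_cmul[OF lS] power2_eq_square)
  have lT: "linear T" using adjoint_pair_linear T(1) by blast
  have blT: "bounded_linear T" using adjoint_pair_bounded_linear[of T T 1] T by simp
  have TT: "norm (T (T b)) \<le> norm b" for b using T(2)[of "T b"] T(2)[of b] by simp
  let ?A = "\<lambda>b. b - T (T b)"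
  have A1: "selfadj ?A"
    using adjoint_pair_diff[OF selfadj_id[of 1] adjoint_pair_comp[OF T(1) T(1)]] by simp
  have A2: "norm (b - ?A b) \<le> norm b" for b using TT by simp
  obtain R where R: "selfadj R" "\<And>b. R (R b) = ?A b"
    "\<And>C b. bounded_linear C \<Longrightarrow> (\<And>b. C (?A b) = ?A (C b)) \<Longrightarrow> C (R b) = R (C b)"
    by (rule sqrt_near_identity[OF A1 A2], rule that) blast+
  have "norm (R (R b)) \<le> 1 * norm b" for b
    by (rule norm_le_of_squares[OF R(1) T(1)])
      (use R(2) R(3)[OF blT] in \<open>simp_all add: linear_diff[OF lT]\<close>)
  then have "norm (b - (1/k\<^sup>2) *\<^sub>R S (S b)) \<le> norm b" for b by (simp add: R(2) T(3))
  then have "norm (k\<^sup>2 *\<^sub>R (b - (1/k\<^sup>2) *\<^sub>R S (S b))) \<le> k\<^sup>2 * norm b" for b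
    by (simp add: mult_left_mono)
  then have "norm (k\<^sup>2 *\<^sub>R b - S (S b)) \<le> k\<^sup>2 * norm b" for b
    using k(1) by (simp add: scaleR_right_diff_distrib)
  then show ?thesis unfolding pos_def
    using adjoint_pair_comp[OF assms(1) assms(1)] by (auto intro!: exI[of _ "k\<^sup>2"])
qed


lemma adjoint_pair_scaleC:
  assumes "adjoint_pair F G"
  shows "G (z *\<^sub>C b) = z *\<^sub>C G b"
proof -
  have "star c * (G (z *\<^sub>C b) - z *\<^sub>C G b) = 0" for c
    by (simp add: right_diff_distrib scaleC_mult_right adjoint_pairD[OF assms, symmetric])
  then show ?thesis using eq_zero_if_annihilated[of "G (z *\<^sub>C b) - z *\<^sub>C G b"] by simp
qed

text \<open>Multiplication by \<open>i\<close> makes a skew map selfadjoint.\<close>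

lemma pos_minus_square_skew:
  assumes K: "adjoint_pair K (\<lambda>b. - K b)" and bl: "bounded_linear K"
  shows "pos (\<lambda>b. - K (K b))"
proof -
  have 1: "selfadj (\<lambda>b. \<i> *\<^sub>C K b)"
    unfolding adjoint_pair_def
    by (simp add: star_scaleC scaleC_mult_left scaleC_mult_right adjoint_pairD[OF K]
        scaleC_minus_left scaleC_minus_right)
  obtain k where k: "k > 0" "\<And>b. norm (K b) \<le> norm b * k"
    using bounded_linear.pos_bounded[OF bl] by auto
  have 2: "bounded_linear (\<lambda>b. \<i> *\<^sub>C K b)"
    by (rule adjoint_pair_bounded_linear[OF 1, of k])
      (use k(2) in \<open>simp add: norm_scaleC mult.commute\<close>)
  have "\<i> *\<^sub>C K (\<i> *\<^sub>C K b) = - K (K b)" for b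
    using adjoint_pair_scaleC[OF adjoint_pair_sym[OF K]] scaleC_scaleC[of \<i> \<i> "K (K b)"]
    by (simp add: scaleC_minus_left)
  then show ?thesis using pos_square[OF 1 2] by simp
qed

text \<open>Both \<open>S\<close> and \<open>t - S\<close> are positive; their square roots commute and are the two components of
  \<open>\<surd>t\<close> times a unitary.\<close>

lemma pos_norm_mono:
  assumes "pos S" "pos S'" "t \<ge> 0" and bd: "\<And>b. norm (S b + S' b) \<le> t * norm b"
  shows "norm (S b) \<le> t * norm b"
proof -
  have "pos (\<lambda>b. t *\<^sub>R b - (S b + S' b))"
    unfolding pos_def
    using adjoint_pair_diff[OF selfadj_id adjoint_pair_add[OF assms(1,2)[THEN pos_selfadj]]]
      assms(3) bd by (auto intro!: exI[of _ t] simp: add.commute)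
  from pos_add[OF this assms(2)] have c: "pos (\<lambda>b. t *\<^sub>R b - S b)"
    by (simp add: algebra_simps)
  obtain R where R: "pos R" "\<And>b. R (R b) = S b"
    "\<And>C b. bounded_linear C \<Longrightarrow> (\<And>b. C (S b) = S (C b)) \<Longrightarrow> C (R b) = R (C b)"
    using pos_sqrt[OF assms(1)] by blast
  obtain Q where Q: "pos Q" "\<And>b. Q (Q b) = t *\<^sub>R b - S b"
    "\<And>C b. bounded_linear C \<Longrightarrow> (\<And>b. C (t *\<^sub>R b - S b) = t *\<^sub>R C b - S (C b))
      \<Longrightarrow> C (Q b) = Q (C b)"
    using pos_sqrt[OF c] by blast
  have blR: "bounded_linear R" and lR: "linear R"
    using pos_bounded_linear[OF R(1)] bounded_linear.linear by blast+
  have "R (Q b) = Q (R b)" for b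
    by (rule Q(3)[OF blR]) (simp add: linear_diff[OF lR] linear_cmul[OF lR] flip: R(2))
  then have "norm (R (R b)) \<le> t * norm b"
    using norm_le_of_squares[of R Q t b] pos_selfadj[OF R(1)] pos_selfadj[OF Q(1)] assms(3)
    by (simp add: R(2) Q(2))
  then show ?thesis by (simp add: R(2))
qed

lemma pos_add_eq_0:
  assumes "pos S" "pos S'" "\<And>b. S b + S' b = 0"
  shows "S b = 0"
  using pos_norm_mono[OF assms(1,2), of 0 b] assms(3) by simp

text \<open>\<open>F F\<^sup>* + F\<^sup>* F\<close> is twice the sum of the squares of the real and imaginary parts of \<open>F\<close>.\<close>

lemma pos_anticommutator:
  assumes F: "adjoint_pair F G" "bounded_linear F" "bounded_linear G"
  shows "pos (\<lambda>b. F (G b) + G (F b))"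
proof -
  note G = adjoint_pair_sym[OF F(1)]
  note lF = bounded_linear.linear[OF F(2)] and lG = bounded_linear.linear[OF F(3)]
  define U where "U = (\<lambda>b. F b + G b)"
  define K where "K = (\<lambda>b. F b - G b)"
  have "selfadj U" using adjoint_pair_add[OF F(1) G] by (simp add: U_def add.commute)
  moreover have "adjoint_pair K (\<lambda>b. - K b)"
    using adjoint_pair_diff[OF F(1) G] by (simp add: K_def)
  moreover have "bounded_linear U" "bounded_linear K"
    unfolding U_def K_def using F by (auto intro: bounded_linear_add bounded_linear_sub)
  ultimately have "pos (\<lambda>b. (1/2) *\<^sub>R (U (U b) + (- K (K b))))"
    by (intro pos_scaleR pos_add pos_square pos_minus_square_skew) auto
  moreover have "(1/2) *\<^sub>R (U (U b) + (- K (K b))) = F (G b) + G (F b)" for b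
  proof -
    have "U (U b) + (- K (K b)) = 2 *\<^sub>R (F (G b) + G (F b))"
      by (simp add: U_def K_def linear_add[OF lF] linear_add[OF lG] linear_diff[OF lF]
          linear_diff[OF lG] scaleR_2 algebra_simps)
    then show ?thesis by simp
  qed
  ultimately show ?thesis by simp
qed

lemma selfadj_square_eq_0:
  assumes "adjoint_pair F G" "\<And>b. G (F b) = 0"
  shows "F b = 0"
  using norm_le_norm_square[OF assms(1), of b] assms(2) by simp

text \<open>Here \<open>F\<^sup>* F = - Q\<^sup>2\<close>. By the anticommutator, \<open>F F\<^sup>*\<close> is positive, so \<open>F F\<^sup>* = W\<^sup>2\<close>. Now \<open>H = F Q\<close> satisfies
  \<open>H H\<^sup>* = - W\<^sup>4\<close> and \<open>H\<^sup>* H = - Q\<^sup>4\<close>, so the positive sum \<open>H H\<^sup>* + H\<^sup>* H\<close> is also negative and all terms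
  vanish. No comparison of the spectra of \<open>F F\<^sup>*\<close> and \<open>F\<^sup>* F\<close> is involved.\<close>

lemma no_negative_F_star_F:
  assumes F: "adjoint_pair F G" "bounded_linear F" "bounded_linear G"
    and Q: "selfadj Q" "bounded_linear Q" and eq: "\<And>b. G (F b) = - Q (Q b)"
  shows "Q b = 0"
proof -
  note lF = bounded_linear.linear[OF F(2)] and lG = bounded_linear.linear[OF F(3)]
    and lQ = bounded_linear.linear[OF Q(2)]
  have "pos (\<lambda>b. (F (G b) + G (F b)) + Q (Q b))"
    by (intro pos_add pos_anticommutator pos_square F Q)
  then have "pos (\<lambda>b. F (G b))" by (simp add: eq)
  then obtain W where W: "pos W" "\<And>b. W (W b) = F (G b)" using pos_sqrt by metis
  note lW = bounded_linear.linear[OF pos_bounded_linear[OF W(1)]]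
  have "pos (\<lambda>b. W (W (W (W b))))"
    using pos_square[of "\<lambda>b. W (W b)"] W(1) adjoint_pair_comp[of W W W W]
      bounded_linear_compose[of W W] by (simp add: pos_selfadj pos_bounded_linear)
  moreover have "pos (\<lambda>b. Q (Q (Q (Q b))))"
    using pos_square[of "\<lambda>b. Q (Q b)"] Q adjoint_pair_comp[of Q Q Q Q]
      bounded_linear_compose[of Q Q] by simp
  moreover have "pos (\<lambda>b. F (Q (Q (G b))) + Q (G (F (Q b))))"
    using pos_anticommutator[of "\<lambda>b. F (Q b)" "\<lambda>b. Q (G b)"]
      adjoint_pair_comp[OF F(1) Q(1)] F Q by (simp add: bounded_linear_compose)
  moreover have "F (Q (Q (G b))) = - W (W (W (W b)))" for b
  proof -
    have "Q (Q (G b)) = - G (F (G b))" by (simp add: eq)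
    then show ?thesis by (simp add: linear_neg[OF lF] W(2))
  qed
  moreover have "Q (G (F (Q b))) = - Q (Q (Q (Q b)))" for b
    by (simp add: eq linear_neg[OF lQ])
  ultimately have "Q (Q (Q (Q b))) = 0" for b
    using pos_add_eq_0[of "\<lambda>b. Q (Q (Q (Q b)))"
        "\<lambda>b. W (W (W (W b))) + (F (Q (Q (G b))) + Q (G (F (Q b))))" b]
      pos_add[of "\<lambda>b. W (W (W (W b)))" "\<lambda>b. F (Q (Q (G b))) + Q (G (F (Q b)))"]
    by simp
  then have "Q (Q b) = 0" for b
    using selfadj_square_eq_0[OF adjoint_pair_comp[OF Q(1) Q(1)]] by blast
  then show ?thesis using selfadj_square_eq_0[OF Q(1)] by blast
qed

text \<open>Kaplansky's argument. If \<open>N\<close> is the negative part of \<open>c\<^sup>* c\<close>, then \<open>(c N)\<^sup>* (c N) = - N\<^sup>3\<close> is minus a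
  square, so that it vanishes.\<close>

lemma pos_star_mult_self: "pos (\<lambda>b. (star c * c) * (b::'b::cstar_algebra))"
proof -
  define H where "H = (\<lambda>b. (star c * c) * b)"
  have H: "selfadj H" "bounded_linear H"
    using adjoint_pair_mult_left[of "star c * c"]
    by (simp_all add: H_def star_mult star_star bounded_linear_mult_right)
  note lH = bounded_linear.linear[OF H(2)]
  obtain M where M: "pos M" "\<And>b. M (M b) = H (H b)"
    "\<And>C b. bounded_linear C \<Longrightarrow> (\<And>b. C (H (H b)) = H (H (C b))) \<Longrightarrow> C (M b) = M (C b)"
    using pos_sqrt[OF pos_square[OF H]] by blast
  note blM = pos_bounded_linear[OF M(1)]
  note lM = bounded_linear.linear[OF blM]
  obtain g where g: "pos g" "\<And>b. g (g b) = M b"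
    "\<And>C b. bounded_linear C \<Longrightarrow> (\<And>b. C (M b) = M (C b)) \<Longrightarrow> C (g b) = g (C b)"
    using pos_sqrt[OF M(1)] by blast
  have HM: "H (M b) = M (H b)" for b using M(3)[OF H(2)] by simp
  \<comment> \<open>Twice the negative part of \<open>H\<close>.\<close>
  define N where "N = (\<lambda>b. M b - H b)"
  have N: "selfadj N" "bounded_linear N"
    unfolding N_def
    by (rule adjoint_pair_diff[OF pos_selfadj[OF M(1)] H(1)], rule bounded_linear_sub[OF blM H(2)])
  note lN = bounded_linear.linear[OF N(2)]
  have HN: "H (N b) = - M (N b)" for b
    by (simp add: N_def linear_diff[OF lH] linear_diff[OF lM] HM M(2))
  have NM: "N (M b) = M (N b)" for b by (simp add: N_def linear_diff[OF lM] HM)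
  have Ng: "N (g b) = g (N b)" for b using g(3)[OF N(2) NM] .
  have "g (N b) = 0" for b
  proof (rule no_negative_F_star_F[of "\<lambda>b. c * N b" "\<lambda>b. N (star c * b)" "\<lambda>b. g (N b)"])
    show "adjoint_pair (\<lambda>b. c * N b) (\<lambda>b. N (star c * b))"
      by (rule adjoint_pair_comp[OF adjoint_pair_mult_left N(1)])
    show "selfadj (\<lambda>b. g (N b))"
      using adjoint_pair_comp[OF pos_selfadj[OF g(1)] N(1)] by (simp add: Ng)
    show "N (star c * (c * N b)) = - g (N (g (N b)))" for b
    proof -
      have "N (star c * (c * N b)) = N (H (N b))" by (simp add: H_def mult.assoc)
      also have "\<dots> = - N (g (g (N b)))" by (simp add: HN linear_neg[OF lN] g(2))
      finally show ?thesis by (simp add: Ng)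
    qed
  qed (auto intro!: bounded_linear_compose[OF N(2)] bounded_linear_compose[OF _ N(2)]
      bounded_linear_mult_right pos_bounded_linear[OF g(1)])
  then have MN: "M (N b) = 0" for b
    by (metis g(2) linear_0 bounded_linear.linear pos_bounded_linear g(1))
  then have "N (N b) = 0" for b
    using HN[of b] by (simp add: N_def[THEN fun_cong, of "N b"])
  then have "N b = 0" for b using selfadj_square_eq_0[OF N(1)] by blast
  then have "H = M" by (auto simp: N_def)
  then show ?thesis using M(1) by (simp add: H_def)
qed

lemma norm_star_mult_self_le_add:
  fixes a b :: "'b::cstar_algebra"
  shows "norm (star a * a) \<le> norm (star a * a + star b * b)"
proof -
  let ?h = "star a * a"
  have "norm (?h * ?h) \<le> norm (star a * a + star b * b) * norm ?h"
    by (rule pos_norm_mono[OF pos_star_mult_self pos_star_mult_self[of b]])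
      (auto simp: norm_mult_ineq simp flip: distrib_right)
  moreover have "norm (?h * ?h) = (norm ?h)\<^sup>2"
    using cstar_identity[of ?h] by (simp add: star_mult star_star)
  ultimately show ?thesis
    by (metis mult_le_cancel_right_pos norm_ge_zero order_le_less power2_eq_square)
qed

section \<open>Symmetric operators for a C*-valued inner product\<close>

lemma subspace_closure:
  fixes S :: "'a::real_normed_vector set"
  assumes "subspace S"
  shows "subspace (closure S)"
  unfolding subspace_def
proof (intro conjI ballI allI)
  show "0 \<in> closure S" using closure_subset subspace_0[OF assms] by blast
  fix a b assume "a \<in> closure S" "b \<in> closure S"
  then obtain f g where fg: "\<And>n. f n \<in> S" "f \<longlonglongrightarrow> a" "\<And>n. g n \<in> S" "g \<longlonglongrightarrow> b"
    unfolding closure_sequential by metis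
  have "(\<lambda>n. f n + g n) \<longlonglongrightarrow> a + b" by (intro tendsto_add fg)
  then show "a + b \<in> closure S"
    unfolding closure_sequential
    by (intro exI[of _ "\<lambda>n. f n + g n"]) (simp add: subspace_add[OF assms fg(1,3)])
  fix c :: real
  have "(\<lambda>n. c *\<^sub>R f n) \<longlonglongrightarrow> c *\<^sub>R a" by (intro tendsto_intros fg)
  then show "c *\<^sub>R a \<in> closure S"
    unfolding closure_sequential
    by (intro exI[of _ "\<lambda>n. c *\<^sub>R f n"]) (simp add: subspace_scale[OF assms fg(1)])
qed

lemma op_add_iff: "(u, w) \<in> op_add f A \<longleftrightarrow> (\<exists>u'. (u, u') \<in> A \<and> w = f u + u')"
  by (auto simp: op_add_def)

lemma op_add_RangeI: "(u, u') \<in> A \<Longrightarrow> f u + u' \<in> Range (op_add f A)"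
  unfolding Range_iff op_add_iff by blast

lemma op_add_op_add: "op_add f (op_add g A) = op_add (\<lambda>u. f u + g u) A"
  for f g :: "'a::ab_group_add \<Rightarrow> 'a"
  by (force simp: set_eq_iff op_add_iff add.assoc)

lemma subspace_op_add:
  assumes "subspace A" "linear f"
  shows "subspace (op_add f A)"
proof -
  have "op_add f A = (\<lambda>(u, u'). (u, f u + u')) ` A" by (auto simp: op_add_def)
  moreover have "linear (\<lambda>(u, u'). (u, f u + u'))"
    using assms(2) by unfold_locales (auto simp: linear_add linear_cmul algebra_simps)
  ultimately show ?thesis using assms(1) linear_subspace_image by metis
qed

text \<open>If \<open>L\<close> maps onto \<open>F\<close>, then \<open>P + L\<close> does so for small \<open>P\<close>: with a section \<open>G\<close> of \<open>L\<close>, the equation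
  \<open>P u + L u = \<eta>\<close> is a fixed point problem for \<open>v = L u\<close>, and the lower bound on \<open>L\<close> makes it a
  contraction.\<close>

lemma range_perturbation:
  fixes L :: "('a::banach \<times> 'a) set"
  assumes L: "subspace L" and F: "closed F" "subspace F" "F \<subseteq> Range L"
    and bd: "\<And>u u'. (u, u') \<in> L \<Longrightarrow> norm u \<le> c * norm u'" "c \<ge> 0"
    and P: "linear P" "\<And>u. norm (P u) \<le> p * norm u" "\<And>u. u \<in> Domain L \<Longrightarrow> P u \<in> F"
    and small: "p * c < 1" "p \<ge> 0"
  shows "F \<subseteq> Range (op_add P L)"
proof
  fix \<eta> assume "\<eta> \<in> F"
  define G where "G = (\<lambda>v. SOME u. (u, v) \<in> L)"
  have G: "(G v, v) \<in> L" if "v \<in> F" for v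
    unfolding G_def by (rule someI_ex) (use that F(3) in auto)
  have "\<exists>!v\<in>F. \<eta> - P (G v) = v"
  proof (rule Banach_fix[of _ "p * c"])
    show "complete F" using F(1) complete_eq_closed by blast
    show "F \<noteq> {}" using \<open>\<eta> \<in> F\<close> by blast
    show "(\<lambda>v. \<eta> - P (G v)) ` F \<subseteq> F"
      using G P(3) \<open>\<eta> \<in> F\<close> by (auto intro!: subspace_diff[OF F(2)])
    fix v w assume "v \<in> F" "w \<in> F"
    then have "(G v - G w, v - w) \<in> L"
      using G[of v] G[of w] subspace_diff[OF L] by fastforce
    then have "norm (G v - G w) \<le> c * norm (v - w)" by (rule bd(1))
    then have "norm (P (G v - G w)) \<le> p * (c * norm (v - w))"
      using P(2)[of "G v - G w"] small(2) by (meson mult_left_mono order_trans)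
    then show "dist (\<eta> - P (G v)) (\<eta> - P (G w)) \<le> p * c * dist v w"
      by (simp add: dist_norm linear_diff[OF P(1)] norm_minus_commute algebra_simps)
  qed (use small bd in auto)
  then obtain v where "v \<in> F" "\<eta> - P (G v) = v" by blast
  then have "\<eta> = P (G v) + v" by (simp add: algebra_simps)
  then show "\<eta> \<in> Range (op_add P L)"
    using G[OF \<open>v \<in> F\<close>] by (auto simp: op_add_def)
qed

text \<open>The part of the Hilbert module structure that the analysis needs. The constant \<open>K\<close> allows for a norm
  that is only equivalent to the one induced by the inner product, as for the norm of the product
  type on \<open>E \<oplus> E\<close>.\<close>

locale cstar_form =
  fixes ip :: "'h::complex_banach \<Rightarrow> 'h \<Rightarrow> 'b::cstar_algebra" and K :: real
  assumes form_add_right: "ip \<xi> (\<eta> + \<zeta>) = ip \<xi> \<eta> + ip \<xi> \<zeta>"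
    and form_scaleC_right: "ip \<xi> (z *\<^sub>C \<eta>) = z *\<^sub>C ip \<xi> \<eta>"
    and star_form: "star (ip \<xi> \<eta>) = ip \<eta> \<xi>"
    and norm_form_le: "norm (ip \<xi> \<eta>) \<le> K * norm \<xi> * norm \<eta>"
    and norm_le_form: "(norm \<xi>)\<^sup>2 \<le> K * norm (ip \<xi> \<xi>)"
    and K_pos: "K > 0"
begin

lemma form_add_left: "ip (\<xi> + \<eta>) \<zeta> = ip \<xi> \<zeta> + ip \<eta> \<zeta>"
  by (metis form_add_right star_add star_form)

lemma form_scaleC_left: "ip (z *\<^sub>C \<xi>) \<eta> = cnj z *\<^sub>C ip \<xi> \<eta>"
  by (metis form_scaleC_right star_scaleC star_form)

lemma bounded_bilinear_form: "bounded_bilinear ip"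
proof
  show "\<exists>K. \<forall>a b. norm (ip a b) \<le> norm a * norm b * K"
    using norm_form_le by (auto intro!: exI[of _ K] simp: mult_ac)
qed (simp_all add: form_add_left form_add_right scaleR_scaleC form_scaleC_left form_scaleC_right)

sublocale form: bounded_bilinear ip
  by (rule bounded_bilinear_form)

lemma form_definite: "ip \<xi> \<xi> = 0 \<Longrightarrow> \<xi> = 0"
  using norm_le_form[of \<xi>] by simp

lemma symmetric_iff:
  "symmetric_on ip UNIV A \<longleftrightarrow> (\<forall>(\<xi>, \<xi>')\<in>A. \<forall>(\<eta>, \<eta>')\<in>A. ip \<xi>' \<eta> = ip \<xi> \<eta>')"
  unfolding symmetric_on_def adjoint_on_def by auto

lemma symmetricD:
  "symmetric_on ip UNIV A \<Longrightarrow> (\<xi>, \<xi>') \<in> A \<Longrightarrow> (\<eta>, \<eta>') \<in> A \<Longrightarrow> ip \<xi>' \<eta> = ip \<xi> \<eta>'"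
  unfolding symmetric_iff by blast

lemma symmetric_closure:
  assumes "symmetric_on ip UNIV A"
  shows "symmetric_on ip UNIV (closure A)"
  unfolding symmetric_iff
proof clarify
  fix \<xi> \<xi>' \<eta> \<eta>' assume "(\<xi>, \<xi>') \<in> closure A" "(\<eta>, \<eta>') \<in> closure A"
  then obtain f g where f: "\<And>n. f n \<in> A" "f \<longlonglongrightarrow> (\<xi>, \<xi>')" and g: "\<And>n. g n \<in> A" "g \<longlonglongrightarrow> (\<eta>, \<eta>')"
    unfolding closure_sequential by metis
  have "(\<lambda>n. ip (snd (f n)) (fst (g n))) \<longlonglongrightarrow> ip \<xi>' \<eta>"
    using form.tendsto[OF tendsto_snd[OF f(2)] tendsto_fst[OF g(2)]] by simp
  moreover have "(\<lambda>n. ip (fst (f n)) (snd (g n))) \<longlonglongrightarrow> ip \<xi> \<eta>'"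
    using form.tendsto[OF tendsto_fst[OF f(2)] tendsto_snd[OF g(2)]] by simp
  moreover have "ip (snd (f n)) (fst (g n)) = ip (fst (f n)) (snd (g n))" for n
    using symmetricD[OF assms, of "fst (f n)" "snd (f n)" "fst (g n)" "snd (g n)"] f(1) g(1)
    by simp
  ultimately show "ip \<xi>' \<eta> = ip \<xi> \<eta>'" using LIMSEQ_unique by simp
qed

text \<open>The inner product of \<open>u\<close> and \<open>u'\<close> is selfadjoint, so \<open>\<mu>\<close> times that of \<open>u\<close> with itself is the
  imaginary part of the inner product of \<open>u\<close> and \<open>i\<mu> u + u'\<close>. Taking imaginary parts does not increase
  the norm, so no order on the algebra is involved.\<close>

lemma symmetric_lower_bound:
  assumes "symmetric_on ip UNIV A" "(u, u') \<in> A"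
  shows "\<bar>\<mu>\<bar> * norm u \<le> K\<^sup>2 * norm ((\<i> * complex_of_real \<mu>) *\<^sub>C u + u')"
proof (cases "u = 0")
  case False
  let ?w = "(\<i> * complex_of_real \<mu>) *\<^sub>C u + u'"
  have s: "ip u' u = ip u u'" using symmetricD[OF assms(1) assms(2) assms(2)] .
  have "ip u ?w - star (ip u ?w) = (2 * \<i> * complex_of_real \<mu>) *\<^sub>C ip u u"
  proof -
    have "ip u ?w - star (ip u ?w)
        = (\<i> * complex_of_real \<mu>) *\<^sub>C ip u u - (- \<i> * complex_of_real \<mu>) *\<^sub>C ip u u"
      by (simp add: star_add star_scaleC star_form form_add_right form_scaleC_right s)
    then show ?thesis by (simp add: mult.assoc flip: scaleC_diff_left)
  qed
  then have "norm ((2 * \<i> * complex_of_real \<mu>) *\<^sub>C ip u u) \<le> 2 * norm (ip u ?w)"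
    using norm_triangle_ineq4[of "ip u ?w" "star (ip u ?w)"] by (simp add: norm_star)
  then have "\<bar>\<mu>\<bar> * norm (ip u u) \<le> K * norm u * norm ?w"
    using norm_form_le[of u ?w] by (simp add: norm_scaleC norm_mult)
  moreover have "\<bar>\<mu>\<bar> * (norm u)\<^sup>2 \<le> K * (\<bar>\<mu>\<bar> * norm (ip u u))"
    using mult_left_mono[OF norm_le_form[of u], of "\<bar>\<mu>\<bar>"] by (simp add: mult_ac)
  ultimately have "\<bar>\<mu>\<bar> * (norm u)\<^sup>2 \<le> K * (K * norm u * norm ?w)"
    using K_pos by (meson mult_left_mono less_imp_le order_trans)
  then have "norm u * (\<bar>\<mu>\<bar> * norm u) \<le> norm u * (K\<^sup>2 * norm ?w)"
    by (simp add: power2_eq_square mult_ac)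
  then show ?thesis using False by simp
qed simp

lemma symmetric_inj:
  assumes "symmetric_on ip UNIV A" "subspace A" "\<mu> \<noteq> 0" "(u, u') \<in> A" "(v, v') \<in> A"
    and "(\<i> * complex_of_real \<mu>) *\<^sub>C u + u' = (\<i> * complex_of_real \<mu>) *\<^sub>C v + v'"
  shows "u = v" "u' = v'"
proof -
  have "(u - v, u' - v') \<in> A" using subspace_diff[OF assms(2) assms(4,5)] by simp
  from symmetric_lower_bound[OF assms(1) this, of \<mu>]
  have "\<bar>\<mu>\<bar> * norm (u - v) \<le> 0"
    using assms(6) by (simp add: scaleC_diff_right algebra_simps)
  then show "u = v" using assms(3) by (simp add: mult_le_0_iff)
  then show "u' = v'" using assms(6) by simp
qed

lemma symmetric_range_closed:
  assumes "symmetric_on ip UNIV A" "subspace A" "closed A" "\<mu> \<noteq> 0"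
  shows "closed (Range (op_add (scaleC (\<i> * complex_of_real \<mu>)) A))"
proof -
  let ?z = "\<i> * complex_of_real \<mu>"
  have "w \<in> Range (op_add (scaleC ?z) A)"
    if w: "\<And>n. W n \<in> Range (op_add (scaleC ?z) A)" "W \<longlonglongrightarrow> w" for W w
  proof -
    have "\<forall>n. \<exists>u u'. (u, u') \<in> A \<and> W n = ?z *\<^sub>C u + u'"
      using w(1) by (auto simp: op_add_iff Range_iff)
    then obtain u u' where u: "\<And>n. (u n, u' n) \<in> A" "\<And>n. W n = ?z *\<^sub>C u n + u' n" by metis
    have "Cauchy u"
    proof (rule CauchyI)
      fix e :: real assume "e > 0"
      then have "\<bar>\<mu>\<bar> * e / K\<^sup>2 > 0" using assms(4) K_pos by simp
      then obtain M where M: "\<And>m n. m \<ge> M \<Longrightarrow> n \<ge> M \<Longrightarrow> norm (W m - W n) < \<bar>\<mu>\<bar> * e / K\<^sup>2"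
        using CauchyD[OF LIMSEQ_imp_Cauchy[OF w(2)]] by metis
      have "norm (u m - u n) < e" if "m \<ge> M" "n \<ge> M" for m n
      proof -
        have "(u m - u n, u' m - u' n) \<in> A"
          using subspace_diff[OF assms(2) u(1)[of m] u(1)[of n]] by simp
        from symmetric_lower_bound[OF assms(1) this, of \<mu>]
        have "\<bar>\<mu>\<bar> * norm (u m - u n) \<le> K\<^sup>2 * norm (W m - W n)"
          by (simp add: u(2) scaleC_diff_right algebra_simps)
        also have "\<dots> < \<bar>\<mu>\<bar> * e"
          using M[OF that] K_pos by (simp add: field_simps)
        finally show ?thesis using assms(4) by simp
      qed
      then show "\<exists>M. \<forall>m\<ge>M. \<forall>n\<ge>M. norm (u m - u n) < e" by blast
    qed
    then obtain v where v: "u \<longlonglongrightarrow> v" using Cauchy_convergent_iff convergent_def by blast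
    have "(\<lambda>n. W n - ?z *\<^sub>C u n) \<longlonglongrightarrow> w - ?z *\<^sub>C v"
      by (intro tendsto_diff w(2) bounded_linear.tendsto[OF bounded_linear_scaleC] v)
    then have "u' \<longlonglongrightarrow> w - ?z *\<^sub>C v" by (simp add: u(2))
    then have "(\<lambda>n. (u n, u' n)) \<longlonglongrightarrow> (v, w - ?z *\<^sub>C v)" using v tendsto_Pair by blast
    then have "(v, w - ?z *\<^sub>C v) \<in> A"
      using closed_sequentially[OF assms(3), of "\<lambda>n. (u n, u' n)"] u(1) by blast
    then show ?thesis unfolding Range_iff op_add_iff by force
  qed
  then show ?thesis unfolding closed_sequential_limits by blast
qed

text \<open>The lower bound at \<open>\<mu>\<close> grows in proportion to \<open>\<bar>\<mu>\<bar>\<close>, so that the admissible relative step does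
  not depend on \<open>\<mu>\<close>. This is why finitely many geometric steps suffice in the next lemma.\<close>

lemma symmetric_range_step:
  assumes A: "symmetric_on ip UNIV A" "subspace A"
    and F: "closed F" "subspace F" "\<And>u z. u \<in> Domain A \<Longrightarrow> z *\<^sub>C u \<in> F"
    and surj: "F \<subseteq> Range (op_add (scaleC (\<i> * complex_of_real \<mu>)) A)" "\<mu> \<noteq> 0"
    and near: "K\<^sup>2 * \<bar>\<nu> - \<mu>\<bar> < \<bar>\<mu>\<bar>"
  shows "F \<subseteq> Range (op_add (scaleC (\<i> * complex_of_real \<nu>)) A)"
proof -
  let ?L = "op_add (scaleC (\<i> * complex_of_real \<mu>)) A"
  let ?P = "scaleC (\<i> * complex_of_real (\<nu> - \<mu>)) :: 'h \<Rightarrow> 'h"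
  have lin: "linear (scaleC z :: 'h \<Rightarrow> 'h)" for z
    using bounded_linear_scaleC bounded_linear.linear by blast
  have "F \<subseteq> Range (op_add ?P ?L)"
  proof (rule range_perturbation[of _ _ "K\<^sup>2 / \<bar>\<mu>\<bar>" _ "\<bar>\<nu> - \<mu>\<bar>"])
    show "subspace ?L" by (rule subspace_op_add[OF A(2) lin])
    show "norm u \<le> K\<^sup>2 / \<bar>\<mu>\<bar> * norm u'" if mem: "(u, u') \<in> ?L" for u u'
    proof -
      obtain v where "(u, v) \<in> A" "u' = (\<i> * complex_of_real \<mu>) *\<^sub>C u + v"
        using mem unfolding op_add_iff by blast
      then show ?thesis
        using symmetric_lower_bound[OF A(1), of u v \<mu>] surj(2) by (simp add: field_simps)
    qed
    show "norm (?P u) \<le> \<bar>\<nu> - \<mu>\<bar> * norm u" for u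
      by (simp add: norm_scaleC norm_mult del: of_real_diff)
    show "?P u \<in> F" if "u \<in> Domain ?L" for u
      using that F(3) by (auto simp: op_add_def)
    show "\<bar>\<nu> - \<mu>\<bar> * (K\<^sup>2 / \<bar>\<mu>\<bar>) < 1" using near surj(2) by (simp add: field_simps)
  qed (use F surj lin in auto)
  moreover have "op_add ?P ?L = op_add (scaleC (\<i> * complex_of_real \<nu>)) A"
    unfolding op_add_op_add by (simp add: algebra_simps flip: scaleC_add_left)
  ultimately show ?thesis by simp
qed

lemma symmetric_range_all:
  assumes A: "symmetric_on ip UNIV A" "subspace A"
    and F: "closed F" "subspace F" "\<And>u z. u \<in> Domain A \<Longrightarrow> z *\<^sub>C u \<in> F"
    and surj: "F \<subseteq> Range (op_add (scaleC (\<i> * complex_of_real \<mu>)) A)"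
    and sign: "\<mu> * \<nu> > 0"
  shows "F \<subseteq> Range (op_add (scaleC (\<i> * complex_of_real \<nu>)) A)"
proof -
  have t: "\<nu> / \<mu> > 0" and nz: "\<mu> \<noteq> 0" using sign by (auto simp: zero_less_mult_iff divide_simps)
  have "(\<lambda>n. root n (\<nu> / \<mu>)) \<longlonglongrightarrow> 1" using LIMSEQ_root_const[OF t] .
  then have "(\<lambda>n. K\<^sup>2 * \<bar>root n (\<nu> / \<mu>) - 1\<bar>) \<longlonglongrightarrow> K\<^sup>2 * \<bar>1 - 1\<bar>"
    by (intro tendsto_intros)
  then have "\<forall>\<^sub>F n in sequentially. K\<^sup>2 * \<bar>root n (\<nu> / \<mu>) - 1\<bar> < 1"
    by (rule order_tendstoD) simp
  then obtain n where n: "n > 0" "K\<^sup>2 * \<bar>root n (\<nu> / \<mu>) - 1\<bar> < 1"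
    using eventually_gt_at_top[of 0] eventually_conj eventually_sequentially
    by (metis (no_types, lifting) le_refl max.cobounded1 max.cobounded2)
  define s where "s = root n (\<nu> / \<mu>)"
  have s: "s > 0" "\<mu> * s ^ n = \<nu>" "K\<^sup>2 * \<bar>s - 1\<bar> < 1"
    using n t nz by (simp_all add: s_def)
  have "F \<subseteq> Range (op_add (scaleC (\<i> * complex_of_real (\<mu> * s ^ k))) A)" for k
  proof (induction k)
    case 0
    then show ?case using surj by simp
  next
    case (Suc k)
    show ?case
    proof (rule symmetric_range_step[OF A F Suc])
      have "\<mu> * s ^ Suc k - \<mu> * s ^ k = (\<mu> * s ^ k) * (s - 1)" by (simp add: algebra_simps)
      then have "K\<^sup>2 * \<bar>\<mu> * s ^ Suc k - \<mu> * s ^ k\<bar> = \<bar>\<mu> * s ^ k\<bar> * (K\<^sup>2 * \<bar>s - 1\<bar>)"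
        by (simp only: abs_mult mult_ac)
      also have "\<dots> < \<bar>\<mu> * s ^ k\<bar> * 1"
        by (rule mult_strict_left_mono[OF s(3)]) (use s(1) nz in simp)
      finally show "K\<^sup>2 * \<bar>\<mu> * s ^ Suc k - \<mu> * s ^ k\<bar> < \<bar>\<mu> * s ^ k\<bar>" by simp
    qed (use s(1) nz in simp_all)
  qed
  from this[of n] show ?thesis by (simp add: s(2))
qed

lemma symmetric_bounded_surj:
  assumes S: "linear S" "\<And>\<xi>. norm (S \<xi>) \<le> M * norm \<xi>" and sym: "\<And>\<xi> \<eta>. ip (S \<xi>) \<eta> = ip \<xi> (S \<eta>)"
    and "\<mu> \<noteq> 0"
  obtains \<xi> where "(\<i> * complex_of_real \<mu>) *\<^sub>C \<xi> + S \<xi> = \<eta>"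
proof -
  let ?G = "{(\<xi>, S \<xi>) |\<xi>. True}"
  define N where "N = sgn \<mu> * (\<bar>M\<bar> + 1)"
  have N: "\<bar>N\<bar> = \<bar>M\<bar> + 1" "N * \<mu> > 0"
    using \<open>\<mu> \<noteq> 0\<close> by (auto simp: N_def abs_mult sgn_if zero_less_mult_iff)
  let ?L = "{(\<xi>, (\<i> * complex_of_real N) *\<^sub>C \<xi>) |\<xi>. True} :: ('h \<times> 'h) set"
  have sub: "subspace {(\<xi>, f \<xi>) |\<xi>. True}" if "linear f" for f :: "'h \<Rightarrow> 'h"
    using that by (auto simp: subspace_def linear_add linear_cmul linear_0 zero_prod_def)
  have "UNIV \<subseteq> Range (op_add S ?L)"
  proof (rule range_perturbation[of _ _ "1 / (\<bar>M\<bar> + 1)" _ "\<bar>M\<bar>"])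
    show "subspace ?L" by (rule sub) (use bounded_linear_scaleC bounded_linear.linear in blast)
    show "UNIV \<subseteq> Range ?L"
    proof
      fix \<eta> :: 'h
      have "(\<i> * complex_of_real N) *\<^sub>C (inverse (\<i> * complex_of_real N) *\<^sub>C \<eta>) = \<eta>"
        using N by (simp add: scaleC_scaleC del: inverse_mult_distrib)
      then show "\<eta> \<in> Range ?L" by (metis (mono_tags, lifting) Range.intros mem_Collect_eq)
    qed
    show "norm (S \<xi>) \<le> \<bar>M\<bar> * norm \<xi>" for \<xi>
      using S(2)[of \<xi>] by (meson abs_ge_self mult_right_mono norm_ge_zero order_trans)
  qed (use N S in \<open>auto simp: norm_scaleC norm_mult\<close>)
  moreover have "op_add S ?L = op_add (scaleC (\<i> * complex_of_real N)) ?G"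
    by (auto simp: op_add_def add.commute)
  ultimately have "UNIV \<subseteq> Range (op_add (scaleC (\<i> * complex_of_real N)) ?G)" by simp
  then have "UNIV \<subseteq> Range (op_add (scaleC (\<i> * complex_of_real \<mu>)) ?G)"
    by (intro symmetric_range_all[of ?G UNIV N \<mu>])
      (use N S(1) sub sym in \<open>auto simp: symmetric_iff\<close>)
  then have "\<eta> \<in> Range (op_add (scaleC (\<i> * complex_of_real \<mu>)) ?G)" by blast
  then show thesis using that by (auto simp: op_add_def)
qed

text \<open>A weakly null bounded sequence has convex combinations that tend to \<open>0\<close> in norm. Averaging each term
  with a later one that is almost orthogonal to it roughly halves \<open>\<parallel>\<langle>v, v\<rangle>\<parallel>\<close> and leaves the
  sequence weakly null, so the step can be iterated.\<close>

lemma banach_saks: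
  fixes v :: "nat \<Rightarrow> 'h"
  assumes C: "closed C" "convex C" and v: "\<And>n. v n \<in> C" "\<And>n. norm (v n) \<le> M"
    and weak: "\<And>w. (\<lambda>n. ip (v n) w) \<longlonglongrightarrow> 0"
  shows "0 \<in> C"
proof -
  define m where "m = K * M\<^sup>2 + 1"
  have "m > 0" using K_pos by (simp add: m_def add_nonneg_pos)
  have "\<exists>v. (\<forall>n. v n \<in> C) \<and> (\<forall>w. (\<lambda>n. ip (v n) w) \<longlonglongrightarrow> 0) \<and>
      (\<forall>n. norm (ip (v n) (v n)) \<le> (5/8) ^ k * m)" for k
  proof (induction k)
    case 0
    have "norm (ip (v n) (v n)) \<le> m" for n
    proof -
      have "norm (ip (v n) (v n)) \<le> K * (norm (v n))\<^sup>2"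
        using norm_form_le[of "v n" "v n"] by (simp add: power2_eq_square mult.assoc)
      also have "\<dots> \<le> K * M\<^sup>2" using v(2)[of n] K_pos by (intro mult_left_mono power_mono) auto
      finally show ?thesis by (simp add: m_def)
    qed
    then show ?case using v(1) weak by auto
  next
    case (Suc k)
    then obtain v where v: "\<And>n. v n \<in> C" "\<And>w. (\<lambda>n. ip (v n) w) \<longlonglongrightarrow> 0"
      "\<And>n. norm (ip (v n) (v n)) \<le> (5/8) ^ k * m" by blast
    let ?q = "(5/8) ^ k * m"
    have "?q > 0" using \<open>m > 0\<close> by simp
    have "\<exists>b\<ge>j. norm (ip (v b) (v j)) \<le> ?q / 4" for j
    proof -
      have "?q / 4 > 0" using \<open>?q > 0\<close> by simp
      then obtain N where "\<And>n. n \<ge> N \<Longrightarrow> norm (ip (v n) (v j)) < ?q / 4"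
        using LIMSEQ_D[OF v(2)[of "v j"]] by (metis diff_zero)
      then show ?thesis by (meson less_imp_le nle_le)
    qed
    then obtain b where b: "\<And>j. b j \<ge> j" "\<And>j. norm (ip (v (b j)) (v j)) \<le> ?q / 4" by metis
    \<comment> \<open>With all four inner products under control, \<open>\<parallel>\<langle>v', v'\<rangle>\<parallel> \<le> (1 + 1 + 1/4 + 1/4) / 4 = 5/8\<close> times
  the old bound.\<close>
    define v' where "v' = (\<lambda>j. (1/2) *\<^sub>R v j + (1/2) *\<^sub>R v (b j))"
    have "v' j \<in> C" for j
      unfolding v'_def using C(2) v(1) by (intro convexD) auto
    moreover have "(\<lambda>n. ip (v' n) w) \<longlonglongrightarrow> 0" for w
    proof -
      have "filterlim b at_top sequentially"
        using filterlim_at_top_mono[OF filterlim_ident, of b] b(1) by (simp add: always_eventually)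
      then have "(\<lambda>n. ip (v (b n)) w) \<longlonglongrightarrow> 0" using v(2) filterlim_compose by blast
      from tendsto_add[OF tendsto_scaleR[OF tendsto_const[of "1/2"] v(2)[of w]]
          tendsto_scaleR[OF tendsto_const[of "1/2"] this]]
      show ?thesis by (simp add: v'_def form_add_left form.scaleR_left)
    qed
    moreover have "norm (ip (v' j) (v' j)) \<le> (5/8) ^ Suc k * m" for j
    proof -
      have e: "ip (v' j) (v' j) = (1/4) *\<^sub>R (ip (v j) (v j) + ip (v (b j)) (v (b j))
          + ip (v (b j)) (v j) + ip (v j) (v (b j)))"
        unfolding v'_def
        by (simp add: form_add_left form_add_right form.scaleR_left form.scaleR_right
            scaleR_add_right algebra_simps)
      have "norm (ip (v j) (v (b j))) = norm (ip (v (b j)) (v j))"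
        by (metis norm_star star_form)
      then have "norm (ip (v j) (v j) + ip (v (b j)) (v (b j))
          + ip (v (b j)) (v j) + ip (v j) (v (b j))) \<le> ?q + ?q + ?q / 4 + ?q / 4"
        using v(3)[of j] v(3)[of "b j"] b(2)[of j] by (intro norm_triangle_mono) auto
      then show ?thesis unfolding e by (simp add: mult_ac)
    qed
    ultimately show ?case by blast
  qed
  then have "\<exists>c\<in>C. norm (ip c c) \<le> (5/8) ^ k * m" for k by blast
  then obtain c where c: "\<And>k. c k \<in> C" "\<And>k. norm (ip (c k) (c k)) \<le> (5/8) ^ k * m" by metis
  have "(\<lambda>k. (norm (c k))\<^sup>2) \<longlonglongrightarrow> 0"
  proof (rule tendsto_sandwich[OF _ _ tendsto_const])
    show "\<forall>\<^sub>F k in sequentially. (norm (c k))\<^sup>2 \<le> K * ((5/8) ^ k * m)"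
      using norm_le_form c(2) K_pos
      by (intro always_eventually allI) (meson less_imp_le mult_left_mono order_trans)
    show "(\<lambda>k. K * ((5/8) ^ k * m)) \<longlonglongrightarrow> 0"
      by (intro tendsto_mult_right_zero tendsto_mult_left_zero LIMSEQ_power_zero) simp
  qed simp
  then have "(\<lambda>k. sqrt ((norm (c k))\<^sup>2)) \<longlonglongrightarrow> sqrt 0" by (intro tendsto_intros)
  then have "c \<longlonglongrightarrow> 0" by (simp add: tendsto_norm_zero_iff)
  then show "0 \<in> C" using C(1) c(1) closed_sequentially by blast
qed

end

section \<open>Compressions of operators with resolvents\<close>

text \<open>These operators are the selfadjoint regular ones; surjectivity of \<open>i\<mu> + A\<close> is the form of
  regularity in which they occur.\<close>

locale regular_symmetric = cstar_form ip K
  for ip :: "'h::complex_banach \<Rightarrow> 'h \<Rightarrow> 'b::cstar_algebra" and K +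
  fixes A :: "('h \<times> 'h) set"
  assumes A_subspace: "subspace A"
    and A_scaleC: "(u, u') \<in> A \<Longrightarrow> (z *\<^sub>C u, z *\<^sub>C u') \<in> A"
    and A_symmetric: "symmetric_on ip UNIV A"
    and A_dense: "closure (Domain A) = UNIV"
    and A_surj: "\<mu> \<noteq> 0 \<Longrightarrow> Range (op_add (scaleC (\<i> * complex_of_real \<mu>)) A) = UNIV"
begin

text \<open>\<open>J t = it (A + it)\<inverse>\<close>, which tends strongly to the identity as \<open>\<bar>t\<bar> \<rightarrow> \<infinity>\<close>.\<close>

definition J :: "real \<Rightarrow> 'h \<Rightarrow> 'h" where
  "J t \<xi> = (SOME u. (u, (\<i> * complex_of_real t) *\<^sub>C (\<xi> - u)) \<in> A)"

lemma J_graph: "(J t \<xi>, (\<i> * complex_of_real t) *\<^sub>C (\<xi> - J t \<xi>)) \<in> A" if t: "t \<noteq> 0"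
proof -
  let ?z = "\<i> * complex_of_real t"
  have "?z *\<^sub>C \<xi> \<in> Range (op_add (scaleC ?z) A)" using A_surj[OF t] by simp
  then obtain u u' where u: "(u, u') \<in> A" "?z *\<^sub>C \<xi> = ?z *\<^sub>C u + u'"
    unfolding Range_iff op_add_iff by blast
  then have "(u, ?z *\<^sub>C (\<xi> - u)) \<in> A" by (simp add: scaleC_diff_right)
  then show ?thesis unfolding J_def by (rule someI)
qed

lemma J_eqI:
  assumes "t \<noteq> 0" "(u, u') \<in> A" "(\<i> * complex_of_real t) *\<^sub>C u + u' = (\<i> * complex_of_real t) *\<^sub>C \<xi>"
  shows "J t \<xi> = u"
  by (rule symmetric_inj(1)[OF A_symmetric A_subspace assms(1) J_graph[OF assms(1)] assms(2)])
    (simp add: assms(3) scaleC_diff_right)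

lemma J_add: "J t (\<xi> + \<eta>) = J t \<xi> + J t \<eta>" if t: "t \<noteq> 0"
  by (rule J_eqI[OF t], rule subspace_add[OF A_subspace J_graph[OF t] J_graph[OF t],
        unfolded add_Pair])
    (simp add: scaleC_diff_right scaleC_add_right)

lemma J_scaleC: "J t (z *\<^sub>C \<xi>) = z *\<^sub>C J t \<xi>" if t: "t \<noteq> 0"
  by (rule J_eqI[OF t], rule A_scaleC[OF J_graph[OF t]])
    (simp add: scaleC_diff_right scaleC_scaleC mult.commute)

lemma J_linear: "linear (J t)" if t: "t \<noteq> 0"
  by unfold_locales (simp_all add: J_add[OF t] J_scaleC[OF t] scaleR_scaleC)

lemma norm_J_le: "norm (J t \<xi>) \<le> K\<^sup>2 * norm \<xi>" if t: "t \<noteq> 0"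
  using symmetric_lower_bound[OF A_symmetric J_graph[OF t], of t \<xi>] t
  by (simp add: norm_scaleC norm_mult scaleC_diff_right)

lemma J_adjoint: "ip (J t \<xi>) \<eta> = ip \<xi> (J (- t) \<eta>)" if t: "t \<noteq> 0"
proof -
  let ?z = "\<i> * complex_of_real t"
  let ?u = "J t \<xi>" and ?v = "J (- t) \<eta>"
  have t': "- t \<noteq> 0" using t by simp
  have "ip (?z *\<^sub>C (\<xi> - ?u)) ?v = ip ?u ((\<i> * complex_of_real (- t)) *\<^sub>C (\<eta> - ?v))"
    by (rule symmetricD[OF A_symmetric J_graph[OF t] J_graph[OF t']])
  then have "?z *\<^sub>C ip (\<xi> - ?u) ?v = ?z *\<^sub>C ip ?u (\<eta> - ?v)"
    by (simp add: form_scaleC_left form_scaleC_right scaleC_minus_left form.minus_right)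
  then have "inverse ?z *\<^sub>C (?z *\<^sub>C ip (\<xi> - ?u) ?v) = inverse ?z *\<^sub>C (?z *\<^sub>C ip ?u (\<eta> - ?v))"
    by simp
  then have "ip (\<xi> - ?u) ?v = ip ?u (\<eta> - ?v)"
    using t by (simp add: scaleC_scaleC del: inverse_mult_distrib)
  then show ?thesis by (simp add: form.diff_left form.diff_right)
qed

text \<open>On \<open>Dom A\<close> the difference \<open>\<xi> - J t \<xi>\<close> is \<open>(it + A)\<inverse> A \<xi>\<close>, of order \<open>1/\<bar>t\<bar>\<close>; the uniform bound on
  \<open>J t\<close> extends the convergence to the closure of \<open>Dom A\<close>. Convergence is wanted along both signs of \<open>t\<close>.\<close>

lemma J_tendsto:
  assumes e: "e > 0"
  obtains T where "T > 0" "\<And>t. \<bar>t\<bar> \<ge> T \<Longrightarrow> norm (\<xi> - J t \<xi>) < e"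
proof -
  have k: "1 + K\<^sup>2 > 0" by (simp add: add_pos_nonneg)
  have "\<xi> \<in> closure (Domain A)" using A_dense by simp
  moreover have "e / (2 * (1 + K\<^sup>2)) > 0" using e k by simp
  ultimately obtain u where u: "u \<in> Domain A" "dist u \<xi> < e / (2 * (1 + K\<^sup>2))"
    unfolding closure_approachable by metis
  obtain u' where u': "(u, u') \<in> A" using u(1) by blast
  define T where "T = 2 * (K\<^sup>2 * norm u') / e + 1"
  have T: "T > 0" using e by (simp add: T_def add_nonneg_pos)
  have "norm (\<xi> - J t \<xi>) < e" if t: "\<bar>t\<bar> \<ge> T" for t
  proof -
    have t0: "t \<noteq> 0" using t T by auto
    have "(u - J t u, u' - (\<i> * complex_of_real t) *\<^sub>C (u - J t u)) \<in> A"
      using subspace_diff[OF A_subspace u' J_graph[OF t0]] by simp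
    from symmetric_lower_bound[OF A_symmetric this, of t]
    have "\<bar>t\<bar> * norm (u - J t u) \<le> K\<^sup>2 * norm u'" by simp
    also have "\<dots> < \<bar>t\<bar> * (e / 2)"
    proof -
      have "K\<^sup>2 * norm u' < T * (e / 2)" using e by (simp add: T_def field_simps)
      also have "\<dots> \<le> \<bar>t\<bar> * (e / 2)" using t e by (intro mult_right_mono) auto
      finally show ?thesis .
    qed
    finally have 1: "norm (u - J t u) < e / 2" using t0 by simp
    have split: "\<xi> - J t \<xi> = (u - J t u) + ((\<xi> - u) - J t (\<xi> - u))"
      by (simp add: linear_diff[OF J_linear[OF t0]])
    have "norm ((\<xi> - u) - J t (\<xi> - u)) \<le> norm (\<xi> - u) + K\<^sup>2 * norm (\<xi> - u)"
      using norm_J_le[OF t0, of "\<xi> - u"] norm_triangle_ineq4[of "\<xi> - u" "J t (\<xi> - u)"] by linarith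
    moreover have "norm (\<xi> - u) + K\<^sup>2 * norm (\<xi> - u) < e / 2"
      using u(2) k by (simp add: dist_norm norm_minus_commute field_simps)
    ultimately show ?thesis
      unfolding split using 1 norm_triangle_ineq[of "u - J t u" "(\<xi> - u) - J t (\<xi> - u)"]
      by linarith
  qed
  then show thesis using that T by blast
qed

lemma J_filterlim:
  assumes "filterlim (\<lambda>n. \<bar>s n\<bar>) at_top F"
  shows "((\<lambda>n. J (s n) \<xi>) \<longlongrightarrow> \<xi>) F"
proof (rule tendstoI)
  fix e :: real assume "e > 0"
  then obtain T where T: "T > 0" "\<And>t. \<bar>t\<bar> \<ge> T \<Longrightarrow> norm (\<xi> - J t \<xi>) < e" using J_tendsto by blast
  have "\<forall>\<^sub>F n in F. T \<le> \<bar>s n\<bar>" using assms unfolding filterlim_at_top by blast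
  then show "\<forall>\<^sub>F n in F. dist (J (s n) \<xi>) \<xi> < e"
    by eventually_elim (use T(2) in \<open>simp add: dist_norm norm_minus_commute\<close>)
qed

text \<open>With \<open>Y u' + d u\<close> in the role of \<open>A Y u\<close>, the set on the left is the range of \<open>i\<mu> + X A Y\<close> on
  \<open>Dom A\<close>. Averaging the resolvents at \<open>t\<close> and \<open>- t\<close> makes the bounded approximation of \<open>A\<close>
  selfadjoint. The commutator of \<open>Y\<close> with \<open>A J t\<close> is \<open>- J t d J t\<close>, so the error made by
  the approximation is \<open>E t = i\<mu> (J t - 1) + X (1 - J t) d J t\<close>; each term of its
  adjoint applies \<open>1 - J (- t)\<close> to a fixed vector before anything that depends on \<open>t\<close>.\<close>

lemma compression_dense_range:
  assumes XY: "bounded_linear X" "bounded_linear Y" "\<And>\<xi> \<eta>. ip (X \<xi>) \<eta> = ip \<xi> (Y \<eta>)"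
    and Y_scaleC: "\<And>z \<xi>. Y (z *\<^sub>C \<xi>) = z *\<^sub>C Y \<xi>"
    and d: "bounded_linear d" "bounded_linear d'" "\<And>\<xi> \<eta>. ip (d \<xi>) \<eta> = ip \<xi> (d' \<eta>)"
    and comm: "\<And>u u'. (u, u') \<in> A \<Longrightarrow> (Y u, Y u' + d u) \<in> A"
    and \<mu>: "\<mu> \<noteq> 0"
  shows "closure {(\<i> * complex_of_real \<mu>) *\<^sub>C u + X (Y u' + d u) |u u'. (u, u') \<in> A} = UNIV"
    (is "closure ?N = UNIV")
proof -
  note lX = bounded_linear.linear[OF XY(1)] and lY = bounded_linear.linear[OF XY(2)]
    and ld = bounded_linear.linear[OF d(1)] and ld' = bounded_linear.linear[OF d(2)]
  have N_sub: "subspace ?N"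
  proof -
    have "linear (\<lambda>(u, u'). (\<i> * complex_of_real \<mu>) *\<^sub>C u + X (Y u' + d u))"
      by unfold_locales (auto simp: linear_add[OF lX] linear_add[OF lY] linear_add[OF ld]
          linear_cmul[OF lX] linear_cmul[OF lY] linear_cmul[OF ld] scaleC_add_right scaleC_scaleR
          algebra_simps)
    from linear_subspace_image[OF this A_subspace]
    show ?thesis by (rule back_subst[of subspace]) (auto simp: image_iff)
  qed
  define q where "q = (\<lambda>t \<xi>. (\<i> * complex_of_real t) *\<^sub>C (\<xi> - J t \<xi>))"
  define t where "t = (\<lambda>n. real (Suc n))"
  have t: "t n \<noteq> 0" "- t n \<noteq> 0" for n by (simp_all add: t_def)
  have Jq: "(J s \<xi>, q s \<xi>) \<in> A" if "s \<noteq> 0" for s \<xi> using J_graph[OF that] by (simp add: q_def)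
  \<comment> \<open>A bounded selfadjoint approximation \<open>B n\<close> of \<open>A\<close>.\<close>
  define r where "r = (\<lambda>n \<xi>. (1/2) *\<^sub>R (J (t n) \<xi> + J (- t n) \<xi>))"
  define B where "B = (\<lambda>n \<xi>. (1/2) *\<^sub>R (q (t n) \<xi> + q (- t n) \<xi>))"
  have rB: "(r n \<xi>, B n \<xi>) \<in> A" for n \<xi>
    using subspace_scale[OF A_subspace subspace_add[OF A_subspace Jq[OF t(1)] Jq[OF t(2)]], of "1/2"]
    by (simp add: r_def B_def)
  have q_adj: "ip (q s \<xi>) \<eta> = ip \<xi> (q (- s) \<eta>)" if "s \<noteq> 0" for s \<xi> \<eta>
    using J_adjoint[OF that, of \<xi> \<eta>]
    by (simp add: q_def form_scaleC_left form_scaleC_right form.diff_left form.diff_right)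
  have B_sym: "ip (B n \<xi>) \<eta> = ip \<xi> (B n \<eta>)" for n \<xi> \<eta>
    using q_adj[OF t(1)] q_adj[OF t(2)]
    by (simp add: B_def form.scaleR_left form.scaleR_right form_add_left form_add_right add.commute)
  have q_bl: "bounded_linear (q s)" if s: "s \<noteq> 0" for s
  proof -
    have "bounded_linear (J s)"
      by (rule bounded_linear_intro[of _ "K\<^sup>2"])
        (use norm_J_le[OF s] in \<open>simp_all add: linear_add[OF J_linear[OF s]]
          linear_cmul[OF J_linear[OF s]] mult.commute\<close>)
    then show ?thesis unfolding q_def
      by (intro bounded_linear_compose[OF bounded_linear_scaleC] bounded_linear_sub
          bounded_linear_ident)
  qed
  have B_bl: "bounded_linear (B n)" for n
    unfolding B_def
    by (intro bounded_linear_compose[OF bounded_linear_scaleR_right] bounded_linear_add q_bl t)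
  \<comment> \<open>Apply \<open>J s\<close> to the identity \<open>(is + A) Y J s = is Y + d J s\<close>.\<close>
  have comm_q: "Y (q s \<xi>) - q s (Y \<xi>) = - J s (d (J s \<xi>))" if s: "s \<noteq> 0" for s \<xi>
  proof -
    let ?z = "\<i> * complex_of_real s"
    have "J s (Y \<xi> + inverse ?z *\<^sub>C d (J s \<xi>)) = Y (J s \<xi>)"
      by (rule J_eqI[OF s comm[OF Jq[OF s]]])
        (use s in \<open>simp add: q_def Y_scaleC linear_diff[OF lY] scaleC_add_right scaleC_scaleC
            scaleC_diff_right del: inverse_mult_distrib\<close>)
    then have "J s (Y \<xi>) + inverse ?z *\<^sub>C J s (d (J s \<xi>)) = Y (J s \<xi>)"
      by (simp add: J_add[OF s] J_scaleC[OF s] del: inverse_mult_distrib)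
    then have "?z *\<^sub>C (J s (Y \<xi>) + inverse ?z *\<^sub>C J s (d (J s \<xi>))) = ?z *\<^sub>C Y (J s \<xi>)" by simp
    then have "?z *\<^sub>C J s (Y \<xi>) + J s (d (J s \<xi>)) = ?z *\<^sub>C Y (J s \<xi>)"
      using s by (simp add: scaleC_add_right scaleC_scaleC del: inverse_mult_distrib)
    then show ?thesis
      by (simp add: q_def Y_scaleC linear_diff[OF lY] scaleC_diff_right algebra_simps)
  qed
  define E where "E = (\<lambda>s \<xi>. (\<i> * complex_of_real \<mu>) *\<^sub>C (J s \<xi> - \<xi>)
      + X (d (J s \<xi>) - J s (d (J s \<xi>))))"
  define E' where "E' = (\<lambda>s w. (- \<i> * complex_of_real \<mu>) *\<^sub>C (J (- s) w - w)
      + J (- s) (d' (Y w - J (- s) (Y w))))"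
  have E_adj: "ip (E s \<xi>) w = ip \<xi> (E' s w)" if "s \<noteq> 0" for s \<xi> w
    using that by (simp add: E_def E'_def form_add_left form_add_right form_scaleC_left
        form_scaleC_right form.diff_left form.diff_right XY(3) d(3) J_adjoint linear_diff[OF ld']
        linear_diff[OF J_linear])
  have E'_0: "(\<lambda>n. E' (s n) w) \<longlonglongrightarrow> 0"
    if s: "filterlim (\<lambda>n. \<bar>s n\<bar>) at_top sequentially" "\<And>n. s n \<noteq> 0" for s w
  proof -
    have s': "filterlim (\<lambda>n. \<bar>- s n\<bar>) at_top sequentially" using s(1) by simp
    have "(\<lambda>n. (- \<i> * complex_of_real \<mu>) *\<^sub>C (J (- s n) w - w)) \<longlonglongrightarrow> (- \<i> * complex_of_real \<mu>) *\<^sub>C (w - w)"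
      by (intro bounded_linear.tendsto[OF bounded_linear_scaleC] tendsto_diff J_filterlim s'
          tendsto_const)
    moreover have "(\<lambda>n. J (- s n) (d' (Y w - J (- s n) (Y w)))) \<longlonglongrightarrow> 0"
    proof (rule Lim_null_comparison)
      show "\<forall>\<^sub>F n in sequentially. norm (J (- s n) (d' (Y w - J (- s n) (Y w))))
          \<le> K\<^sup>2 * norm (d' (Y w - J (- s n) (Y w)))"
        using norm_J_le s(2) by (intro always_eventually allI) auto
      have "(\<lambda>n. K\<^sup>2 * norm (d' (Y w - J (- s n) (Y w)))) \<longlonglongrightarrow> K\<^sup>2 * norm (d' (Y w - Y w))"
        by (intro tendsto_intros bounded_linear.tendsto[OF d(2)] J_filterlim s')
      then show "(\<lambda>n. K\<^sup>2 * norm (d' (Y w - J (- s n) (Y w)))) \<longlonglongrightarrow> 0"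
        by (simp add: linear_0[OF ld'])
    qed
    ultimately show ?thesis unfolding E'_def using tendsto_add by fastforce
  qed
  obtain kX where kX: "kX > 0" "\<And>\<xi>. norm (X \<xi>) \<le> norm \<xi> * kX"
    using bounded_linear.pos_bounded[OF XY(1)] by auto
  obtain kd where kd: "kd > 0" "\<And>\<xi>. norm (d \<xi>) \<le> norm \<xi> * kd"
    using bounded_linear.pos_bounded[OF d(1)] by auto
  define M where "M = \<bar>\<mu>\<bar> * (K\<^sup>2 + 1) + kX * ((1 + K\<^sup>2) * (kd * K\<^sup>2))"
  have E_bd: "norm (E s \<xi>) \<le> M * norm \<xi>" if s: "s \<noteq> 0" for s \<xi>
  proof -
    have "norm (J s \<xi> - \<xi>) \<le> (K\<^sup>2 + 1) * norm \<xi>"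
      using norm_triangle_ineq4[of "J s \<xi>" \<xi>] norm_J_le[OF s, of \<xi>] by (simp add: algebra_simps)
    then have 1: "norm ((\<i> * complex_of_real \<mu>) *\<^sub>C (J s \<xi> - \<xi>)) \<le> \<bar>\<mu>\<bar> * ((K\<^sup>2 + 1) * norm \<xi>)"
      by (simp add: norm_scaleC norm_mult mult_left_mono)
    let ?w = "d (J s \<xi>)"
    have "norm ?w \<le> kd * norm (J s \<xi>)" using kd(2) by (simp add: mult.commute)
    also have "\<dots> \<le> kd * (K\<^sup>2 * norm \<xi>)"
      by (rule mult_left_mono[OF norm_J_le[OF s]]) (use kd(1) in simp)
    finally have "norm ?w \<le> kd * (K\<^sup>2 * norm \<xi>)" .
    then have "(1 + K\<^sup>2) * norm ?w \<le> (1 + K\<^sup>2) * (kd * (K\<^sup>2 * norm \<xi>))"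
      by (rule mult_left_mono) simp
    moreover have "norm (?w - J s ?w) \<le> (1 + K\<^sup>2) * norm ?w"
      using norm_triangle_ineq4[of ?w "J s ?w"] norm_J_le[OF s, of ?w] by (simp add: algebra_simps)
    ultimately have "kX * norm (?w - J s ?w) \<le> kX * ((1 + K\<^sup>2) * (kd * (K\<^sup>2 * norm \<xi>)))"
      using kX(1) by (intro mult_left_mono) auto
    then have "norm (X (?w - J s ?w)) \<le> kX * ((1 + K\<^sup>2) * (kd * (K\<^sup>2 * norm \<xi>)))"
      using kX(2)[of "?w - J s ?w"] by (simp add: mult.commute)
    then have "norm (E s \<xi>) \<le> \<bar>\<mu>\<bar> * ((K\<^sup>2 + 1) * norm \<xi>) + kX * ((1 + K\<^sup>2) * (kd * (K\<^sup>2 * norm \<xi>)))"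
      unfolding E_def using 1 norm_triangle_mono by blast
    then show ?thesis by (simp add: M_def algebra_simps)
  qed
  have "\<eta> \<in> closure ?N" for \<eta>
  proof -
    have "\<exists>\<xi>. (\<i> * complex_of_real \<mu>) *\<^sub>C \<xi> + X (B n (Y \<xi>)) = \<eta>" for n
    proof -
      have bl: "bounded_linear (\<lambda>\<xi>. X (B n (Y \<xi>)))"
        by (intro bounded_linear_compose[OF XY(1)] bounded_linear_compose[OF B_bl XY(2)])
      obtain k where "\<And>\<xi>. norm (X (B n (Y \<xi>))) \<le> norm \<xi> * k"
        using bounded_linear.bounded[OF bl] by auto
      then have k: "\<And>\<xi>. norm (X (B n (Y \<xi>))) \<le> k * norm \<xi>" by (simp add: mult.commute)
      have YX: "ip (Y \<xi>) \<eta> = ip \<xi> (X \<eta>)" for \<xi> \<eta> by (metis XY(3) star_form)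
      show ?thesis
        by (rule symmetric_bounded_surj[OF bounded_linear.linear[OF bl] k _ \<mu>, of \<eta>])
          (auto simp: XY(3) B_sym YX)
    qed
    then obtain \<xi> where \<xi>: "\<And>n. (\<i> * complex_of_real \<mu>) *\<^sub>C \<xi> n + X (B n (Y (\<xi> n))) = \<eta>" by metis
    have \<xi>_bd: "norm (\<xi> n) \<le> K\<^sup>2 * norm \<eta> / \<bar>\<mu>\<bar>" for n
    proof -
      have YX: "ip (Y \<xi>) \<eta> = ip \<xi> (X \<eta>)" for \<xi> \<eta> by (metis XY(3) star_form)
      have "symmetric_on ip UNIV {(\<xi>, X (B n (Y \<xi>))) |\<xi>. True}"
        by (auto simp: symmetric_iff XY(3) B_sym YX)
      from symmetric_lower_bound[OF this, of "\<xi> n" "X (B n (Y (\<xi> n)))" \<mu>]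
      have "\<bar>\<mu>\<bar> * norm (\<xi> n) \<le> K\<^sup>2 * norm \<eta>" unfolding \<xi> by blast
      then show ?thesis using \<mu> by (simp add: field_simps)
    qed
    \<comment> \<open>The error of \<open>r n (\<xi> n)\<close> as a solution.\<close>
    define v where "v = (\<lambda>n. (1/2) *\<^sub>R (E (t n) (\<xi> n) + E (- t n) (\<xi> n)))"
    have v_eq: "(\<i> * complex_of_real \<mu>) *\<^sub>C r n (\<xi> n) + X (Y (B n (\<xi> n)) + d (r n (\<xi> n))) - \<eta> = v n" for n
    proof -
      have YB: "Y (B n (\<xi> n)) = B n (Y (\<xi> n))
          - (1/2) *\<^sub>R (J (t n) (d (J (t n) (\<xi> n))) + J (- t n) (d (J (- t n) (\<xi> n))))"
      proof -
        have "Y (B n (\<xi> n)) - B n (Y (\<xi> n)) = (1/2) *\<^sub>R ((Y (q (t n) (\<xi> n)) - q (t n) (Y (\<xi> n)))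
            + (Y (q (- t n) (\<xi> n)) - q (- t n) (Y (\<xi> n))))"
          by (simp add: B_def linear_add[OF lY] linear_cmul[OF lY] algebra_simps)
        also have "\<dots> = - ((1/2) *\<^sub>R (J (t n) (d (J (t n) (\<xi> n))) + J (- t n) (d (J (- t n) (\<xi> n)))))"
          by (simp add: comm_q[OF t(1)] comm_q[OF t(2)] algebra_simps)
        finally show ?thesis by (simp add: algebra_simps)
      qed
      have half: "a = (1/2) *\<^sub>R (a + a)" for a :: 'h by (simp flip: scaleR_2)
      have rr: "(\<i> * complex_of_real \<mu>) *\<^sub>C r n (\<xi> n) - (\<i> * complex_of_real \<mu>) *\<^sub>C \<xi> n
        = (1/2) *\<^sub>R ((\<i> * complex_of_real \<mu>) *\<^sub>C (J (t n) (\<xi> n) - \<xi> n)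
          + (\<i> * complex_of_real \<mu>) *\<^sub>C (J (- t n) (\<xi> n) - \<xi> n))"
        by (subst half[of "(\<i> * complex_of_real \<mu>) *\<^sub>C \<xi> n"])
          (simp add: r_def scaleC_scaleR scaleC_add_right scaleC_diff_right algebra_simps)
      have "X (Y (B n (\<xi> n)) + d (r n (\<xi> n))) - X (B n (Y (\<xi> n)))
        = X (Y (B n (\<xi> n)) + d (r n (\<xi> n)) - B n (Y (\<xi> n)))"
        by (simp add: linear_diff[OF lX])
      also have "Y (B n (\<xi> n)) + d (r n (\<xi> n)) - B n (Y (\<xi> n))
        = (1/2) *\<^sub>R ((d (J (t n) (\<xi> n)) - J (t n) (d (J (t n) (\<xi> n))))
          + (d (J (- t n) (\<xi> n)) - J (- t n) (d (J (- t n) (\<xi> n)))))"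
        unfolding YB by (simp add: r_def linear_add[OF ld] linear_cmul[OF ld] algebra_simps)
      finally have XX: "X (Y (B n (\<xi> n)) + d (r n (\<xi> n))) - X (B n (Y (\<xi> n)))
        = (1/2) *\<^sub>R (X (d (J (t n) (\<xi> n)) - J (t n) (d (J (t n) (\<xi> n))))
          + X (d (J (- t n) (\<xi> n)) - J (- t n) (d (J (- t n) (\<xi> n)))))"
        by (simp only: linear_add[OF lX] linear_cmul[OF lX])
      have "(\<i> * complex_of_real \<mu>) *\<^sub>C r n (\<xi> n) + X (Y (B n (\<xi> n)) + d (r n (\<xi> n))) - \<eta>
        = ((\<i> * complex_of_real \<mu>) *\<^sub>C r n (\<xi> n) - (\<i> * complex_of_real \<mu>) *\<^sub>C \<xi> n)
          + (X (Y (B n (\<xi> n)) + d (r n (\<xi> n))) - X (B n (Y (\<xi> n))))"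
        by (subst \<xi>[of n, symmetric]) (simp add: algebra_simps)
      also have "\<dots> = v n" unfolding rr XX v_def E_def by (simp add: scaleR_add_right)
      finally show ?thesis .
    qed
    let ?C = "closure ((\<lambda>w. w - \<eta>) ` ?N)"
    have "0 \<in> ?C"
    proof (rule banach_saks[of _ v "M * (K\<^sup>2 * norm \<eta> / \<bar>\<mu>\<bar>)"])
      show "convex ?C"
        using subspace_imp_convex[OF N_sub] convex_translation_subtract by (intro convex_closure) blast
      show "v n \<in> ?C" for n
        by (rule subsetD[OF closure_subset]) (use rB[of n "\<xi> n"] v_eq[of n] in \<open>blast intro: sym\<close>)
      have M0: "M \<ge> 0" using kX(1) kd(1) by (simp add: M_def)
      have Ebd: "norm (E s (\<xi> n)) \<le> M * (K\<^sup>2 * norm \<eta> / \<bar>\<mu>\<bar>)" if "s \<noteq> 0" for s n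
        using E_bd[OF that, of "\<xi> n"] mult_left_mono[OF \<xi>_bd[of n] M0] by linarith
      show "norm (v n) \<le> M * (K\<^sup>2 * norm \<eta> / \<bar>\<mu>\<bar>)" for n
      proof -
        have "norm (E (t n) (\<xi> n) + E (- t n) (\<xi> n))
            \<le> M * (K\<^sup>2 * norm \<eta> / \<bar>\<mu>\<bar>) + M * (K\<^sup>2 * norm \<eta> / \<bar>\<mu>\<bar>)"
          by (rule norm_triangle_mono[OF Ebd[OF t(1)] Ebd[OF t(2)]])
        then show ?thesis unfolding v_def norm_scaleR by linarith
      qed
      fix w
      have weak: "(\<lambda>n. ip (E (s n) (\<xi> n)) w) \<longlonglongrightarrow> 0"
        if s: "filterlim (\<lambda>n. \<bar>s n\<bar>) at_top sequentially" "\<And>n. s n \<noteq> 0" for s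
      proof (rule Lim_null_comparison)
        show "\<forall>\<^sub>F n in sequentially. norm (ip (E (s n) (\<xi> n)) w)
            \<le> (K * (K\<^sup>2 * norm \<eta> / \<bar>\<mu>\<bar>)) * norm (E' (s n) w)"
        proof (intro always_eventually allI)
          fix n
          have "norm (ip (\<xi> n) (E' (s n) w)) \<le> (K * norm (\<xi> n)) * norm (E' (s n) w)"
            using norm_form_le by (simp add: mult.assoc)
          also have "\<dots> \<le> (K * (K\<^sup>2 * norm \<eta> / \<bar>\<mu>\<bar>)) * norm (E' (s n) w)"
            using \<xi>_bd K_pos by (intro mult_right_mono mult_left_mono) auto
          finally show "norm (ip (E (s n) (\<xi> n)) w)
            \<le> (K * (K\<^sup>2 * norm \<eta> / \<bar>\<mu>\<bar>)) * norm (E' (s n) w)"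
            by (simp add: E_adj[OF s(2)])
        qed
        show "(\<lambda>n. (K * (K\<^sup>2 * norm \<eta> / \<bar>\<mu>\<bar>)) * norm (E' (s n) w)) \<longlonglongrightarrow> 0"
          by (intro tendsto_mult_right_zero tendsto_norm_zero E'_0 s)
      qed
      have "filterlim (\<lambda>n. \<bar>t n\<bar>) at_top sequentially"
        using filterlim_real_sequentially
        by (simp add: t_def filterlim_sequentially_Suc[of real] del: of_nat_Suc)
      then have "(\<lambda>n. ip (E (t n) (\<xi> n)) w) \<longlonglongrightarrow> 0" "(\<lambda>n. ip (E (- t n) (\<xi> n)) w) \<longlonglongrightarrow> 0"
        using weak[of t] weak[of "\<lambda>n. - t n"] t by simp_all
      from tendsto_scaleR[OF tendsto_const[of "1/2"] tendsto_add[OF this]]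
      show "(\<lambda>n. ip (v n) w) \<longlonglongrightarrow> 0"
        by (simp add: v_def form.scaleR_left form_add_left)
    qed simp
    then show ?thesis
      by (auto simp: closure_approachable dist_norm) 
  qed
  then show ?thesis by blast
qed

end

section \<open>Hilbert modules and the doubling of a regular operator\<close>

instantiation prod :: (complex_normed_vector, complex_normed_vector) complex_normed_vector
begin

definition scaleC_prod :: "complex \<Rightarrow> 'a \<times> 'b \<Rightarrow> 'a \<times> 'b" where
  "scaleC_prod z p = (z *\<^sub>C fst p, z *\<^sub>C snd p)"

instance
proof
  fix z w :: complex and r :: real and a b :: "'a \<times> 'b"
  show "z *\<^sub>C (a + b) = z *\<^sub>C a + z *\<^sub>C b" "(z + w) *\<^sub>C a = z *\<^sub>C a + w *\<^sub>C a"
    "z *\<^sub>C (w *\<^sub>C a) = (z * w) *\<^sub>C a" "r *\<^sub>R a = complex_of_real r *\<^sub>C a"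
    by (simp_all add: scaleC_prod_def scaleC_add_right scaleC_add_left scaleC_scaleC
        scaleR_prod_def scaleR_scaleC)
  have "sqrt ((cmod z)\<^sup>2 * ((norm (fst a))\<^sup>2 + (norm (snd a))\<^sup>2))
      = cmod z * sqrt ((norm (fst a))\<^sup>2 + (norm (snd a))\<^sup>2)"
    by (simp add: real_sqrt_mult)
  then show "norm (z *\<^sub>C a) = cmod z * norm a"
    by (simp add: scaleC_prod_def norm_prod_def norm_scaleC power_mult_distrib distrib_left)
qed

end

instance prod :: (complex_banach, complex_banach) complex_banach ..

lemma scaleC_Pair [simp]: "z *\<^sub>C (a, b) = (z *\<^sub>C a, z *\<^sub>C b)"
  by (simp add: scaleC_prod_def)

definition prod_form :: "('e \<Rightarrow> 'e \<Rightarrow> 'b::plus) \<Rightarrow> 'e \<times> 'e \<Rightarrow> 'e \<times> 'e \<Rightarrow> 'b" where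
  "prod_form f p q = f (fst p) (fst q) + f (snd p) (snd q)"

context hilbert_module
begin

lemma norm_ip_self: "norm (ip \<xi> \<xi>) = (norm \<xi>)\<^sup>2"
  by (simp add: norm_ip[of \<xi>])

text \<open>Polarization and the triangle inequality bound the inner product on pairs of unit vectors.\<close>

lemma norm_ip_le: "norm (ip \<xi> \<eta>) \<le> 4 * norm \<xi> * norm \<eta>"
proof -
  have add_left: "ip (\<xi> + \<eta>) \<zeta> = ip \<xi> \<zeta> + ip \<eta> \<zeta>" for \<xi> \<eta> \<zeta>
    by (metis ip_add_right star_add star_ip)
  have scale_left: "ip (z *\<^sub>C \<xi>) \<eta> = cnj z *\<^sub>C ip \<xi> \<eta>" for z \<xi> \<eta>
    by (metis ip_scaleC_right star_scaleC star_ip)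
  have neg: "ip \<xi> (- \<eta>) = - ip \<xi> \<eta>" "ip (- \<xi>) \<eta> = - ip \<xi> \<eta>" for \<xi> \<eta>
    using ip_scaleC_right[of \<xi> "-1" \<eta>] scale_left[of "-1" \<xi> \<eta>] by (simp_all add: scaleC_minus_left)
  have sym: "norm (ip \<xi> \<eta> + star (ip \<xi> \<eta>)) \<le> (norm \<xi> + norm \<eta>)\<^sup>2" for \<xi> \<eta>
  proof -
    have "ip (\<xi> + \<eta>) (\<xi> + \<eta>) - ip (\<xi> + - \<eta>) (\<xi> + - \<eta>) = 2 *\<^sub>R (ip \<xi> \<eta> + star (ip \<xi> \<eta>))"
      by (simp only: add_left ip_add_right neg star_ip) (simp add: scaleR_2)
    then have "2 * norm (ip \<xi> \<eta> + star (ip \<xi> \<eta>))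
        \<le> norm (ip (\<xi> + \<eta>) (\<xi> + \<eta>)) + norm (ip (\<xi> + - \<eta>) (\<xi> + - \<eta>))"
      by (metis norm_scaleR norm_triangle_ineq4 abs_numeral)
    also have "\<dots> = (norm (\<xi> + \<eta>))\<^sup>2 + (norm (\<xi> - \<eta>))\<^sup>2" by (simp add: norm_ip_self)
    also have "\<dots> \<le> (norm \<xi> + norm \<eta>)\<^sup>2 + (norm \<xi> + norm \<eta>)\<^sup>2"
      by (intro add_mono power_mono norm_triangle_ineq norm_triangle_ineq4 norm_ge_zero)
    finally show ?thesis by simp
  qed
  have P: "norm (ip \<xi> \<eta>) \<le> (norm \<xi> + norm \<eta>)\<^sup>2" for \<xi> \<eta>
  proof -
    have "norm (\<i> *\<^sub>C (ip \<xi> \<eta> - star (ip \<xi> \<eta>))) \<le> (norm \<xi> + norm \<eta>)\<^sup>2"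
      using sym[of \<xi> "\<i> *\<^sub>C \<eta>"]
      by (simp add: ip_scaleC_right star_scaleC norm_scaleC scaleC_diff_right scaleC_minus_left)
    then have "norm (ip \<xi> \<eta> - star (ip \<xi> \<eta>)) \<le> (norm \<xi> + norm \<eta>)\<^sup>2" by (simp add: norm_scaleC)
    moreover have "2 *\<^sub>R ip \<xi> \<eta> = (ip \<xi> \<eta> + star (ip \<xi> \<eta>)) + (ip \<xi> \<eta> - star (ip \<xi> \<eta>))"
      by (simp add: scaleR_2)
    ultimately have "norm (2 *\<^sub>R ip \<xi> \<eta>) \<le> (norm \<xi> + norm \<eta>)\<^sup>2 + (norm \<xi> + norm \<eta>)\<^sup>2"
      using sym[of \<xi> \<eta>] norm_triangle_mono by metis
    then show ?thesis by simp
  qed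
  show ?thesis
  proof (cases "\<xi> = 0 \<or> \<eta> = 0")
    case True
    then show ?thesis
      using ip_scaleC_right[of \<xi> 0 \<eta>] scale_left[of 0 \<xi> \<eta>] by auto
  next
    case False
    let ?r = "1 / norm \<xi>" and ?s = "1 / norm \<eta>"
    have "ip (?r *\<^sub>R \<xi>) (?s *\<^sub>R \<eta>) = (?r * ?s) *\<^sub>R ip \<xi> \<eta>"
      by (simp add: scaleR_scaleC ip_scaleC_right scale_left scaleC_scaleC mult.commute)
    then have "(?r * ?s) * norm (ip \<xi> \<eta>) \<le> (norm (?r *\<^sub>R \<xi>) + norm (?s *\<^sub>R \<eta>))\<^sup>2"
      using P[of "?r *\<^sub>R \<xi>" "?s *\<^sub>R \<eta>"] by simp
    also have "\<dots> = 4" using False by simp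
    finally show ?thesis using False by (simp add: field_simps)
  qed
qed

sublocale cstar_form ip 4
proof
  show "(norm \<xi>)\<^sup>2 \<le> 4 * norm (ip \<xi> \<xi>)" for \<xi> by (simp add: norm_ip_self)
qed (simp_all add: ip_add_right ip_scaleC_right star_ip norm_ip_le)

text \<open>The lower estimate says that \<open>\<parallel>a\<^sup>* a\<parallel> + \<parallel>b\<^sup>* b\<parallel>\<close> is controlled by \<open>\<parallel>a\<^sup>* a + b\<^sup>* b\<parallel>\<close>, which is where
  positivity in the C*-algebra is needed.\<close>

lemma cstar_form_prod: "cstar_form (prod_form ip) 8"
proof
  fix p q r :: "'e \<times> 'e" and z
  show "prod_form ip p (q + r) = prod_form ip p q + prod_form ip p r"
    "prod_form ip p (z *\<^sub>C q) = z *\<^sub>C prod_form ip p q"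
    "star (prod_form ip p q) = prod_form ip q p"
    by (simp_all add: prod_form_def ip_add_right scaleC_prod_def ip_scaleC_right scaleC_add_right
        star_add star_ip)
  have "norm (prod_form ip p q) \<le> 4 * norm (fst p) * norm (fst q) + 4 * norm (snd p) * norm (snd q)"
    unfolding prod_form_def by (intro norm_triangle_mono norm_ip_le)
  also have "\<dots> \<le> 4 * norm p * norm q + 4 * norm p * norm q"
    by (intro add_mono mult_mono) (auto simp: norm_prod_def)
  finally show "norm (prod_form ip p q) \<le> 8 * norm p * norm q" by simp
  obtain a b where ab: "ip (fst p) (fst p) = star a * a" "ip (snd p) (snd p) = star b * b"
    using ip_positive unfolding positive_def by metis
  have "(norm p)\<^sup>2 = norm (ip (fst p) (fst p)) + norm (ip (snd p) (snd p))"
    by (simp add: norm_prod_def norm_ip_self)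
  also have "\<dots> \<le> 8 * norm (prod_form ip p p)"
    using norm_star_mult_self_le_add[of a b] norm_ge_zero[of "star a * a + star b * b"]
      norm_star_mult_self_le_add[of b a, unfolded add.commute[of "star b * b"]]
    unfolding prod_form_def ab by linarith
  finally show "(norm p)\<^sup>2 \<le> 8 * norm (prod_form ip p p)" .
qed simp

lemma adjoint_onD: "(u, u') \<in> T \<Longrightarrow> (v, v') \<in> adjoint_on ip F T \<Longrightarrow> ip u' v = ip u v'"
  unfolding adjoint_on_def by blast

lemma subspace_adjoint: "subspace (adjoint_on ip UNIV T)"
  by (auto simp: subspace_def adjoint_on_def zero_prod_def form_add_right form.scaleR_right
      form.zero_right split: prod.splits)

lemma scaleC_adjoint: "(v, v') \<in> adjoint_on ip UNIV T \<Longrightarrow> (z *\<^sub>C v, z *\<^sub>C v') \<in> adjoint_on ip UNIV T"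
  by (auto simp: adjoint_on_def form_scaleC_right)

lemma closed_adjoint: "closed (adjoint_on ip UNIV T)"
proof -
  have "adjoint_on ip UNIV T = (\<Inter>(u, u')\<in>T. {p. ip u' (fst p) = ip u (snd p)})"
    by (auto simp: adjoint_on_def)
  moreover have "closed {p. ip u' (fst p) = ip u (snd p)}" for u u'
    by (intro closed_Collect_eq form.continuous_on continuous_intros)
  ultimately show ?thesis by (auto intro!: closed_INT)
qed

lemma orthogonal_dense_eq_0:
  assumes "closure S = UNIV" "\<And>u. u \<in> S \<Longrightarrow> ip w u = 0"
  shows "w = 0"
proof -
  have "closed {u. ip w u = 0}"
    by (intro closed_Collect_eq form.continuous_on continuous_intros)
  then have "closure S \<subseteq> {u. ip w u = 0}" using assms(2) by (intro closure_minimal) auto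
  then show ?thesis using assms(1) form_definite by auto
qed

end

text \<open>The doubled operator \<open>(a, b) \<mapsto> (D b, D' a)\<close>.\<close>

definition hat :: "('e \<times> 'e) set \<Rightarrow> ('e \<times> 'e) set \<Rightarrow> (('e \<times> 'e) \<times> ('e \<times> 'e)) set" where
  "hat D' D = {((a, b), (b', a')) |a a' b b'. (a, a') \<in> D' \<and> (b, b') \<in> D}"

lemma hat_iff: "((a, b), (b', a')) \<in> hat D' D \<longleftrightarrow> (a, a') \<in> D' \<and> (b, b') \<in> D"
  by (auto simp: hat_def)

text \<open>For \<open>\<sigma> = \<plusminus>1\<close> the range of \<open>i\<sigma> + hat D' D\<close> is closed. It contains \<open>(0, u + D\<^sup>* D u)\<close>, the image of
  \<open>(D u, - i\<sigma> u)\<close>, so regularity puts \<open>0 \<oplus> E\<close> into it; the images of \<open>(- i\<sigma> a, 0)\<close> with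
  \<open>a\<close> in \<open>Dom D\<^sup>*\<close> then supply \<open>E \<oplus> 0\<close>.\<close>

lemma (in hilbert_module) regular_symmetric_hat:
  assumes D: "subspace D" "\<And>u u' z. (u, u') \<in> D \<Longrightarrow> (z *\<^sub>C u, z *\<^sub>C u') \<in> D" "closed D"
    and sym: "symmetric_on ip UNIV D" and reg: "regular_on ip UNIV D"
  shows "regular_symmetric (prod_form ip) 8 (hat (adjoint_on ip UNIV D) D)"
proof -
  let ?D' = "adjoint_on ip UNIV D"
  let ?A = "hat ?D' D"
  interpret H: cstar_form "prod_form ip" 8 by (rule cstar_form_prod)
  have dense: "closure (Domain D) = UNIV" "closure (Domain ?D') = UNIV"
    "closure (Range (op_add id (D O ?D'))) = UNIV"
    using reg by (auto simp: regular_on_def densely_defined_on_def)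
  have sub: "subspace ?A"
    unfolding subspace_def
    by (auto simp: hat_def zero_prod_def subspace_0[OF D(1), unfolded zero_prod_def]
        subspace_0[OF subspace_adjoint, unfolded zero_prod_def]
        dest: subspace_add[OF D(1)] subspace_add[OF subspace_adjoint] subspace_scale[OF D(1)]
          subspace_scale[OF subspace_adjoint])
  have A_sym: "symmetric_on (prod_form ip) UNIV ?A"
  proof -
    have "ip b' c + ip a' e = ip a e' + ip b c'"
      if "(a, a') \<in> ?D'" "(b, b') \<in> D" "(c, c') \<in> ?D'" "(e, e') \<in> D" for a a' b b' c c' e e'
      using adjoint_onD[OF that(2,3)] arg_cong[OF adjoint_onD[OF that(4,1)], of star]
      by (simp add: star_ip add.commute)
    then show ?thesis unfolding H.symmetric_iff by (auto simp: hat_def prod_form_def)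
  qed
  have "closed ?A"
  proof -
    have "?A = (\<lambda>p. ((fst (fst p), snd (snd p)), (snd (fst p), fst (snd p)))) -` (?D' \<times> D)"
      by (auto simp: hat_def)
    then show ?thesis
      by (auto intro!: closed_vimage closed_Times closed_adjoint D(3) continuous_intros)
  qed
  have base: "Range (op_add (scaleC (\<i> * complex_of_real \<sigma>)) ?A) = UNIV"
    if \<sigma>: "\<sigma> = 1 \<or> \<sigma> = -1" for \<sigma>
  proof -
    let ?z = "\<i> * complex_of_real \<sigma>"
    let ?R = "Range (op_add (scaleC ?z) ?A)"
    have z2: "?z * ?z = - 1" "\<sigma> \<noteq> 0" "?z * (?z * w) = - w" for w
      using \<sigma> by (auto simp: algebra_simps)
    have clR: "closed ?R" by (rule H.symmetric_range_closed[OF A_sym sub \<open>closed ?A\<close> z2(2)])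
    have subR: "subspace ?R"
    proof -
      have "linear (snd :: ('e \<times> 'e) \<times> ('e \<times> 'e) \<Rightarrow> _)" by unfold_locales auto
      from linear_subspace_image[OF this subspace_op_add[OF sub, of "scaleC ?z"]]
      show ?thesis by (simp add: Range_snd bounded_linear.linear[OF bounded_linear_scaleC])
    qed
    have mem: "?z *\<^sub>C (a, b) + (b', a') \<in> ?R" if "(a, a') \<in> ?D'" "(b, b') \<in> D" for a a' b b'
    proof -
      have "((a, b), (b', a')) \<in> ?A" using that by (simp add: hat_iff)
      then show ?thesis by (rule op_add_RangeI)
    qed
    have z_scale: "?z *\<^sub>C ((- ?z) *\<^sub>C u) = u" for u :: 'e
      by (simp add: scaleC_scaleC z2 del: scaleC_minus_left)
    have 1: "(0, \<eta>) \<in> ?R" for \<eta>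
    proof -
      have "(0, \<eta>) \<in> ?R" if \<eta>: "\<eta> \<in> Range (op_add id (D O ?D'))" for \<eta>
      proof -
        obtain u u' u'' where u: "(u, u') \<in> D" "(u', u'') \<in> ?D'" "\<eta> = u + u''"
          using \<eta> by (auto simp: op_add_def)
        have "?z *\<^sub>C (u', (- ?z) *\<^sub>C u) + ((- ?z) *\<^sub>C u', u'') \<in> ?R" using mem[OF u(2) D(2)[OF u(1)]] .
        moreover have "?z *\<^sub>C (u', (- ?z) *\<^sub>C u) + ((- ?z) *\<^sub>C u', u'') = (0, \<eta>)"
          by (simp only: scaleC_Pair z_scale) (simp add: scaleC_minus_left u(3))
        ultimately show ?thesis by simp
      qed
      then have "Range (op_add id (D O ?D')) \<subseteq> (\<lambda>\<eta>. (0, \<eta>)) -` ?R" by (meson subsetI vimageI2)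
      moreover have "closed ((\<lambda>\<eta>. (0, \<eta>)) -` ?R)"
        by (intro closed_vimage clR continuous_intros)
      ultimately have "closure (Range (op_add id (D O ?D'))) \<subseteq> (\<lambda>\<eta>. (0, \<eta>)) -` ?R"
        by (rule closure_minimal)
      then show ?thesis using dense(3) by auto
    qed
    have 2: "(\<eta>, 0) \<in> ?R" for \<eta>
    proof -
      have "(\<eta>, 0) \<in> ?R" if "\<eta> \<in> Domain ?D'" for \<eta>
      proof -
        obtain \<eta>' where "(\<eta>, \<eta>') \<in> ?D'" using \<open>\<eta> \<in> Domain ?D'\<close> by blast
        then have "((- ?z) *\<^sub>C \<eta>, (- ?z) *\<^sub>C \<eta>') \<in> ?D'" by (rule scaleC_adjoint)
        moreover have "(0, 0) \<in> D" using subspace_0[OF D(1)] by (simp add: zero_prod_def)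
        ultimately have "?z *\<^sub>C ((- ?z) *\<^sub>C \<eta>, 0) + (0, (- ?z) *\<^sub>C \<eta>') \<in> ?R" by (rule mem)
        then have "(\<eta>, (- ?z) *\<^sub>C \<eta>') \<in> ?R"
          by (simp only: scaleC_Pair z_scale) simp
        from subspace_diff[OF subR this 1[of "(- ?z) *\<^sub>C \<eta>'"]] show ?thesis by simp
      qed
      then have "Domain ?D' \<subseteq> (\<lambda>\<eta>. (\<eta>, 0)) -` ?R" by (meson subsetI vimageI2)
      moreover have "closed ((\<lambda>\<eta>. (\<eta>, 0)) -` ?R)"
        by (intro closed_vimage clR continuous_intros)
      ultimately have "closure (Domain ?D') \<subseteq> (\<lambda>\<eta>. (\<eta>, 0)) -` ?R" by (rule closure_minimal)
      then show ?thesis using dense(2) by auto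
    qed
    have "(a, b) \<in> ?R" for a b using subspace_add[OF subR 2[of a] 1[of b]] by simp
    then show ?thesis by auto
  qed
  show ?thesis
  proof
    show "subspace ?A" by (rule sub)
    show "symmetric_on (prod_form ip) UNIV ?A" by (rule A_sym)
    show "(z *\<^sub>C u, z *\<^sub>C u') \<in> ?A" if "(u, u') \<in> ?A" for u u' z
      using that D(2) scaleC_adjoint by (auto simp: hat_def scaleC_prod_def)
    show "closure (Domain ?A) = UNIV"
    proof -
      have "Domain ?A = Domain ?D' \<times> Domain D"
        unfolding set_eq_iff Domain_iff split_paired_all mem_Times_iff
        by (simp add: Domain_iff split_paired_Ex hat_iff)
      then show ?thesis by (simp add: closure_Times dense)
    qed
    show "Range (op_add (scaleC (\<i> * complex_of_real \<mu>)) ?A) = UNIV" if \<mu>: "\<mu> \<noteq> 0" for \<mu>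
    proof -
      have "UNIV \<subseteq> Range (op_add (scaleC (\<i> * complex_of_real \<mu>)) ?A)"
        by (rule H.symmetric_range_all[OF A_sym sub, of UNIV "sgn \<mu>"])
          (use \<mu> base[of "sgn \<mu>"] in \<open>auto simp: sgn_if zero_less_mult_iff\<close>)
      then show ?thesis by blast
    qed
  qed
qed

section \<open>Single-valued operators and bounded adjoints\<close>

lemma app_eqI: "single_valued T \<Longrightarrow> (u, v) \<in> T \<Longrightarrow> app T u = v"
  unfolding app_def by (rule the_equality) (auto dest: single_valuedD)

lemma closure_invariant:
  assumes "continuous_on UNIV f" "f ` S \<subseteq> S" "p \<in> closure S"
  shows "f p \<in> closure S"
proof -
  have "f ` closure S \<subseteq> closure S"
    using assms(2) closure_subset
    by (intro image_closure_subset continuous_on_subset[OF assms(1)]) auto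
  then show ?thesis using assms(3) by blast
qed

lemma single_valued_op_add: "single_valued T \<Longrightarrow> single_valued (op_add f T)"
  by (auto simp: single_valued_def op_add_def)

context hilbert_module
begin

lemma symmetric_single_valued:
  assumes G: "symmetric_on ip UNIV G" "subspace G" "closure (Domain G) = UNIV"
  shows "single_valued G"
proof (rule single_valuedI)
  fix u v w assume "(u, v) \<in> G" "(u, w) \<in> G"
  then have "(0, v - w) \<in> G" using subspace_diff[OF G(2)] by fastforce
  then have "ip (v - w) s = 0" if "s \<in> Domain G" for s
    using that symmetricD[OF G(1)] form.zero_left by fastforce
  from orthogonal_dense_eq_0[OF G(3) this] show "v = w" by simp
qed

lemma symmetric_single_valued_inverse:
  assumes "symmetric_on ip UNIV G" "subspace G" "\<mu> \<noteq> 0"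
  shows "single_valued ((op_add (scaleC (\<i> * complex_of_real \<mu>)) G)\<inverse>)"
  unfolding single_valued_def converse_iff op_add_iff using symmetric_inj(1)[OF assms] by metis

lemma ip_act_left: "ip (act \<xi> b) \<eta> = star b * ip \<xi> \<eta>"
  by (metis ip_act_right star_ip star_mult)

lemma bounded_linear_act: "bounded_linear (\<lambda>\<xi>. act \<xi> b)"
proof (rule bounded_linear_intro)
  show "act (\<xi> + \<eta>) b = act \<xi> b + act \<eta> b" "act (r *\<^sub>R \<xi>) b = r *\<^sub>R act \<xi> b" for \<xi> \<eta> r
    by (simp_all add: act_add_left scaleR_scaleC act_scaleC_left)
  show "norm (act \<xi> b) \<le> norm \<xi> * norm b" for \<xi>
  proof -
    have "(norm (act \<xi> b))\<^sup>2 = norm (star b * (ip \<xi> \<xi> * b))"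
      by (simp add: ip_act_left ip_act_right mult.assoc flip: norm_ip_self)
    also have "\<dots> \<le> norm b * ((norm \<xi>)\<^sup>2 * norm b)"
      using norm_mult_ineq[of "star b" "ip \<xi> \<xi> * b"]
        mult_left_mono[OF norm_mult_ineq[of "ip \<xi> \<xi>" b] norm_ge_zero[of b]]
      by (simp add: norm_star norm_ip_self)
    finally have "(norm (act \<xi> b))\<^sup>2 \<le> (norm \<xi> * norm b)\<^sup>2"
      by (simp add: power2_eq_square mult_ac)
    then show ?thesis by (simp add: abs_le_square_iff[symmetric] power2_le_iff_abs_le)
  qed
qed

lemma ip_eqI:
  assumes "\<And>\<xi>. ip \<xi> \<eta> = ip \<xi> \<zeta>"
  shows "\<eta> = \<zeta>"
  using form_definite[of "\<eta> - \<zeta>"] assms by (simp add: form.diff_right)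

lemma ip_adj:
  assumes "adjointable ip f"
  shows "ip (f \<xi>) \<eta> = ip \<xi> (adj ip f \<eta>)"
proof -
  obtain g where g: "\<forall>\<xi> \<eta>. ip (f \<xi>) \<eta> = ip \<xi> (g \<eta>)" using assms by (auto simp: adjointable_def)
  have "\<forall>\<xi> \<eta>. ip (f \<xi>) \<eta> = ip \<xi> (adj ip f \<eta>)"
    unfolding adj_def by (rule theI[of _ g]) (use g ip_eqI in \<open>auto intro!: ext\<close>)
  then show ?thesis by blast
qed

lemma bounded_operator_adj:
  assumes f: "bounded_operator act f" "adjointable ip f"
  shows "bounded_operator act (adj ip f)"
proof -
  let ?g = "adj ip f"
  note adj = ip_adj[OF f(2), symmetric]
  have scale: "?g (z *\<^sub>C \<eta>) = z *\<^sub>C ?g \<eta>" for z \<eta>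
    by (rule ip_eqI) (simp add: adj form_scaleC_right)
  have "?g (act \<eta> b) = act (?g \<eta>) b" for \<eta> b
    by (rule ip_eqI) (simp add: adj ip_act_right)
  moreover have "bounded_linear ?g"
  proof -
    obtain k where k: "k > 0" "\<And>\<xi>. norm (f \<xi>) \<le> norm \<xi> * k"
      using bounded_linear.pos_bounded f(1) unfolding bounded_operator_def by blast
    show ?thesis
    proof (rule bounded_linear_intro)
      show "?g (\<xi> + \<eta>) = ?g \<xi> + ?g \<eta>" for \<xi> \<eta>
        by (rule ip_eqI) (simp add: adj form_add_right)
      show "?g (r *\<^sub>R \<xi>) = r *\<^sub>R ?g \<xi>" for r \<xi> by (simp add: scaleR_scaleC scale)
      show "norm (?g \<xi>) \<le> norm \<xi> * (4 * k)" for \<xi>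
      proof (cases "?g \<xi> = 0")
        case True
        then show ?thesis using k(1) by simp
      next
        case False
        have "(norm (?g \<xi>))\<^sup>2 = norm (ip (f (?g \<xi>)) \<xi>)" by (simp add: ip_adj[OF f(2)] norm_ip_self)
        also have "\<dots> \<le> 4 * norm (f (?g \<xi>)) * norm \<xi>" by (rule norm_ip_le)
        also have "\<dots> \<le> 4 * (norm (?g \<xi>) * k) * norm \<xi>"
          using k(2) by (intro mult_right_mono mult_left_mono) auto
        finally have "norm (?g \<xi>) * norm (?g \<xi>) \<le> norm (?g \<xi>) * (norm \<xi> * (4 * k))"
          by (simp add: power2_eq_square mult_ac)
        then show ?thesis using False by simp
      qed
    qed
  qed
  ultimately show ?thesis using scale by (simp add: bounded_operator_def)
qed

end

lemma Range_op_add_mono: "A \<subseteq> B \<Longrightarrow> Range (op_add f A) \<subseteq> Range (op_add f B)"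
  by (auto simp: op_add_def)


section \<open>Selfadjointness and regularity from surjectivity\<close>

context hilbert_module
begin

text \<open>If \<open>(\<eta>, \<zeta>)\<close> lies in the adjoint, subtract the element of \<open>G\<close> with the same value of \<open>i + G\<close>. The
  difference \<open>w\<close> satisfies \<open>G\<^sup>* w = - i w\<close>, so that it is orthogonal to the range of \<open>- i + G\<close>, which
  contains \<open>w\<close>.\<close>

lemma selfadjoint_of_surj:
  assumes G: "symmetric_on ip UNIV G" "G \<subseteq> F \<times> F" and F: "subspace F" "\<And>u z. u \<in> F \<Longrightarrow> z *\<^sub>C u \<in> F"
    and surj: "\<And>\<mu>. \<mu> \<noteq> 0 \<Longrightarrow> F \<subseteq> Range (op_add (scaleC (\<i> * complex_of_real \<mu>)) G)"
  shows "selfadjoint_on ip F G"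
  unfolding selfadjoint_on_def
proof
  show "G \<subseteq> adjoint_on ip F G" using G unfolding symmetric_iff adjoint_on_def by blast
  show "adjoint_on ip F G \<subseteq> G"
  proof clarify
    fix \<eta> \<zeta> assume mem: "(\<eta>, \<zeta>) \<in> adjoint_on ip F G"
    then have \<eta>\<zeta>: "\<eta> \<in> F" "\<zeta> \<in> F" by (auto simp: adjoint_on_def)
    let ?z = "\<i> * complex_of_real 1"
    have "?z *\<^sub>C \<eta> + \<zeta> \<in> F" using \<eta>\<zeta> F by (simp add: subspace_add)
    then obtain u u' where u: "(u, u') \<in> G" "?z *\<^sub>C \<eta> + \<zeta> = ?z *\<^sub>C u + u'"
      using surj[of 1] unfolding subset_iff Range_iff op_add_iff by (metis one_neq_zero)
    define w where "w = \<eta> - u"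
    have w: "w \<in> F" "\<zeta> - u' = - (\<i> *\<^sub>C w)"
      using \<eta>\<zeta>(1) u G(2) F(1) by (auto simp: w_def scaleC_diff_right subspace_diff algebra_simps)
    have *: "ip v' w = ip v (- (\<i> *\<^sub>C w))" if "(v, v') \<in> G" for v v'
      using adjoint_onD[OF that mem] symmetricD[OF G(1) that u(1)]
      by (simp add: w_def form.diff_right flip: w(2)[unfolded w_def])
    obtain v v' where v: "(v, v') \<in> G" "w = (\<i> * complex_of_real (-1)) *\<^sub>C v + v'"
      using surj[of "-1"] w(1) unfolding subset_iff Range_iff op_add_iff by (metis neg_equal_0_iff_equal one_neq_zero)
    have "ip w w = \<i> *\<^sub>C ip v w + ip v' w"
      by (subst (1) v(2)) (simp add: form_add_left form_scaleC_left)
    then have "ip w w = 0"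
      by (simp add: *[OF v(1)] form.minus_right form_scaleC_right)
    then have "w = 0" by (rule form_definite)
    then show "(\<eta>, \<zeta>) \<in> G" using u(1) w(2) by (simp add: w_def)
  qed
qed

lemma regular_of_surj:
  assumes sa: "selfadjoint_on ip F G" and G: "closed G" "G \<subseteq> F \<times> F" "densely_defined_on F G"
      "subspace G" "\<And>u u' z. (u, u') \<in> G \<Longrightarrow> (z *\<^sub>C u, z *\<^sub>C u') \<in> G"
    and F: "closed F" "subspace F"
    and surj: "\<And>\<mu>. \<mu> \<noteq> 0 \<Longrightarrow> F \<subseteq> Range (op_add (scaleC (\<i> * complex_of_real \<mu>)) G)"
  shows "regular_on ip F G"
proof -
  have adj: "adjoint_on ip F G = G" using sa by (simp add: selfadjoint_on_def)
  have "Range (op_add id (G O G)) = F"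
  proof
    show "Range (op_add id (G O G)) \<subseteq> F"
      using G(2) subspace_add[OF F(2)] by (auto simp: op_add_def)
    show "F \<subseteq> Range (op_add id (G O G))"
    proof
      fix \<eta> assume "\<eta> \<in> F"
      \<comment> \<open>Factor \<open>1 + G\<^sup>2\<close> as \<open>(G + i) (G - i)\<close>.\<close>
      then obtain v v' where v: "(v, v') \<in> G" "\<eta> = (\<i> * complex_of_real 1) *\<^sub>C v + v'"
        using surj[of 1] unfolding subset_iff Range_iff op_add_iff by (metis one_neq_zero)
      have "v \<in> F" using v(1) G(2) by blast
      then obtain u u' where u: "(u, u') \<in> G" "v = (\<i> * complex_of_real (-1)) *\<^sub>C u + u'"
        using surj[of "-1"] unfolding subset_iff Range_iff op_add_iff
        by (metis neg_equal_0_iff_equal one_neq_zero)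
      have "(\<i> *\<^sub>C u + v, \<i> *\<^sub>C u' + v') \<in> G"
        using subspace_add[OF G(4) G(5)[OF u(1)] v(1)] by simp
      moreover have "\<i> *\<^sub>C u + v = u'" using u(2) by (simp add: scaleC_minus_left)
      moreover have "\<i> *\<^sub>C u' + v' = \<eta> - u"
        using u(2) v(2) by (simp add: scaleC_diff_right scaleC_minus_left scaleC_scaleC
            scaleC_add_right scaleC_minus_right)
      ultimately have "(u, \<eta> - u) \<in> G O G" using u(1) by auto
      from op_add_RangeI[OF this, of id] show "\<eta> \<in> Range (op_add id (G O G))" by simp
    qed
  qed
  then show ?thesis using G F by (simp add: regular_on_def adj)
qed

end


section \<open>Compressions of a symmetric regular operator\<close>

text \<open>The data of the theorem, symmetric under the exchange of \<open>x\<close> with its adjoint \<open>y\<close>. The derivations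
  \<open>dx\<close> and \<open>dy\<close> are recorded by what they do to the graph of \<open>D\<close>.\<close>

locale localization_data = hilbert_module act ip
  for act :: "'e::complex_banach \<Rightarrow> 'b::cstar_algebra \<Rightarrow> 'e" and ip :: "'e \<Rightarrow> 'e \<Rightarrow> 'b" +
  fixes D :: "('e \<times> 'e) set" and x y dx dy :: "'e \<Rightarrow> 'e"
  assumes D_subspace: "subspace D"
    and D_scaleC: "(u, u') \<in> D \<Longrightarrow> (z *\<^sub>C u, z *\<^sub>C u') \<in> D"
    and D_closed: "closed D"
    and D_symmetric: "symmetric_on ip UNIV D"
    and D_regular: "regular_on ip UNIV D"
    and x_bl: "bounded_linear x" and y_bl: "bounded_linear y"
    and x_scaleC: "x (z *\<^sub>C \<xi>) = z *\<^sub>C x \<xi>" and y_scaleC: "y (z *\<^sub>C \<xi>) = z *\<^sub>C y \<xi>"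
    and dx_bl: "bounded_linear dx" and dy_bl: "bounded_linear dy"
    and xy_adjoint: "ip (x \<xi>) \<eta> = ip \<xi> (y \<eta>)"
    and x_Domain: "u \<in> Domain (adjoint_on ip UNIV D) \<Longrightarrow> x u \<in> Domain D"
    and y_Domain: "u \<in> Domain (adjoint_on ip UNIV D) \<Longrightarrow> y u \<in> Domain D"
    and x_comm: "(u, u') \<in> D \<Longrightarrow> (x u, x u' + dx u) \<in> D"
    and y_comm: "(u, u') \<in> D \<Longrightarrow> (y u, y u' + dy u) \<in> D"
begin

abbreviation D' :: "('e \<times> 'e) set" where
  "D' \<equiv> adjoint_on ip UNIV D"

lemmas x_lin = linear_add[OF bounded_linear.linear[OF x_bl]] linear_diff[OF bounded_linear.linear[OF x_bl]]
  linear_cmul[OF bounded_linear.linear[OF x_bl]]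
lemmas y_lin = linear_add[OF bounded_linear.linear[OF y_bl]] linear_diff[OF bounded_linear.linear[OF y_bl]]
  linear_cmul[OF bounded_linear.linear[OF y_bl]]

lemma yx_adjoint: "ip (y \<xi>) \<eta> = ip \<xi> (x \<eta>)"
  by (metis xy_adjoint star_ip)

lemma swap: "localization_data act ip D y x dy dx"
  by (rule localization_data.intro[OF hilbert_module_axioms localization_data_axioms.intro[OF
          D_subspace D_scaleC D_closed D_symmetric D_regular y_bl x_bl y_scaleC x_scaleC dy_bl dx_bl
          yx_adjoint y_Domain x_Domain y_comm x_comm]])

lemma D_subset: "D \<subseteq> D'"
  using D_symmetric by (simp add: symmetric_on_def)

lemma Domain_dense: "closure (Domain D) = UNIV"
  using D_regular by (simp add: regular_on_def densely_defined_on_def)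

lemma dy_adjoint: "ip (dy \<xi>) \<eta> = - ip \<xi> (dx \<eta>)"
proof -
  have on_D: "ip (dy u) v + ip u (dx v) = 0" if "u \<in> Domain D" "v \<in> Domain D" for u v
  proof -
    obtain u' v' where u: "(u, u') \<in> D" and v: "(v, v') \<in> D" using \<open>u \<in> Domain D\<close> \<open>v \<in> Domain D\<close> by blast
    have "ip (y u' + dy u) v = ip (y u) v'" by (rule symmetricD[OF D_symmetric y_comm[OF u] v])
    moreover have "ip u' (x v) = ip u (x v' + dx v)"
      by (rule symmetricD[OF D_symmetric u x_comm[OF v]])
    ultimately show ?thesis by (simp add: form_add_left form_add_right yx_adjoint algebra_simps)
  qed
  have "closed {p. ip (dy (fst p)) (snd p) + ip (fst p) (dx (snd p)) = 0}"
    by (intro closed_Collect_eq form.continuous_on continuous_intros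
        bounded_linear.continuous_on[OF dx_bl] bounded_linear.continuous_on[OF dy_bl])
  then have "closure (Domain D \<times> Domain D) \<subseteq> {p. ip (dy (fst p)) (snd p) + ip (fst p) (dx (snd p)) = 0}"
    using on_D by (intro closure_minimal subsetI CollectI) (simp_all add: mem_Times_iff)
  from subsetD[OF this, of "(\<xi>, \<eta>)"] have "ip (dy \<xi>) \<eta> + ip \<xi> (dx \<eta>) = 0"
    by (simp add: closure_Times Domain_dense)
  then show ?thesis by (simp add: eq_neg_iff_add_eq_0)
qed

lemma dx_adjoint: "ip (dx \<xi>) \<eta> = - ip \<xi> (dy \<eta>)"
  by (metis dy_adjoint minus_minus star_ip star_minus)

text \<open>The commutator relation extends from \<open>D\<close> to \<open>D\<^sup>*\<close> with the same bounded operator: test \<open>D (y a)\<close>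
  against \<open>Dom D\<close> and move \<open>x\<close> through \<open>D\<close>.\<close>

lemma y_comm_adjoint: "(y a, y a' + dy a) \<in> D" if a: "(a, a') \<in> D'"
proof -
  obtain v where v: "(y a, v) \<in> D" using y_Domain a by blast
  have "ip (v - (y a' + dy a)) u = 0" if u: "u \<in> Domain D" for u
  proof -
    obtain u' where u': "(u, u') \<in> D" using u by blast
    have "ip u' (y a) = ip u v" by (rule symmetricD[OF D_symmetric u' v])
    moreover have "ip (x u' + dx u) a = ip (x u) a'" by (rule adjoint_onD[OF x_comm[OF u'] a])
    ultimately have "ip u v = ip u (y a' + dy a)"
      by (simp add: form_add_left form_add_right xy_adjoint dx_adjoint algebra_simps)
    then have "ip u (v - (y a' + dy a)) = 0" by (simp add: form.diff_right)
    then show ?thesis by (metis star_ip star_zero)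
  qed
  from orthogonal_dense_eq_0[OF Domain_dense this] have "v = y a' + dy a" by simp
  then show ?thesis using v by simp
qed

text \<open>The operator \<open>x G x\<^sup>*\<close>, with \<open>G x\<^sup>*\<close> expanded by the commutator, so that its domain is
  that of \<open>G\<close>.\<close>

definition compress :: "('e \<times> 'e) set \<Rightarrow> ('e \<times> 'e) set" where
  "compress G = {(u, x (y u' + dy u)) |u u'. (u, u') \<in> G}"

lemma compressI: "(u, u') \<in> G \<Longrightarrow> (u, x (y u' + dy u)) \<in> compress G"
  by (auto simp: compress_def)

lemma compress_mono: "G \<subseteq> H \<Longrightarrow> compress G \<subseteq> compress H"
  by (auto simp: compress_def)

lemma compress_linear: "linear (\<lambda>(u, u'). (u, x (y u' + dy u)))"
  by unfold_locales
    (auto simp: x_lin y_lin linear_add[OF bounded_linear.linear[OF dy_bl]]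
      linear_cmul[OF bounded_linear.linear[OF dy_bl]] algebra_simps)

lemma subspace_compress: "subspace G \<Longrightarrow> subspace (compress G)"
proof -
  assume "subspace G"
  moreover have "compress G = (\<lambda>(u, u'). (u, x (y u' + dy u))) ` G"
    by (auto simp: compress_def image_iff)
  ultimately show ?thesis using linear_subspace_image[OF compress_linear] by simp
qed

lemma compress_symmetric: "symmetric_on ip UNIV (compress D')"
proof -
  have "ip (x (y a' + dy a)) c = ip a (x (y c' + dy c))" if "(a, a') \<in> D'" "(c, c') \<in> D'" for a a' c c'
    using symmetricD[OF D_symmetric y_comm_adjoint[OF that(1)] y_comm_adjoint[OF that(2)]]
    by (simp add: xy_adjoint flip: yx_adjoint)
  then show ?thesis unfolding symmetric_iff by (auto simp: compress_def)
qed

text \<open>Density of the range of the doubled compression, written in components.\<close>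

lemma approximate_pair:
  assumes "\<mu> \<noteq> 0" "e > 0"
  obtains a a' b b' where "(a, a') \<in> compress D'" "(b, b') \<in> compress D"
    "norm ((\<i> * complex_of_real \<mu>) *\<^sub>C a + b' - \<eta>) < e"
    "norm ((\<i> * complex_of_real \<mu>) *\<^sub>C b + a' - \<zeta>) < e"
proof -
  interpret H: regular_symmetric "prod_form ip" 8 "hat D' D"
    by (rule regular_symmetric_hat[OF D_subspace D_scaleC D_closed D_symmetric D_regular])
  let ?X = "\<lambda>p. (x (fst p), x (snd p))" and ?Y = "\<lambda>p. (y (fst p), y (snd p))"
  let ?d = "\<lambda>p. (dy (snd p), dy (fst p))" and ?d' = "\<lambda>p. (- dx (snd p), - dx (fst p))"
  let ?z = "\<i> * complex_of_real \<mu>"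
  have bl: "bounded_linear (\<lambda>p. (f (fst p), f (snd p)))" "bounded_linear (\<lambda>p. (f (snd p), f (fst p)))"
    if "bounded_linear f" for f :: "'e \<Rightarrow> 'e"
    by (intro bounded_linear_Pair bounded_linear_compose[OF that] bounded_linear_fst bounded_linear_snd)+
  have "closure {?z *\<^sub>C u + ?X (?Y u' + ?d u) |u u'. (u, u') \<in> hat D' D} = UNIV"
  proof (rule H.compression_dense_range)
    show "bounded_linear ?X" "bounded_linear ?Y" "bounded_linear ?d" "bounded_linear ?d'"
      using bl x_bl y_bl dy_bl bounded_linear_minus[OF dx_bl] by blast+
    show "prod_form ip (?X p) q = prod_form ip p (?Y q)" for p q
      by (simp add: prod_form_def xy_adjoint)
    show "prod_form ip (?d p) q = prod_form ip p (?d' q)" for p q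
      by (simp add: prod_form_def dy_adjoint form.minus_right)
    show "?Y (z *\<^sub>C p) = z *\<^sub>C ?Y p" for z p by (simp add: scaleC_prod_def y_scaleC)
    show "(?Y u, ?Y u' + ?d u) \<in> hat D' D" if "(u, u') \<in> hat D' D" for u u'
      using that y_comm_adjoint y_comm D_subset by (auto simp: hat_def)
  qed (use assms in auto)
  then have "(\<eta>, \<zeta>) \<in> closure {?z *\<^sub>C u + ?X (?Y u' + ?d u) |u u'. (u, u') \<in> hat D' D}" by simp
  then obtain p where p: "p \<in> {?z *\<^sub>C u + ?X (?Y u' + ?d u) |u u'. (u, u') \<in> hat D' D}" "dist p (\<eta>, \<zeta>) < e"
    using assms(2) unfolding closure_approachable by blast
  then obtain a a' b b' where ab: "(a, a') \<in> D'" "(b, b') \<in> D"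
    "p = (?z *\<^sub>C a + x (y b' + dy b), ?z *\<^sub>C b + x (y a' + dy a))"
    by (auto simp: hat_def)
  have "norm (fst p - \<eta>) < e" "norm (snd p - \<zeta>) < e"
    using p(2) dist_fst_le[of p "(\<eta>, \<zeta>)"] dist_snd_le[of p "(\<eta>, \<zeta>)"] by (simp_all add: dist_norm)
  then show thesis using that compressI[OF ab(1)] compressI[OF ab(2)] ab(3) by simp
qed

text \<open>For a target \<open>(\<eta>/2, \<eta>/2)\<close> of the doubled operator, the two equations add up to one for \<open>a + b\<close>.\<close>

lemma compress_range_dense:
  assumes "\<mu> \<noteq> 0"
  shows "closure (Range (op_add (scaleC (\<i> * complex_of_real \<mu>)) (compress D'))) = UNIV"
proof -
  let ?z = "\<i> * complex_of_real \<mu>"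
  have "\<eta> \<in> closure (Range (op_add (scaleC ?z) (compress D')))" for \<eta>
    unfolding closure_approachable
  proof (intro allI impI)
    fix e :: real assume "e > 0"
    then have "e / 2 > 0" by simp
    from approximate_pair[OF assms this, of "(1/2) *\<^sub>R \<eta>" "(1/2) *\<^sub>R \<eta>"]
    obtain a a' b b' where ab: "(a, a') \<in> compress D'" "(b, b') \<in> compress D"
      "norm (?z *\<^sub>C a + b' - (1/2) *\<^sub>R \<eta>) < e / 2" "norm (?z *\<^sub>C b + a' - (1/2) *\<^sub>R \<eta>) < e / 2" by blast
    have "(b, b') \<in> compress D'" using ab(2) compress_mono[OF D_subset] by blast
    with ab(1) have "(a + b, a' + b') \<in> compress D'"
      using subspace_add[OF subspace_compress[OF subspace_adjoint]] by fastforce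
    then have "?z *\<^sub>C (a + b) + (a' + b') \<in> Range (op_add (scaleC ?z) (compress D'))"
      by (rule op_add_RangeI)
    moreover have "dist (?z *\<^sub>C (a + b) + (a' + b')) \<eta> < e"
    proof -
      have eq: "?z *\<^sub>C (a + b) + (a' + b') - \<eta>
        = (?z *\<^sub>C a + b' - (1/2) *\<^sub>R \<eta>) + (?z *\<^sub>C b + a' - (1/2) *\<^sub>R \<eta>)"
        by (simp add: scaleC_add_right algebra_simps flip: scaleR_left_distrib)
      then show ?thesis
        using ab(3,4) norm_triangle_ineq[of "?z *\<^sub>C a + b' - (1/2) *\<^sub>R \<eta>" "?z *\<^sub>C b + a' - (1/2) *\<^sub>R \<eta>"]
        unfolding dist_norm eq by linarith
    qed
    ultimately show "\<exists>w\<in>Range (op_add (scaleC ?z) (compress D')). dist w \<eta> < e" by blast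
  qed
  then show ?thesis by blast
qed

text \<open>Solve the doubled equation approximately for the value that it takes at \<open>(0, u)\<close>. The
  difference \<open>(a, b - u)\<close> then nearly solves the homogeneous equation, so its sum \<open>a + w\<close> and its
  difference \<open>a - w\<close> nearly solve the ones for \<open>i\<close> and \<open>- i\<close>, which have a lower bound. The
  component \<open>b\<close> lies in \<open>Dom D\<close>.\<close>

lemma compress_adjoint_subset_closure: "compress D' \<subseteq> closure (compress D)"
proof clarify
  fix u u' assume u: "(u, u') \<in> compress D'"
  note sub = subspace_compress[OF subspace_adjoint[of D]]
  show "(u, u') \<in> closure (compress D)"
    unfolding closure_approachable
  proof (intro allI impI)
    fix e :: real assume "e > 0"
    \<comment> \<open>The estimates below add up to \<open>65 \<delta>\<close>.\<close>
    define \<delta> where "\<delta> = e / 66"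
    have "\<delta> > 0" using \<open>e > 0\<close> by (simp add: \<delta>_def)
    obtain a a' b b' where ab: "(a, a') \<in> compress D'" "(b, b') \<in> compress D"
      "norm ((\<i> * complex_of_real 1) *\<^sub>C a + b' - u') < \<delta>"
      "norm ((\<i> * complex_of_real 1) *\<^sub>C b + a' - \<i> *\<^sub>C u) < \<delta>"
      using approximate_pair[OF one_neq_zero \<open>\<delta> > 0\<close>, of u' "\<i> *\<^sub>C u"] by blast
    define w w' where "w = b - u" and "w' = b' - u'"
    have b': "(b, b') \<in> compress D'" using ab(2) compress_mono[OF D_subset] by blast
    have w: "(w, w') \<in> compress D'"
      using subspace_diff[OF sub b' u] by (simp add: w_def w'_def)
    have 1: "norm (\<i> *\<^sub>C a + w') < \<delta>" "norm (\<i> *\<^sub>C w + a') < \<delta>"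
      using ab(3,4) by (simp_all add: w_def w'_def scaleC_diff_right algebra_simps)
    have "norm (a + w) \<le> 16 * norm (\<i> *\<^sub>C (a + w) + (a' + w'))"
      using symmetric_lower_bound[OF compress_symmetric, of "a + w" "a' + w'" 1]
        subspace_add[OF sub ab(1) w] by simp
    also have "\<i> *\<^sub>C (a + w) + (a' + w') = (\<i> *\<^sub>C a + w') + (\<i> *\<^sub>C w + a')"
      by (simp add: scaleC_add_right)
    finally have 2: "norm (a + w) \<le> 32 * \<delta>"
      using 1 norm_triangle_ineq[of "\<i> *\<^sub>C a + w'" "\<i> *\<^sub>C w + a'"] by simp
    have "norm (a - w) \<le> 16 * norm ((- \<i>) *\<^sub>C (a - w) + (a' - w'))"
      using symmetric_lower_bound[OF compress_symmetric, of "a - w" "a' - w'" "-1"]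
        subspace_diff[OF sub ab(1) w] by simp
    also have "(- \<i>) *\<^sub>C (a - w) + (a' - w') = (\<i> *\<^sub>C w + a') - (\<i> *\<^sub>C a + w')"
      by (simp add: scaleC_diff_right scaleC_minus_left)
    finally have 3: "norm (a - w) \<le> 32 * \<delta>"
      using 1 norm_triangle_ineq4[of "\<i> *\<^sub>C w + a'" "\<i> *\<^sub>C a + w'"] by simp
    have "2 *\<^sub>R w = (a + w) - (a - w)" "2 *\<^sub>R a = (a + w) + (a - w)" by (simp_all add: scaleR_2)
    then have "2 * norm w \<le> norm (a + w) + norm (a - w)" "2 * norm a \<le> norm (a + w) + norm (a - w)"
      by (metis norm_scaleR norm_triangle_ineq4 abs_numeral, metis norm_scaleR norm_triangle_ineq abs_numeral)
    then have 4: "norm w \<le> 32 * \<delta>" "norm a \<le> 32 * \<delta>" using 2 3 by auto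
    have "norm w' \<le> norm (\<i> *\<^sub>C a + w') + norm (\<i> *\<^sub>C a)"
      using norm_triangle_ineq4[of "\<i> *\<^sub>C a + w'" "\<i> *\<^sub>C a"] by simp
    then have "norm w' < 33 * \<delta>" using 1 4 by (simp add: norm_scaleC)
    moreover have "dist (b, b') (u, u') \<le> norm w + norm w'"
      using norm_Pair_le[of "b - u" "b' - u'"] by (simp add: dist_norm w_def w'_def)
    ultimately have "dist (b, b') (u, u') < e" using 4 \<open>\<delta> > 0\<close> by (simp add: \<delta>_def)
    then show "\<exists>p\<in>compress D. dist p (u, u') < e" using ab(2) by blast
  qed
qed

text \<open>The closure of \<open>x D x\<^sup>*\<close>; starting from \<open>D\<close> or from \<open>D\<^sup>*\<close> makes no difference.\<close>

definition compression :: "('e \<times> 'e) set" where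
  "compression = closure (compress D)"

lemma compression_eq: "compression = closure (compress D')"
  unfolding compression_def
  by (intro antisym closure_mono compress_mono D_subset closure_minimal
      compress_adjoint_subset_closure closed_closure)

lemma compression_symmetric: "symmetric_on ip UNIV compression"
  unfolding compression_eq by (intro symmetric_closure compress_symmetric)

lemma subspace_compression: "subspace compression"
  unfolding compression_def by (intro subspace_closure subspace_compress D_subspace)

lemma compression_surj:
  assumes "\<mu> \<noteq> 0"
  shows "Range (op_add (scaleC (\<i> * complex_of_real \<mu>)) compression) = UNIV"
proof -
  let ?R = "Range (op_add (scaleC (\<i> * complex_of_real \<mu>)) compression)"
  have "closed ?R"
    by (rule symmetric_range_closed[OF compression_symmetric subspace_compression _ assms])
      (simp add: compression_def)
  moreover have "Range (op_add (scaleC (\<i> * complex_of_real \<mu>)) (compress D')) \<subseteq> ?R"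
    using closure_subset[of "compress D'"] by (auto simp: compression_eq op_add_def)
  ultimately have "closure (Range (op_add (scaleC (\<i> * complex_of_real \<mu>)) (compress D'))) \<subseteq> ?R"
    by (rule closure_minimal[rotated])
  then show ?thesis using compress_range_dense[OF assms] by auto
qed

text \<open>The right-hand side is contained in the left one, which is a closed operator extending \<open>x D x\<^sup>*\<close>.
  Conversely, the left operator is contained in the adjoint of \<open>x D x\<^sup>*\<close>, and \<open>i\<close> plus the right one is
  already onto; the argument is that of selfadjointness.\<close>

lemma compression_formula:
  "op_add (\<lambda>\<xi>. - dx (y \<xi>)) (op_comp D (x \<circ> y)) = compression" (is "?T = _")
proof
  have T_iff: "(\<xi>, \<zeta>) \<in> ?T \<longleftrightarrow> (x (y \<xi>), \<zeta> + dx (y \<xi>)) \<in> D" for \<xi> \<zeta>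
    by (auto simp: op_add_iff op_comp_def)
  have "compress D' \<subseteq> ?T"
    unfolding compress_def by (auto simp: T_iff intro!: x_comm y_comm_adjoint)
  moreover have "closed ?T"
  proof -
    have "?T = (\<lambda>p. (x (y (fst p)), snd p + dx (y (fst p)))) -` D" by (auto simp: T_iff)
    moreover have "continuous_on UNIV (\<lambda>p. (x (y (fst p)), snd p + dx (y (fst p))))"
      by (intro continuous_intros bounded_linear.continuous_on[OF x_bl]
          bounded_linear.continuous_on[OF y_bl] bounded_linear.continuous_on[OF dx_bl])
    ultimately show ?thesis using closed_vimage[OF D_closed] by metis
  qed
  ultimately show sup: "compression \<subseteq> ?T" unfolding compression_eq by (rule closure_minimal)
  show "?T \<subseteq> compression"
  proof clarify
    fix \<xi> \<xi>' assume \<xi>: "(\<xi>, \<xi>') \<in> ?T"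
    have adj: "ip \<zeta>' c = ip \<zeta> c'" if \<zeta>: "(\<zeta>, \<zeta>') \<in> ?T" and c: "(c, c') \<in> compress D'" for \<zeta> \<zeta>' c c'
    proof -
      obtain c0 where c0: "(c, c0) \<in> D'" "c' = x (y c0 + dy c)" using c by (auto simp: compress_def)
      have "(x (y \<zeta>), \<zeta>' + dx (y \<zeta>)) \<in> D" using \<zeta> by (simp add: T_iff)
      from adjoint_onD[OF this c0(1)]
      have "ip \<zeta>' c = ip (y \<zeta>) (y c0) + ip (y \<zeta>) (dy c)"
        by (simp add: form_add_left xy_adjoint dx_adjoint algebra_simps)
      then show ?thesis by (simp add: c0(2) form_add_right flip: yx_adjoint)
    qed
    let ?z = "\<i> * complex_of_real 1"
    have "?z *\<^sub>C \<xi> + \<xi>' \<in> Range (op_add (scaleC ?z) compression)"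
      using compression_surj[of 1] by simp
    then obtain u u' where u: "(u, u') \<in> compression" "?z *\<^sub>C \<xi> + \<xi>' = ?z *\<^sub>C u + u'"
      unfolding Range_iff op_add_iff by blast
    define w where "w = \<xi> - u"
    have w': "\<xi>' - u' = (- \<i>) *\<^sub>C w"
      using u(2) by (simp add: w_def scaleC_diff_right scaleC_minus_left algebra_simps)
    have "ip w s = 0" if s: "s \<in> Range (op_add (scaleC (\<i> * complex_of_real (-1))) (compress D'))" for s
    proof -
      obtain c c' where c: "(c, c') \<in> compress D'" "s = (- \<i>) *\<^sub>C c + c'"
        using s by (auto simp: Range_iff op_add_iff)
      have "ip (\<xi>' - u') c = ip w c'"
        using adj[OF \<xi> c(1)] adj[OF subsetD[OF sup u(1)] c(1)] by (simp add: w_def form.diff_left)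
      then show ?thesis
        unfolding w' by (simp add: c(2) form_scaleC_left form_scaleC_right scaleC_minus_left
            form.minus_left form.diff_right)
    qed
    from orthogonal_dense_eq_0[OF compress_range_dense[of "-1"] this] have "w = 0" by simp
    then show "(\<xi>, \<xi>') \<in> compression" using u(1) w' by (simp add: w_def)
  qed
qed

end

section \<open>The localization\<close>

context localization_data
begin

abbreviation Ex :: "'e set" where "Ex \<equiv> loc_module x"

lemma range_subset_Ex: "x \<xi> \<in> Ex"
  using closure_subset[of "range x"] by (auto simp: loc_module_def)

lemma closed_Ex: "closed Ex"
  by (simp add: loc_module_def)

lemma subspace_Ex: "subspace Ex"
  unfolding loc_module_def
  using linear_subspace_image[OF bounded_linear.linear[OF x_bl] subspace_UNIV]
  by (rule subspace_closure)

lemma scaleC_Ex: "u \<in> Ex \<Longrightarrow> z *\<^sub>C u \<in> Ex"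
  unfolding loc_module_def
  by (rule closure_invariant[OF bounded_linear.continuous_on[OF bounded_linear_scaleC continuous_on_id]])
    (auto simp flip: x_scaleC)

lemma Domain_image_dense: "closure (x ` Domain D) = Ex"
proof
  show "closure (x ` Domain D) \<subseteq> Ex"
    unfolding loc_module_def by (intro closure_mono) auto
  have "x ` closure (Domain D) \<subseteq> closure (x ` Domain D)"
    by (intro image_closure_subset bounded_linear.continuous_on[OF x_bl] continuous_on_id closure_subset)
      simp
  then show "Ex \<subseteq> closure (x ` Domain D)"
    unfolding loc_module_def Domain_dense by (rule closure_minimal) simp
qed

text \<open>The restriction of \<open>x D x\<^sup>*\<close> to \<open>x (Dom D)\<close>, whose closure turns out to be the localization.\<close>

definition loc_core :: "('e \<times> 'e) set" where
  "loc_core = compress D \<inter> (x ` Domain D) \<times> UNIV"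

lemma subspace_loc_core: "subspace loc_core"
proof -
  have "subspace (Domain D)"
    using linear_subspace_image[OF _ D_subspace, of fst]
    by (simp add: Domain_fst linear_iff)
  then have "subspace (x ` Domain D)"
    using linear_subspace_image bounded_linear.linear[OF x_bl] by blast
  then show ?thesis unfolding loc_core_def
    by (intro subspace_inter subspace_compress D_subspace subspace_Times subspace_UNIV)
qed

lemma compress_subset_compression: "compress D \<subseteq> compression"
  by (simp add: compression_def closure_subset)

lemma loc_core_symmetric: "symmetric_on ip UNIV (closure loc_core)"
  and loc_core_subset: "closure loc_core \<subseteq> compression"
proof -
  show sub: "closure loc_core \<subseteq> compression"
    unfolding compression_def loc_core_def by (intro closure_mono) auto
  then show "symmetric_on ip UNIV (closure loc_core)"
    using compression_symmetric unfolding symmetric_iff by blast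
qed

lemma closure_compress_Ex_subset: "closure (compress D \<inter> Ex \<times> UNIV) \<subseteq> Ex \<times> Ex"
  by (rule closure_minimal) (auto simp: compress_def range_subset_Ex closed_Times closed_Ex)

lemma loc_core_subset_localization: "closure loc_core \<subseteq> closure (compress D \<inter> Ex \<times> UNIV)"
  unfolding loc_core_def by (intro closure_mono) (auto simp: range_subset_Ex)

text \<open>With the roles of \<open>x\<close> and \<open>y\<close> exchanged, \<open>i\<nu>\<close> plus the closure of \<open>y D x\<close> maps onto \<open>E\<close>. For large
  \<open>\<nu>\<close> this remains true after adding \<open>dy x\<close>, and the result extends \<open>i\<nu> + D y x\<close>. The map \<open>\<Phi>\<close> applies \<open>x\<close> to the values of this
  operator; on \<open>Dom D\<close> these are values of \<open>i\<nu> + x D y\<close> at points of \<open>x (Dom D)\<close>.\<close>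

lemma loc_core_surj:
  assumes \<mu>: "\<mu> \<noteq> 0"
  shows "Ex \<subseteq> Range (op_add (scaleC (\<i> * complex_of_real \<mu>)) (closure loc_core))"
proof -
  interpret S: localization_data act ip D y x dy dx by (rule swap)
  have bl: "bounded_linear (\<lambda>u. dy (x u))" by (rule bounded_linear_compose[OF dy_bl x_bl])
  obtain p where p: "p > 0" "\<And>u. norm (dy (x u)) \<le> norm u * p"
    using bounded_linear.pos_bounded[OF bl] by auto
  \<comment> \<open>\<open>16 = K\<^sup>2\<close> is the constant of the lower bound, so \<open>16 p < \<bar>\<nu>\<bar>\<close> makes the perturbation small.\<close>
  define \<nu> where "\<nu> = sgn \<mu> * (16 * p + 1)"
  have \<nu>: "\<bar>\<nu>\<bar> = 16 * p + 1" "\<nu> \<noteq> 0" "\<nu> * \<mu> > 0"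
    using \<mu> p(1) by (auto simp: \<nu>_def abs_mult sgn_if zero_less_mult_iff)
  let ?z = "\<i> * complex_of_real \<nu>"
  let ?R = "Range (op_add (scaleC ?z) loc_core)"
  have onto: "UNIV \<subseteq> Range (op_add (\<lambda>u. dy (x u)) (op_add (scaleC ?z) S.compression))"
  proof (rule range_perturbation[of _ _ "16 / \<bar>\<nu>\<bar>" _ p])
    show "subspace (op_add (scaleC ?z) S.compression)"
      by (rule subspace_op_add[OF S.subspace_compression bounded_linear.linear[OF bounded_linear_scaleC]])
    show "UNIV \<subseteq> Range (op_add (scaleC ?z) S.compression)"
      using S.compression_surj[OF \<nu>(2)] by simp
    show "norm u \<le> 16 / \<bar>\<nu>\<bar> * norm w" if mem: "(u, w) \<in> op_add (scaleC ?z) S.compression" for u w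
    proof -
      obtain u' where "(u, u') \<in> S.compression" "w = ?z *\<^sub>C u + u'"
        using mem unfolding op_add_iff by blast
      then show ?thesis
        using symmetric_lower_bound[OF S.compression_symmetric, of u u' \<nu>] \<nu>(2)
        by (simp add: field_simps)
    qed
    show "p * (16 / \<bar>\<nu>\<bar>) < 1" using p(1) by (simp add: \<nu>(1) field_simps)
  qed (use p bl bounded_linear.linear in \<open>auto simp: mult.commute\<close>)
  define \<Phi> where "\<Phi> = (\<lambda>(u, w). x (?z *\<^sub>C u + w + dy (x u)))"
  have \<Phi>_cont: "continuous_on UNIV \<Phi>"
    unfolding \<Phi>_def case_prod_unfold
    by (intro bounded_linear.continuous_on[OF x_bl] bounded_linear.continuous_on[OF dy_bl]
        continuous_on_add bounded_linear.continuous_on[OF bounded_linear_scaleC]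
        continuous_on_fst continuous_on_snd continuous_on_id)
  have "\<Phi> ` S.compress D \<subseteq> ?R"
  proof clarify
    fix u w assume "(u, w) \<in> S.compress D"
    then obtain u' where u': "(u, u') \<in> D" "w = y (x u' + dx u)" by (auto simp: S.compress_def)
    have "(x u, x (y (x u' + dx u) + dy (x u))) \<in> loc_core"
      using compressI[OF x_comm[OF u'(1)]] u'(1) by (auto simp: loc_core_def)
    then have "?z *\<^sub>C x u + x (y (x u' + dx u) + dy (x u)) \<in> ?R" by (rule op_add_RangeI)
    then show "\<Phi> (u, w) \<in> ?R" by (simp add: \<Phi>_def u'(2) x_lin x_scaleC add.assoc)
  qed
  then have \<Phi>: "\<Phi> ` S.compression \<subseteq> closure ?R"
    unfolding S.compression_def using closure_subset[of ?R] continuous_on_subset[OF \<Phi>_cont]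
    by (intro image_closure_subset) auto
  have closed: "closed (Range (op_add (scaleC ?z) (closure loc_core)))"
    by (rule symmetric_range_closed[OF loc_core_symmetric subspace_closure[OF subspace_loc_core] _ \<nu>(2)])
      simp
  have "range x \<subseteq> Range (op_add (scaleC ?z) (closure loc_core))"
  proof clarify
    fix \<eta>
    obtain u w where uw: "(u, w) \<in> S.compression" "\<eta> = dy (x u) + (?z *\<^sub>C u + w)"
    proof -
      have "\<eta> \<in> Range (op_add (\<lambda>u. dy (x u)) (op_add (scaleC ?z) S.compression))" using onto by blast
      then show thesis using that unfolding Range_iff op_add_iff by blast
    qed
    then have "x \<eta> \<in> closure ?R" using \<Phi> by (auto simp: \<Phi>_def add.commute)
    moreover have "closure ?R \<subseteq> Range (op_add (scaleC ?z) (closure loc_core))"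
      by (intro closure_minimal closed Range_op_add_mono closure_subset)
    ultimately show "x \<eta> \<in> Range (op_add (scaleC ?z) (closure loc_core))" by blast
  qed
  then have at_\<nu>: "Ex \<subseteq> Range (op_add (scaleC ?z) (closure loc_core))"
    unfolding loc_module_def using closed by (rule closure_minimal)
  show ?thesis
  proof (rule symmetric_range_all[OF loc_core_symmetric subspace_closure[OF subspace_loc_core]
        closed_Ex subspace_Ex _ at_\<nu> \<nu>(3)])
    show "z *\<^sub>C u \<in> Ex" if "u \<in> Domain (closure loc_core)" for u z
      using that loc_core_subset_localization closure_compress_Ex_subset scaleC_Ex by blast
  qed
qed

text \<open>Adding \<open>i\<close> makes the smaller operator onto \<open>E\<^sub>x\<close> and the larger one injective.\<close>

lemma localization_eq_closure_core: "closure (compress D \<inter> Ex \<times> UNIV) = closure loc_core"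
proof
  show "closure (compress D \<inter> Ex \<times> UNIV) \<subseteq> closure loc_core"
  proof clarify
    fix \<xi> \<xi>' assume \<xi>: "(\<xi>, \<xi>') \<in> closure (compress D \<inter> Ex \<times> UNIV)"
    let ?z = "\<i> * complex_of_real 1"
    have "\<xi> \<in> Ex" "\<xi>' \<in> Ex" using \<xi> closure_compress_Ex_subset by auto
    then have "?z *\<^sub>C \<xi> + \<xi>' \<in> Ex" by (intro subspace_add[OF subspace_Ex] scaleC_Ex)
    then have "?z *\<^sub>C \<xi> + \<xi>' \<in> Range (op_add (scaleC ?z) (closure loc_core))"
      using loc_core_surj[OF one_neq_zero] by blast
    then obtain u u' where u: "(u, u') \<in> closure loc_core" "?z *\<^sub>C \<xi> + \<xi>' = ?z *\<^sub>C u + u'"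
      unfolding Range_iff op_add_iff by blast
    have "closure (compress D \<inter> Ex \<times> UNIV) \<subseteq> compression"
      unfolding compression_def by (intro closure_mono) auto
    then have "(\<xi>, \<xi>') \<in> compression" "(u, u') \<in> compression" using \<xi> u(1) loc_core_subset by blast+
    from symmetric_inj[OF compression_symmetric subspace_compression one_neq_zero this u(2)]
    show "(\<xi>, \<xi>') \<in> closure loc_core" using u(1) by simp
  qed
qed (rule loc_core_subset_localization)

end

theorem proposition11:
  fixes act :: "'e::complex_banach \<Rightarrow> 'b::cstar_algebra \<Rightarrow> 'e"
    and ip :: "'e \<Rightarrow> 'e \<Rightarrow> 'b"
    and D :: "('e \<times> 'e) set"
    and x dx dxs :: "'e \<Rightarrow> 'e"
  assumes "hilbert_module act ip"
    and "countably_generated act"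
    and "sigma_unital TYPE('b)"
    and "unbounded_operator_on act UNIV D"
    and "closed D"
    and "symmetric_on ip UNIV D"
    and "regular_on ip UNIV D"
    and "bounded_operator act x"
    and "adjointable ip x"
    and "x ` Domain (adjoint_on ip UNIV D) \<subseteq> Domain D"
    and "adj ip x ` Domain (adjoint_on ip UNIV D) \<subseteq> Domain D"
    and "bounded_operator act dx"
    and "\<forall>\<xi>\<in>Domain D. dx \<xi> = app D (x \<xi>) - x (app D \<xi>)"
    and "bounded_operator act dxs"
    and "\<forall>\<xi>\<in>Domain D. dxs \<xi> = app D (adj ip x \<xi>) - adj ip x (app D \<xi>)"
  shows "let
      Ex = loc_module x;
      Dx = localization ip x D;
      \<Delta> = x \<circ> adj ip x;
      T = op_add (\<lambda>\<xi>. - dx (adj ip x \<xi>)) (op_comp D \<Delta>)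
    in
      unbounded_operator_on act Ex Dx \<and> selfadjoint_on ip Ex Dx \<and> regular_on ip Ex Dx \<and>
      core (x ` Domain D) Dx \<and>
      (\<forall>\<mu>::real. \<mu> \<noteq> 0 \<longrightarrow>
        bijective_onto Ex (op_add (scaleC (\<i> * complex_of_real \<mu>)) Dx) \<and>
        bijective_onto UNIV (op_add (scaleC (\<i> * complex_of_real \<mu>)) T) \<and>
        (\<forall>\<xi>\<in>Ex. app ((op_add (scaleC (\<i> * complex_of_real \<mu>)) Dx)\<inverse>) \<xi> =
                app ((op_add (scaleC (\<i> * complex_of_real \<mu>)) T)\<inverse>) \<xi>) \<and>
        invariant_submodule act ((op_add (scaleC (\<i> * complex_of_real \<mu>)) T)\<inverse>) Ex)"
proof -
  interpret hilbert_module act ip by fact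
  define y where "y = adj ip x"
  note D_op = \<open>unbounded_operator_on act UNIV D\<close>[unfolded unbounded_operator_on_def]
  have D_add: "(\<xi> + \<eta>, \<xi>' + \<eta>') \<in> D" if "(\<xi>, \<xi>') \<in> D" "(\<eta>, \<eta>') \<in> D" for \<xi> \<xi>' \<eta> \<eta>'
    using D_op that by blast
  have D_scaleC: "(z *\<^sub>C \<xi>, z *\<^sub>C \<xi>') \<in> D" if "(\<xi>, \<xi>') \<in> D" for \<xi> \<xi>' z
    using D_op that by blast
  have D_act: "(act \<xi> b, act \<xi>' b) \<in> D" if "(\<xi>, \<xi>') \<in> D" for \<xi> \<xi>' b
    using D_op that by blast
  have D_sv: "single_valued D" and D0: "(0, 0) \<in> D" using D_op by blast+
  have D_sub: "subspace D"
    by (auto simp: subspace_def zero_prod_def D0 D_add D_scaleC scaleR_scaleC)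
  have x: "bounded_linear x" "\<And>z \<xi>. x (z *\<^sub>C \<xi>) = z *\<^sub>C x \<xi>" "\<And>\<xi> b. x (act \<xi> b) = act (x \<xi>) b"
    using \<open>bounded_operator act x\<close> by (auto simp: bounded_operator_def)
  have y: "bounded_linear y" "\<And>z \<xi>. y (z *\<^sub>C \<xi>) = z *\<^sub>C y \<xi>" "\<And>\<xi> b. y (act \<xi> b) = act (y \<xi>) b"
    using bounded_operator_adj[OF \<open>bounded_operator act x\<close> \<open>adjointable ip x\<close>]
    by (auto simp: bounded_operator_def y_def)
  have dx: "bounded_linear dx" and dxs: "bounded_linear dxs"
    "\<And>z \<xi>. dxs (z *\<^sub>C \<xi>) = z *\<^sub>C dxs \<xi>" "\<And>\<xi> b. dxs (act \<xi> b) = act (dxs \<xi>) b"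
    using \<open>bounded_operator act dx\<close> \<open>bounded_operator act dxs\<close> by (auto simp: bounded_operator_def)
  have D_subset: "Domain D \<subseteq> Domain (adjoint_on ip UNIV D)"
    using \<open>symmetric_on ip UNIV D\<close> by (auto simp: symmetric_on_def)
  have comm: "(f u, f u' + df u) \<in> D"
    if "f ` Domain (adjoint_on ip UNIV D) \<subseteq> Domain D" "\<forall>\<xi>\<in>Domain D. df \<xi> = app D (f \<xi>) - f (app D \<xi>)"
      "(u, u') \<in> D" for f df u u'
  proof -
    have "f u \<in> Domain D" using that(1,3) D_subset by blast
    then obtain v where v: "(f u, v) \<in> D" by blast
    have "df u = v - f u'"
      using that(2,3) app_eqI[OF D_sv v] app_eqI[OF D_sv that(3)] by auto
    then show ?thesis using v by simp
  qed
  interpret localization_data act ip D x y dx dxs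
  proof (intro localization_data.intro localization_data_axioms.intro)
    show "(x u, x u' + dx u) \<in> D" if "(u, u') \<in> D" for u u'
      by (rule comm[OF _ _ that]) fact+
    show "(y u, y u' + dxs u) \<in> D" if "(u, u') \<in> D" for u u'
      unfolding y_def by (rule comm[OF _ _ that]) fact+
    show "ip (x \<xi>) \<eta> = ip \<xi> (y \<eta>)" for \<xi> \<eta>
      unfolding y_def by (rule ip_adj) fact
    show "x u \<in> Domain D" if "u \<in> Domain (adjoint_on ip UNIV D)" for u
      using that \<open>x ` Domain (adjoint_on ip UNIV D) \<subseteq> Domain D\<close> by blast
    show "y u \<in> Domain D" if "u \<in> Domain (adjoint_on ip UNIV D)" for u
      using that \<open>adj ip x ` Domain (adjoint_on ip UNIV D) \<subseteq> Domain D\<close> unfolding y_def by blast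
  qed (rule hilbert_module_axioms D_sub x(1,2) y(1,2) dx dxs(1) \<open>closed D\<close>
      \<open>symmetric_on ip UNIV D\<close> \<open>regular_on ip UNIV D\<close> | erule D_scaleC)+
  define Dx where "Dx = localization ip x D"
  define T where "T = op_add (\<lambda>\<xi>. - dx (y \<xi>)) (op_comp D (x \<circ> y))"
  have T: "T = compression" unfolding T_def by (rule compression_formula)
  have Dx_Ex: "Dx = closure (compress D \<inter> Ex \<times> UNIV)"
  proof -
    have app: "x (app D (y \<xi>)) = x (y \<xi>' + dxs \<xi>)" if "(\<xi>, \<xi>') \<in> D" for \<xi> \<xi>'
      using app_eqI[OF D_sv y_comm[OF that]] by simp
    have "{(\<xi>, x (app D (y \<xi>))) |\<xi>. \<xi> \<in> Domain D \<inter> Ex} = compress D \<inter> Ex \<times> UNIV"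
    proof (intro set_eqI iffI)
      fix p assume "p \<in> {(\<xi>, x (app D (y \<xi>))) |\<xi>. \<xi> \<in> Domain D \<inter> Ex}"
      then obtain \<xi> \<xi>' where "p = (\<xi>, x (app D (y \<xi>)))" "(\<xi>, \<xi>') \<in> D" "\<xi> \<in> Ex" by blast
      then show "p \<in> compress D \<inter> Ex \<times> UNIV" using app compressI by simp
    next
      fix p assume "p \<in> compress D \<inter> Ex \<times> UNIV"
      then obtain \<xi> \<xi>' where p: "p = (\<xi>, x (y \<xi>' + dxs \<xi>))" "(\<xi>, \<xi>') \<in> D" "\<xi> \<in> Ex"
        by (auto simp: compress_def)
      then have "p = (\<xi>, x (app D (y \<xi>)))" by (simp add: app)
      then show "p \<in> {(\<xi>, x (app D (y \<xi>))) |\<xi>. \<xi> \<in> Domain D \<inter> Ex}" using p(2,3) by blast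
    qed
    then show ?thesis by (simp add: Dx_def localization_def y_def)
  qed
  then have Dx: "Dx = closure loc_core" by (simp add: localization_eq_closure_core)
  have Dx_sub: "Dx \<subseteq> Ex \<times> Ex" unfolding Dx_Ex by (rule closure_compress_Ex_subset)
  have Dx_T: "Dx \<subseteq> T" unfolding Dx T by (rule loc_core_subset)
  have Dx_subspace: "subspace Dx" unfolding Dx by (intro subspace_closure subspace_loc_core)
  have Dx_sym: "symmetric_on ip UNIV Dx" unfolding Dx by (rule loc_core_symmetric)
  have Dx_surj: "Ex \<subseteq> Range (op_add (scaleC (\<i> * complex_of_real \<mu>)) Dx)" if "\<mu> \<noteq> 0" for \<mu>
    unfolding Dx by (rule loc_core_surj[OF that])
  have T_sv: "single_valued T"
  proof -
    have "Domain D \<subseteq> Domain T" using compress_subset_compression compressI[of _ _ D] unfolding T by blast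
    then have "closure (Domain T) = UNIV" using closure_mono Domain_dense by blast
    then show ?thesis unfolding T
      by (rule symmetric_single_valued[OF compression_symmetric subspace_compression])
  qed
  have Dx_sv: "single_valued Dx" using T_sv Dx_T by (rule single_valued_subset[rotated])
  have core_dom: "x ` Domain D \<subseteq> Domain loc_core"
  proof clarify
    fix u u' assume "(u, u') \<in> D"
    then show "x u \<in> Domain loc_core"
      using compressI[OF x_comm] by (fastforce simp: loc_core_def)
  qed
  have core_Dx: "loc_core \<subseteq> Dx" unfolding Dx by (rule closure_subset)
  have Dx_scaleC: "(z *\<^sub>C u, z *\<^sub>C u') \<in> Dx" if "(u, u') \<in> Dx" for u u' z
  proof -
    have "(z *\<^sub>C v, z *\<^sub>C v') \<in> compress D" if mem: "(v, v') \<in> compress D" for v v'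
    proof -
      obtain w where w: "(v, w) \<in> D" "v' = x (y w + dxs v)" using mem by (auto simp: compress_def)
      from compressI[OF D_scaleC[OF w(1), of z]] show ?thesis
        by (simp add: w(2) x(2) y(2) dxs(2) x_lin(1) scaleC_add_right)
    qed
    then have "z *\<^sub>C p \<in> compress D \<inter> Ex \<times> UNIV" if "p \<in> compress D \<inter> Ex \<times> UNIV" for p
      using that scaleC_Ex by (cases p) auto
    then have "z *\<^sub>C (u, u') \<in> Dx"
      using that unfolding Dx_Ex
      by (intro closure_invariant[OF bounded_linear.continuous_on[OF bounded_linear_scaleC continuous_on_id]]) auto
    then show ?thesis by simp
  qed
  have Ex_act: "act u b \<in> Ex" if "u \<in> Ex" for u b
    using that unfolding loc_module_def
    by (intro closure_invariant[OF bounded_linear.continuous_on[OF bounded_linear_act continuous_on_id]])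
      (auto simp flip: x(3))
  have Dx_act: "(act u b, act u' b) \<in> Dx" if "(u, u') \<in> Dx" for u u' b
  proof -
    let ?f = "\<lambda>p. (act (fst p) b, act (snd p) b)"
    have "(act v b, act v' b) \<in> compress D" if mem: "(v, v') \<in> compress D" for v v'
    proof -
      obtain w where w: "(v, w) \<in> D" "v' = x (y w + dxs v)" using mem by (auto simp: compress_def)
      from compressI[OF D_act[OF w(1), of b]] show ?thesis
        by (simp add: w(2) x(3) y(3) dxs(3) x_lin(1) act_add_left)
    qed
    then have "?f p \<in> compress D \<inter> Ex \<times> UNIV" if "p \<in> compress D \<inter> Ex \<times> UNIV" for p
      using that Ex_act by (cases p) auto
    then have "?f (u, u') \<in> Dx"
      using that unfolding Dx_Ex
      by (intro closure_invariant[of ?f] continuous_on_Pair continuous_on_fst continuous_on_snd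
          continuous_on_id bounded_linear.continuous_on[OF bounded_linear_act]) auto
    then show ?thesis by simp
  qed
  have 1: "unbounded_operator_on act Ex Dx"
    unfolding unbounded_operator_on_def
  proof (intro conjI allI impI)
    show "(0, 0) \<in> Dx" using subspace_0[OF Dx_subspace] by (simp add: zero_prod_def)
    show "(u + v, u' + v') \<in> Dx" if "(u, u') \<in> Dx" "(v, v') \<in> Dx" for u u' v v'
      using subspace_add[OF Dx_subspace that] by simp
  qed (rule Dx_sub Dx_sv | erule Dx_scaleC Dx_act)+
  have 2: "selfadjoint_on ip Ex Dx"
    by (rule selfadjoint_of_surj[OF Dx_sym Dx_sub subspace_Ex scaleC_Ex Dx_surj])
  have dense: "densely_defined_on Ex Dx"
  proof -
    have "Ex \<subseteq> closure (Domain Dx)"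
      using closure_mono[OF order_trans[OF core_dom Domain_mono[OF core_Dx]]] Domain_image_dense by simp
    moreover have "closure (Domain Dx) \<subseteq> Ex"
      using Dx_sub by (intro closure_minimal closed_Ex) auto
    ultimately show ?thesis by (simp add: densely_defined_on_def)
  qed
  have 3: "regular_on ip Ex Dx"
    by (rule regular_of_surj[OF 2 _ Dx_sub dense Dx_subspace Dx_scaleC closed_Ex subspace_Ex Dx_surj])
      (simp_all add: Dx)
  have 4: "core (x ` Domain D) Dx"
    unfolding core_def
  proof (intro conjI antisym)
    show "x ` Domain D \<subseteq> Domain Dx" using core_dom Domain_mono[OF core_Dx] by blast
    show "closure (Dx \<inter> x ` Domain D \<times> UNIV) \<subseteq> Dx"
      by (intro closure_minimal) (auto simp: Dx)
    show "Dx \<subseteq> closure (Dx \<inter> x ` Domain D \<times> UNIV)"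
      using core_Dx unfolding Dx by (intro closure_mono) (auto simp: loc_core_def)
  qed
  have 5: "bijective_onto Ex (op_add (scaleC (\<i> * complex_of_real \<mu>)) Dx) \<and>
        bijective_onto UNIV (op_add (scaleC (\<i> * complex_of_real \<mu>)) T) \<and>
        (\<forall>\<xi>\<in>Ex. app ((op_add (scaleC (\<i> * complex_of_real \<mu>)) Dx)\<inverse>) \<xi> =
                app ((op_add (scaleC (\<i> * complex_of_real \<mu>)) T)\<inverse>) \<xi>) \<and>
        invariant_submodule act ((op_add (scaleC (\<i> * complex_of_real \<mu>)) T)\<inverse>) Ex"
    if \<mu>: "\<mu> \<noteq> 0" for \<mu> :: real
  proof -
    let ?z = "\<i> * complex_of_real \<mu>"
    have svT: "single_valued ((op_add (scaleC ?z) T)\<inverse>)"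
      unfolding T by (rule symmetric_single_valued_inverse[OF compression_symmetric subspace_compression \<mu>])
    have svDx: "single_valued ((op_add (scaleC ?z) Dx)\<inverse>)"
      by (rule symmetric_single_valued_inverse[OF Dx_sym Dx_subspace \<mu>])
    have inv: "\<exists>u\<in>Ex. (\<xi>, u) \<in> (op_add (scaleC ?z) Dx)\<inverse> \<and> (\<xi>, u) \<in> (op_add (scaleC ?z) T)\<inverse>"
      if \<xi>: "\<xi> \<in> Ex" for \<xi>
    proof -
      obtain u u' where u: "(u, u') \<in> Dx" "\<xi> = ?z *\<^sub>C u + u'"
        using Dx_surj[OF \<mu>] \<xi> unfolding subset_iff Range_iff op_add_iff by metis
      then have "(u, u') \<in> T" "u \<in> Ex" using Dx_T Dx_sub by auto
      then show ?thesis using u unfolding converse_iff op_add_iff by blast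
    qed
    have "Range (op_add (scaleC ?z) Dx) \<subseteq> Ex"
      using Dx_sub scaleC_Ex subspace_add[OF subspace_Ex] by (fastforce simp: op_add_def)
    then have "bijective_onto Ex (op_add (scaleC ?z) Dx)"
      using single_valued_op_add[OF Dx_sv] svDx Dx_surj[OF \<mu>] unfolding bijective_onto_def by blast
    moreover have "bijective_onto UNIV (op_add (scaleC ?z) T)"
      using single_valued_op_add[OF T_sv] svT compression_surj[OF \<mu>] unfolding bijective_onto_def T by blast
    moreover have "\<forall>\<xi>\<in>Ex. app ((op_add (scaleC ?z) Dx)\<inverse>) \<xi> = app ((op_add (scaleC ?z) T)\<inverse>) \<xi>"
      using inv app_eqI[OF svDx] app_eqI[OF svT] by metis
    moreover have "(op_add (scaleC ?z) T)\<inverse> `` Ex \<subseteq> Ex"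
    proof clarify
      fix \<xi> v assume "\<xi> \<in> Ex" "(v, \<xi>) \<in> op_add (scaleC ?z) T"
      then show "v \<in> Ex" using inv[of \<xi>] single_valuedD[OF svT] by blast
    qed
    moreover have "submodule act Ex"
      unfolding submodule_def using subspace_0[OF subspace_Ex] subspace_add[OF subspace_Ex] scaleC_Ex Ex_act
      by blast
    ultimately show ?thesis using closed_Ex by (simp add: invariant_submodule_def)
  qed
  show ?thesis
    unfolding Let_def y_def[symmetric] Dx_def[symmetric] T_def[symmetric] using 1 2 3 4 5 by blast
qed

end
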